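(* Let $\alpha,K>0$, $\beta\in(0,1]$, and let $p^\star=e^{-u+a}$ be an $(\alpha,\beta,K)$-weakly log-concave probability density on $\mathbb R^d$. Let $f,\sigma\in C^1_{\text{a.e.}}([0,1],[0,1])$ with $f$ increasing, $f_0=0$, $f_1=1$, and $\sigma$ decreasing, $\sigma_0=1$, $\sigma_1=0$. Assume there exists $\gamma\in(0,1)$ such that $\gamma\le \sigma_{1/2}\wedge f_{1/2}$ and $f_{1-\gamma}^2\ge\sigma_{1-\gamma}$. Let $Y\sim p^\star$ and $\xi\sim\mathcal N(0,I_d)$ be independent, $X_t=f_tY+\sigma_t\xi$, and let $v_t(x)=\mathbb E[f_t'Y+\sigma_t'\xi\mid X_t=x]$ be the associated flow-matching vector field. Then there is a constant $C>0$ depending only on $\alpha,\beta,K,\gamma,\sigma_{1-\gamma}$, and not on the dimension $d$, such that for all $z\in[0,1]$, $$\int_z^1\sup_{x\in\mathbb R^d}\lambda_{\max}\big(\nabla v_t(x)\big)\,dt\le C.$$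
   Context: Weak log-concavity. For $\alpha,K>0$ and $\beta\in(0,1]$, a probability density $p$ on $\mathbb R^d$ is $(\alpha,\beta,K)$-weakly log-concave if $p=\exp(-u+a)$ where (1) $u:\mathbb R^d\to\mathbb R\cup\{+\infty\}$ is convex, $C^2$ on the interior of the support, with $\nabla^2u\succeq\alpha\,\mathrm{Id}$ there; (2) $|a(x)-a(y)|\le K\|x-y\|^\beta$ for all $x,y\in\mathbb R^d$. Explicitly, for $\sigma_t>0$, $v_t(x)=\int\big(\frac{\sigma_t'}{\sigma_t}(x-f_ty)+f_t'y\big)\rho^{t,x}(dy)$, where $\rho^{t,x}(dy)\propto p^\star(y)\exp(-\|x-f_ty\|^2/(2\sigma_t^2))\,dy$ is the law of $Y$ given $X_t=x$. Primes denote time derivatives. For a square matrix $A$, $\lambda_{\max}(A)$ is the largest eigenvalue of $(A+A^\top)/2$; $\nabla v_t$ is the Jacobian in $x$. $C^1_{\text{a.e.}}([0,1],[0,1])$ denotes absolutely continuous functions $[0,1]\to[0,1]$ that are continuously differentiable outside a closed Lebesgue-null set. Increasing and decreasing are understood strictly. *)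

theory Defs
  imports "HOL-Probability.Probability" "Jordan_Normal_Form.Char_Poly"
begin

text \<open>
  The constant of the main statement must not depend on the dimension, so the dimension \<open>d\<close> has to
  be quantified inside the formula.  Points of Euclidean \<open>d\<close>-space are therefore functions on
  \<open>{..<d}\<close> (extensional, i.e. \<open>undefined\<close> outside); the product topology and the product
  of the one-dimensional Lebesgue measures both have exactly this carrier.
\<close>

abbreviation Rd :: "nat \<Rightarrow> (nat \<Rightarrow> real) set" where
  "Rd d \<equiv> {..<d} \<rightarrow>\<^sub>E UNIV"

abbreviation Rd_top :: "nat \<Rightarrow> (nat \<Rightarrow> real) topology" where
  "Rd_top d \<equiv> product_topology (\<lambda>_. euclideanreal) {..<d}"

abbreviation Rd_leb :: "nat \<Rightarrow> (nat \<Rightarrow> real) measure" where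
  "Rd_leb d \<equiv> Pi\<^sub>M {..<d} (\<lambda>_. lborel)"

abbreviation Rd_norm :: "nat \<Rightarrow> (nat \<Rightarrow> real) \<Rightarrow> real" where
  "Rd_norm d x \<equiv> L2_set x {..<d}"

definition partial_deriv :: "nat \<Rightarrow> ((nat \<Rightarrow> real) \<Rightarrow> real) \<Rightarrow> (nat \<Rightarrow> real) \<Rightarrow> real" where
  "partial_deriv i g x = deriv (\<lambda>h. g (x(i := h))) (x i)"

primrec Ck_on :: "nat \<Rightarrow> nat \<Rightarrow> (nat \<Rightarrow> real) set \<Rightarrow> ((nat \<Rightarrow> real) \<Rightarrow> real) \<Rightarrow> bool" where
  "Ck_on d 0 S g \<longleftrightarrow> continuous_map (subtopology (Rd_top d) S) euclideanreal g"
| "Ck_on d (Suc k) S g \<longleftrightarrow>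
     continuous_map (subtopology (Rd_top d) S) euclideanreal g \<and>
     (\<forall>i<d. (\<forall>x\<in>S. (\<lambda>h. g (x(i := h))) differentiable (at (x i))) \<and>
            Ck_on d k S (partial_deriv i g))"

definition hessian_ge :: "nat \<Rightarrow> real \<Rightarrow> ((nat \<Rightarrow> real) \<Rightarrow> real) \<Rightarrow> (nat \<Rightarrow> real) \<Rightarrow> bool" where
  "hessian_ge d \<alpha> g x \<longleftrightarrow>
     (\<forall>w\<in>Rd d. (\<Sum>i<d. \<Sum>j<d. partial_deriv j (partial_deriv i g) x * w i * w j) \<ge> \<alpha> * (Rd_norm d w)\<^sup>2)"

definition convex_ereal_fun :: "nat \<Rightarrow> ((nat \<Rightarrow> real) \<Rightarrow> ereal) \<Rightarrow> bool" where
  "convex_ereal_fun d u \<longleftrightarrow>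
     (\<forall>x\<in>Rd d. \<forall>y\<in>Rd d. \<forall>r\<in>{0..1::real}.
        u (\<lambda>i\<in>{..<d}. (1 - r) * x i + r * y i) \<le> ereal (1 - r) * u x + ereal r * u y)"

definition prob_density_on :: "nat \<Rightarrow> ((nat \<Rightarrow> real) \<Rightarrow> real) \<Rightarrow> bool" where
  "prob_density_on d p \<longleftrightarrow>
     p \<in> borel_measurable (Rd_leb d) \<and> (\<forall>x\<in>Rd d. 0 \<le> p x) \<and> (\<integral>\<^sup>+x. ennreal (p x) \<partial>Rd_leb d) = 1"

text \<open>
  The set \<open>{x. 0 < p x}\<close> below is the effective domain of the convex function \<open>u\<close>.  Being convex
  and of positive measure, it has the same interior as its closure, the topological support of \<open>p\<close>.
\<close>

definition weakly_log_concave ::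
  "nat \<Rightarrow> real \<Rightarrow> real \<Rightarrow> real \<Rightarrow> ((nat \<Rightarrow> real) \<Rightarrow> real) \<Rightarrow> bool" where
  "weakly_log_concave d \<alpha> \<beta> K p \<longleftrightarrow>
     (\<exists>(u :: (nat \<Rightarrow> real) \<Rightarrow> ereal) (a :: (nat \<Rightarrow> real) \<Rightarrow> real).
        (\<forall>x\<in>Rd d. u x \<noteq> -\<infinity>) \<and>
        (\<forall>x\<in>Rd d. p x = (if u x = \<infinity> then 0 else exp (- real_of_ereal (u x) + a x))) \<and>
        convex_ereal_fun d u \<and>
        (let U = Rd_top d interior_of {x \<in> Rd d. 0 < p x}
         in Ck_on d 2 U (\<lambda>x. real_of_ereal (u x)) \<and>
            (\<forall>x\<in>U. hessian_ge d \<alpha> (\<lambda>x. real_of_ereal (u x)) x)) \<and>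
        (\<forall>x\<in>Rd d. \<forall>y\<in>Rd d. \<bar>a x - a y\<bar> \<le> K * Rd_norm d (\<lambda>i. x i - y i) powr \<beta>))"

definition absolutely_continuous_fun_on :: "real \<Rightarrow> real \<Rightarrow> (real \<Rightarrow> real) \<Rightarrow> bool" where
  "absolutely_continuous_fun_on a b f \<longleftrightarrow>
     (\<forall>\<epsilon>>0. \<exists>\<delta>>0. \<forall>(n::nat) l r.
        (\<forall>k<n. a \<le> l k \<and> l k \<le> r k \<and> r k \<le> b) \<and>
        disjoint_family_on (\<lambda>k. {l k<..<r k}) {..<n} \<and>
        (\<Sum>k<n. r k - l k) < \<delta> \<longrightarrow> (\<Sum>k<n. \<bar>f (r k) - f (l k)\<bar>) < \<epsilon>)"

definition C1_ae :: "(real \<Rightarrow> real) \<Rightarrow> bool" where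
  "C1_ae f \<longleftrightarrow>
     f \<in> {0..1} \<rightarrow> {0..1} \<and> absolutely_continuous_fun_on 0 1 f \<and>
     (\<exists>N f'. closed N \<and> N \<in> null_sets lborel \<and>
        (\<forall>t\<in>{0..1} - N. (f has_real_derivative f' t) (at t within {0..1})) \<and>
        continuous_on ({0..1} - N) f')"

abbreviation time_deriv :: "(real \<Rightarrow> real) \<Rightarrow> real \<Rightarrow> real" where
  "time_deriv f t \<equiv> vector_derivative f (at t within {0..1})"

definition posterior_weight ::
  "nat \<Rightarrow> ((nat \<Rightarrow> real) \<Rightarrow> real) \<Rightarrow> real \<Rightarrow> real \<Rightarrow> (nat \<Rightarrow> real) \<Rightarrow> (nat \<Rightarrow> real) \<Rightarrow> real" where
  "posterior_weight d p f s x y = p y * exp (- (Rd_norm d (\<lambda>i. x i - f * y i))\<^sup>2 / (2 * s\<^sup>2))"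

definition posterior ::
  "nat \<Rightarrow> ((nat \<Rightarrow> real) \<Rightarrow> real) \<Rightarrow> real \<Rightarrow> real \<Rightarrow> (nat \<Rightarrow> real) \<Rightarrow> (nat \<Rightarrow> real) measure" where
  "posterior d p f s x =
     density (Rd_leb d)
       (\<lambda>y. ennreal (posterior_weight d p f s x y / (\<integral>y'. posterior_weight d p f s x y' \<partial>Rd_leb d)))"

definition velocity ::
  "nat \<Rightarrow> ((nat \<Rightarrow> real) \<Rightarrow> real) \<Rightarrow> real \<Rightarrow> real \<Rightarrow> real \<Rightarrow> real \<Rightarrow> (nat \<Rightarrow> real) \<Rightarrow> nat \<Rightarrow> real" where
  "velocity d p f s f' s' x i = (\<integral>y. s' / s * (x i - f * y i) + f' * y i \<partial>posterior d p f s x)"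

definition flow_matching_field ::
  "nat \<Rightarrow> ((nat \<Rightarrow> real) \<Rightarrow> real) \<Rightarrow> (real \<Rightarrow> real) \<Rightarrow> (real \<Rightarrow> real) \<Rightarrow> real \<Rightarrow> (nat \<Rightarrow> real) \<Rightarrow> nat \<Rightarrow> real" where
  "flow_matching_field d p f \<sigma> t = velocity d p (f t) (\<sigma> t) (time_deriv f t) (time_deriv \<sigma> t)"

definition jacobian_mat :: "nat \<Rightarrow> ((nat \<Rightarrow> real) \<Rightarrow> nat \<Rightarrow> real) \<Rightarrow> (nat \<Rightarrow> real) \<Rightarrow> real mat" where
  "jacobian_mat d v x = mat d d (\<lambda>(i, j). partial_deriv j (\<lambda>x. v x i) x)"

definition lambda_max :: "real mat \<Rightarrow> real" where
  "lambda_max A = Max {k. eigenvalue ((1/2) \<cdot>\<^sub>m (A + transpose_mat A)) k}"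

text \<open>
  Lebesgue integral of an extended real valued function.  As \<open>\<infinity> - \<infinity> = \<infinity>\<close> in \<^typ>\<open>ereal\<close>, a
  finite upper bound on this integral entails that the positive part has finite integral.
\<close>

definition ereal_integral :: "'a measure \<Rightarrow> ('a \<Rightarrow> ereal) \<Rightarrow> ereal" where
  "ereal_integral M g =
     enn2ereal (\<integral>\<^sup>+x. e2ennreal (g x) \<partial>M) - enn2ereal (\<integral>\<^sup>+x. e2ennreal (- g x) \<partial>M)"

text \<open>
  \<open>velocity\<close> is the explicit form of the field for \<open>s > 0\<close>.  It is a version of the conditional expectation of \<open>f' Y + s' \<xi>\<close> given
  \<open>X = f Y + s \<xi>\<close>, where \<open>Y\<close> and \<open>\<xi>\<close> are realised as the coordinates of the product of the law
  of \<open>Y\<close> and the standard Gaussian (lemma \<open>velocity_is_cond_exp\<close> below).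
\<close>

definition std_gaussian :: "nat \<Rightarrow> (nat \<Rightarrow> real) measure" where
  "std_gaussian d = density (Rd_leb d) (\<lambda>z. ennreal (exp (- (Rd_norm d z)\<^sup>2 / 2) / sqrt (2 * pi) ^ d))"

definition joint_law :: "nat \<Rightarrow> ((nat \<Rightarrow> real) \<Rightarrow> real) \<Rightarrow> ((nat \<Rightarrow> real) \<times> (nat \<Rightarrow> real)) measure" where
  "joint_law d p = density (Rd_leb d) (\<lambda>y. ennreal (p y)) \<Otimes>\<^sub>M std_gaussian d"

definition interpolant ::
  "nat \<Rightarrow> real \<Rightarrow> real \<Rightarrow> (nat \<Rightarrow> real) \<times> (nat \<Rightarrow> real) \<Rightarrow> (nat \<Rightarrow> real)" where
  "interpolant d f s \<omega> = (\<lambda>i\<in>{..<d}. f * fst \<omega> i + s * snd \<omega> i)"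

lemma sigma_finite_Rd_leb: "sigma_finite_measure (Rd_leb d)"
proof -
  interpret product_sigma_finite "\<lambda>_::nat. lborel :: real measure"
    by (simp add: product_sigma_finite_def sigma_finite_lborel)
  show ?thesis by (rule sigma_finite) simp
qed

lemma Rd_leb_affine:
  fixes c :: "nat \<Rightarrow> real"
  assumes s: "s > 0"
  shows "Rd_leb d = density (distr (Rd_leb d) (Rd_leb d) (\<lambda>z. \<lambda>i\<in>{..<d}. c i + s * z i)) (\<lambda>_. ennreal (s ^ d))"
    (is "_ = density (distr _ _ ?T) _")
proof -
  interpret product_sigma_finite "\<lambda>_::nat. lborel :: real measure"
    by (simp add: product_sigma_finite_def sigma_finite_lborel)
  have T[measurable]: "?T \<in> Rd_leb d \<rightarrow>\<^sub>M Rd_leb d"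
    by measurable
  show ?thesis
  proof (rule PiM_eqI[symmetric])
    fix A :: "nat \<Rightarrow> real set" assume A: "\<And>i. i \<in> {..<d} \<Longrightarrow> A i \<in> sets lborel"
    have A'[measurable]: "Pi\<^sub>E {..<d} A \<in> sets (Rd_leb d)"
      using A by (auto intro!: sets_PiM_I_finite)
    have V: "?T -` Pi\<^sub>E {..<d} A \<inter> space (Rd_leb d) = Pi\<^sub>E {..<d} (\<lambda>i. (\<lambda>z. c i + s * z) -` A i)"
      by (auto simp: space_PiM PiE_def Pi_def extensional_def)
    have B: "(\<lambda>z. c i + s * z) -` A i \<in> sets lborel" if "i < d" for i
    proof -
      have "(\<lambda>z. c i + s * z) \<in> borel_measurable borel" by measurable
      from measurable_sets[OF this, of "A i"] A[of i] that show ?thesis by simp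
    qed
    have one: "emeasure lborel (A i) = ennreal s * emeasure lborel ((\<lambda>z. c i + s * z) -` A i)" if "i < d" for i
    proof -
      have Ai: "A i \<in> sets borel" using A[of i] that by simp
      have "emeasure lborel (A i) = emeasure (density (distr lborel borel (\<lambda>x. c i + s * x)) (\<lambda>_. ennreal \<bar>s\<bar>)) (A i)"
        using lborel_real_affine[of s "c i"] s by simp
      also have "\<dots> = ennreal s * emeasure (distr lborel borel (\<lambda>x. c i + s * x)) (A i)"
        using Ai s by (subst emeasure_density) (auto simp: nn_integral_cmult)
      also have "\<dots> = ennreal s * emeasure lborel ((\<lambda>z. c i + s * z) -` A i)"
        using Ai by (subst emeasure_distr) auto
      finally show ?thesis .
    qed
    have "emeasure (density (distr (Rd_leb d) (Rd_leb d) ?T) (\<lambda>_. ennreal (s ^ d))) (Pi\<^sub>E {..<d} A)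
        = ennreal (s ^ d) * emeasure (distr (Rd_leb d) (Rd_leb d) ?T) (Pi\<^sub>E {..<d} A)"
      by (subst emeasure_density) (auto simp: nn_integral_cmult)
    also have "\<dots> = ennreal (s ^ d) * emeasure (Rd_leb d) (Pi\<^sub>E {..<d} (\<lambda>i. (\<lambda>z. c i + s * z) -` A i))"
      by (subst emeasure_distr) (auto simp: V)
    also have "\<dots> = (\<Prod>i<d. ennreal s) * (\<Prod>i<d. emeasure lborel ((\<lambda>z. c i + s * z) -` A i))"
      using B s by (subst emeasure_PiM) (auto simp: ennreal_power)
    also have "\<dots> = (\<Prod>i<d. emeasure lborel (A i))"
      by (simp add: one prod.distrib)
    finally show "emeasure (density (distr (Rd_leb d) (Rd_leb d) ?T) (\<lambda>_. ennreal (s ^ d))) (Pi\<^sub>E {..<d} A)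
        = (\<Prod>i<d. emeasure lborel (A i))" .
  qed auto
qed

lemma nn_integral_Rd_leb_affine:
  fixes c :: "nat \<Rightarrow> real"
  assumes s: "s > 0" and h[measurable]: "h \<in> borel_measurable (Rd_leb d)"
  shows "(\<integral>\<^sup>+x. h x \<partial>Rd_leb d) = ennreal (s ^ d) * (\<integral>\<^sup>+z. h (\<lambda>i\<in>{..<d}. c i + s * z i) \<partial>Rd_leb d)"
proof -
  have [measurable]: "(\<lambda>z. \<lambda>i\<in>{..<d}. c i + s * z i) \<in> Rd_leb d \<rightarrow>\<^sub>M Rd_leb d"
    by measurable
  show ?thesis
    by (subst Rd_leb_affine[OF s, of d c])
       (simp add: nn_integral_density nn_integral_distr nn_integral_cmult)
qed

lemma Rd_norm_measurable[measurable]: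
  assumes "\<And>i. i < d \<Longrightarrow> (\<lambda>x. g x i) \<in> borel_measurable M"
  shows "(\<lambda>x. Rd_norm d (g x)) \<in> borel_measurable M"
  unfolding L2_set_def using assms by (auto intro!: borel_measurable_sum borel_measurable_power)

lemma component_measurable[measurable]:
  "i < d \<Longrightarrow> (\<lambda>x. x i) \<in> borel_measurable (Rd_leb d)"
  using measurable_component_singleton[of i "{..<d}" "\<lambda>_. lborel :: real measure"] by simp

lemma nn_integral_std_gaussian_density:
  "(\<integral>\<^sup>+z. ennreal (exp (- (Rd_norm d z)\<^sup>2 / 2) / sqrt (2 * pi) ^ d) \<partial>Rd_leb d) = 1"
proof -
  interpret product_sigma_finite "\<lambda>_::nat. lborel :: real measure"
    by (simp add: product_sigma_finite_def sigma_finite_lborel)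
  have eq: "ennreal (exp (- (Rd_norm d z)\<^sup>2 / 2) / sqrt (2 * pi) ^ d)
      = (\<Prod>i<d. ennreal (std_normal_density (z i)))" for z
  proof -
    have "(\<Prod>i<d. std_normal_density (z i)) = exp (- (Rd_norm d z)\<^sup>2 / 2) / sqrt (2 * pi) ^ d"
      by (simp add: std_normal_density_def prod_dividef L2_set_def sum_nonneg sum_negf sum_divide_distrib
            flip: exp_sum)
    then show ?thesis by (simp add: prod_ennreal)
  qed
  have "(\<integral>\<^sup>+z. (\<Prod>i<d. ennreal (std_normal_density (z i))) \<partial>Rd_leb d)
      = (\<Prod>i<d. \<integral>\<^sup>+x. ennreal (std_normal_density x) \<partial>lborel)"
    by (rule product_nn_integral_prod) auto
  also have "(\<integral>\<^sup>+x. ennreal (std_normal_density x) \<partial>lborel) = 1"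
    by (subst nn_integral_eq_integral) (auto simp: integrable_normal_density integral_normal_density)
  finally show ?thesis unfolding eq by simp
qed

lemma prob_space_joint_law:
  assumes p: "prob_density_on d p"
  shows "prob_space (joint_law d p)"
proof -
  have [measurable]: "p \<in> borel_measurable (Rd_leb d)" and p1: "(\<integral>\<^sup>+x. ennreal (p x) \<partial>Rd_leb d) = 1"
    using p by (auto simp: prob_density_on_def)
  interpret P: prob_space "density (Rd_leb d) (\<lambda>y. ennreal (p y))"
    by standard (use p1 in \<open>simp add: emeasure_density cong: nn_integral_cong\<close>)
  interpret G: prob_space "std_gaussian d"
    unfolding std_gaussian_def
    by standard (use nn_integral_std_gaussian_density[of d] in \<open>simp add: emeasure_density cong: nn_integral_cong\<close>)
  show ?thesis unfolding joint_law_def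
    by (rule prob_space_pair) (rule P.prob_space_axioms G.prob_space_axioms)+
qed

lemma posterior_weight_measurable[measurable]:
  assumes [measurable]: "p \<in> borel_measurable (Rd_leb d)"
  shows "(\<lambda>(x, y). posterior_weight d p f s x y) \<in> borel_measurable (Rd_leb d \<Otimes>\<^sub>M Rd_leb d)"
proof -
  have [measurable]: "(\<lambda>q. Rd_norm d (\<lambda>i. fst q i - f * snd q i)) \<in> borel_measurable (Rd_leb d \<Otimes>\<^sub>M Rd_leb d)"
    by (rule Rd_norm_measurable) measurable
  show ?thesis unfolding posterior_weight_def split_beta by measurable
qed

lemma interpolant_measurable[measurable]:
  "interpolant d f s \<in> joint_law d p \<rightarrow>\<^sub>M Rd_leb d"
  unfolding interpolant_def joint_law_def std_gaussian_def by measurable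

lemma distr_joint_law:
  assumes p: "prob_density_on d p" and s: "s > 0"
  shows "distr (joint_law d p) (Rd_leb d \<Otimes>\<^sub>M Rd_leb d) (\<lambda>\<omega>. (interpolant d f s \<omega>, fst \<omega>))
       = density (Rd_leb d \<Otimes>\<^sub>M Rd_leb d)
           (\<lambda>(x, y). ennreal (posterior_weight d p f s x y / (sqrt (2 * pi) * s) ^ d))"
    (is "distr ?M ?LL ?T = density _ (\<lambda>(x, y). ennreal (?w x y / ?k))")
proof (rule measure_eqI)
  have pm[measurable]: "p \<in> borel_measurable (Rd_leb d)" and p0: "\<And>x. x \<in> Rd d \<Longrightarrow> 0 \<le> p x"
    using p by (auto simp: prob_density_on_def)
  interpret L: sigma_finite_measure "Rd_leb d" by (rule sigma_finite_Rd_leb)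
  interpret LL: pair_sigma_finite "Rd_leb d" "Rd_leb d" ..
  have G: "prob_space (std_gaussian d)"
    unfolding std_gaussian_def
    by standard (use nn_integral_std_gaussian_density[of d] in \<open>simp add: emeasure_density cong: nn_integral_cong\<close>)
  interpret G: prob_space "std_gaussian d" by (rule G)
  have setsM: "sets ?M = sets ?LL"
    unfolding joint_law_def std_gaussian_def by (intro sets_pair_measure_cong) auto
  have T[measurable]: "?T \<in> ?M \<rightarrow>\<^sub>M ?LL"
  proof (intro measurable_Pair)
    show "fst \<in> ?M \<rightarrow>\<^sub>M Rd_leb d"
      unfolding measurable_cong_sets[OF setsM refl] by measurable
  qed measurable
  show "sets (distr ?M ?LL ?T) = sets (density ?LL (\<lambda>(x, y). ennreal (?w x y / ?k)))" by simp
  fix A assume "A \<in> sets (distr ?M ?LL ?T)"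
  then have A[measurable]: "A \<in> sets ?LL" by simp
  have Tm: "(\<lambda>\<omega>. indicator A (?T \<omega>) :: ennreal) \<in> borel_measurable ?M"
    using measurable_compose[OF T borel_measurable_indicator[OF A]] .
  have gm[measurable]: "(\<lambda>z. ennreal (exp (- (Rd_norm d z)\<^sup>2 / 2) / sqrt (2 * pi) ^ d)) \<in> borel_measurable (Rd_leb d)"
    by measurable
  have Im: "(\<lambda>q. indicator A (?T q) :: ennreal) \<in> borel_measurable (Rd_leb d \<Otimes>\<^sub>M Rd_leb d)"
    using Tm unfolding measurable_cong_sets[OF setsM refl] .
  have "emeasure (distr ?M ?LL ?T) A = (\<integral>\<^sup>+\<omega>. indicator A \<omega> \<partial>distr ?M ?LL ?T)" by simp
  also have "\<dots> = (\<integral>\<^sup>+\<omega>. indicator A (?T \<omega>) \<partial>?M)"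
    by (rule nn_integral_distr) measurable
  also have "\<dots> = (\<integral>\<^sup>+y. (\<integral>\<^sup>+z. indicator A (?T (y, z)) \<partial>std_gaussian d) \<partial>density (Rd_leb d) (\<lambda>y. ennreal (p y)))"
    using Tm unfolding joint_law_def by (rule G.nn_integral_fst[symmetric])
  also have "\<dots> = (\<integral>\<^sup>+y. ennreal (p y) * (\<integral>\<^sup>+z. indicator A (?T (y, z)) \<partial>std_gaussian d) \<partial>Rd_leb d)"
  proof (rule nn_integral_density)
    show "(\<lambda>y. \<integral>\<^sup>+z. indicator A (?T (y, z)) \<partial>std_gaussian d) \<in> borel_measurable (Rd_leb d)"
      using G.borel_measurable_nn_integral_fst[OF Tm[unfolded joint_law_def]] by simp
  qed measurable
  also have "\<dots> = (\<integral>\<^sup>+y. (\<integral>\<^sup>+x. ennreal (?w x y / ?k) * indicator A (x, y) \<partial>Rd_leb d) \<partial>Rd_leb d)"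
  proof (rule nn_integral_cong)
    fix y assume y: "y \<in> space (Rd_leb d)"
    then have yR: "y \<in> Rd d" by (simp add: space_PiM)
    have [measurable]: "(\<lambda>z. indicator A (?T (y, z)) :: ennreal) \<in> borel_measurable (Rd_leb d)"
      using measurable_Pair2[OF Im y] .
    have wm: "(\<lambda>x. ennreal (?w x y / ?k) * indicator A (x, y)) \<in> borel_measurable (Rd_leb d)"
      using y by measurable
    have "(\<integral>\<^sup>+x. ennreal (?w x y / ?k) * indicator A (x, y) \<partial>Rd_leb d)
        = ennreal (s ^ d) * (\<integral>\<^sup>+z. ennreal (?w (\<lambda>i\<in>{..<d}. f * y i + s * z i) y / ?k)
             * indicator A ((\<lambda>i\<in>{..<d}. f * y i + s * z i), y) \<partial>Rd_leb d)"
      by (rule nn_integral_Rd_leb_affine[OF s wm])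
    also have "\<dots> = ennreal (s ^ d) * (\<integral>\<^sup>+z. ennreal (p y / s ^ d) * (ennreal (exp (- (Rd_norm d z)\<^sup>2 / 2) / sqrt (2 * pi) ^ d)
             * indicator A (?T (y, z))) \<partial>Rd_leb d)"
    proof (rule arg_cong2[where f = "(*)", OF refl], rule nn_integral_cong)
      fix z
      have "Rd_norm d (\<lambda>i. (\<lambda>i\<in>{..<d}. f * y i + s * z i) i - f * y i) = Rd_norm d (\<lambda>i. s * z i)"
        by (rule L2_set_cong) auto
      also have "\<dots> = s * Rd_norm d z" using s by (simp add: L2_set_right_distrib)
      finally have wk: "?w (\<lambda>i\<in>{..<d}. f * y i + s * z i) y / ?k
          = (p y / s ^ d) * (exp (- (Rd_norm d z)\<^sup>2 / 2) / sqrt (2 * pi) ^ d)"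
        using s by (simp add: posterior_weight_def power_mult_distrib)
      have weight: "ennreal (?w (\<lambda>i\<in>{..<d}. f * y i + s * z i) y / ?k)
          = ennreal (p y / s ^ d) * ennreal (exp (- (Rd_norm d z)\<^sup>2 / 2) / sqrt (2 * pi) ^ d)"
        unfolding wk by (rule ennreal_mult) (use s p0[OF yR] in auto)
      show "ennreal (?w (\<lambda>i\<in>{..<d}. f * y i + s * z i) y / ?k)
             * indicator A ((\<lambda>i\<in>{..<d}. f * y i + s * z i), y)
          = ennreal (p y / s ^ d) * (ennreal (exp (- (Rd_norm d z)\<^sup>2 / 2) / sqrt (2 * pi) ^ d)
             * indicator A (?T (y, z)))"
        unfolding weight by (simp add: interpolant_def mult.assoc)
    qed
    also have "\<dots> = (ennreal (s ^ d) * ennreal (p y / s ^ d)) * (\<integral>\<^sup>+z. ennreal (exp (- (Rd_norm d z)\<^sup>2 / 2) / sqrt (2 * pi) ^ d)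
             * indicator A (?T (y, z)) \<partial>Rd_leb d)"
    proof -
      have "(\<lambda>z. ennreal (exp (- (Rd_norm d z)\<^sup>2 / 2) / sqrt (2 * pi) ^ d) * indicator A (?T (y, z))) \<in> borel_measurable (Rd_leb d)"
        by (rule borel_measurable_times_ennreal) measurable
      from nn_integral_cmult[OF this] show ?thesis by (simp only: mult.assoc)
    qed
    also have "ennreal (s ^ d) * ennreal (p y / s ^ d) = ennreal (p y)"
      using s p0[OF yR] by (simp flip: ennreal_mult)
    also have "(\<integral>\<^sup>+z. ennreal (exp (- (Rd_norm d z)\<^sup>2 / 2) / sqrt (2 * pi) ^ d)
             * indicator A (?T (y, z)) \<partial>Rd_leb d) = (\<integral>\<^sup>+z. indicator A (?T (y, z)) \<partial>std_gaussian d)"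
      unfolding std_gaussian_def by (rule nn_integral_density[symmetric]) measurable
    finally show "ennreal (p y) * (\<integral>\<^sup>+z. indicator A (?T (y, z)) \<partial>std_gaussian d)
        = (\<integral>\<^sup>+x. ennreal (?w x y / ?k) * indicator A (x, y) \<partial>Rd_leb d)" by simp
  qed
  also have "\<dots> = (\<integral>\<^sup>+q. (case q of (x, y) \<Rightarrow> ennreal (?w x y / ?k)) * indicator A q \<partial>?LL)"
    by (subst LL.nn_integral_snd[symmetric]) auto
  also have "\<dots> = emeasure (density ?LL (\<lambda>(x, y). ennreal (?w x y / ?k))) A"
    by (rule emeasure_density[symmetric]) measurable
  finally show "emeasure (distr ?M ?LL ?T) A = emeasure (density ?LL (\<lambda>(x, y). ennreal (?w x y / ?k))) A" .
qed

lemma velocity_eq: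
  assumes p: "prob_density_on d p" and x: "x \<in> Rd d" and i: "i < d"
  shows "velocity d p f s f' s' x i
       = (\<integral>y. posterior_weight d p f s x y * (s' / s * (x i - f * y i) + f' * y i) \<partial>Rd_leb d)
         / (\<integral>y. posterior_weight d p f s x y \<partial>Rd_leb d)" (is "_ = (\<integral>y. ?w y * ?H y \<partial>_) / ?Z")
    and "velocity d p f s f' s' x i * (\<integral>y. posterior_weight d p f s x y \<partial>Rd_leb d)
       = (\<integral>y. posterior_weight d p f s x y * (s' / s * (x i - f * y i) + f' * y i) \<partial>Rd_leb d)"
proof -
  have pm[measurable]: "p \<in> borel_measurable (Rd_leb d)" and p0: "\<And>x. x \<in> Rd d \<Longrightarrow> 0 \<le> p x"
    and p1: "(\<integral>\<^sup>+x. ennreal (p x) \<partial>Rd_leb d) = 1"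
    using p by (auto simp: prob_density_on_def)
  have xs: "x \<in> space (Rd_leb d)" using x by (simp add: space_PiM)
  have wm[measurable]: "?w \<in> borel_measurable (Rd_leb d)"
    using measurable_Pair2[OF posterior_weight_measurable[OF pm] xs] by simp
  have Hm[measurable]: "?H \<in> borel_measurable (Rd_leb d)" using i by measurable
  have w0: "0 \<le> ?w y" if "y \<in> Rd d" for y using p0[OF that] by (simp add: posterior_weight_def)
  have ae0: "AE y in Rd_leb d. 0 \<le> ?w y" by (rule AE_I2) (simp add: space_PiM w0)
  have pint: "integrable (Rd_leb d) p"
  proof (rule integrableI_nonneg)
    show "AE x in Rd_leb d. 0 \<le> p x" by (rule AE_I2) (simp add: space_PiM p0)
  qed (use p1 in auto)
  have wint: "integrable (Rd_leb d) ?w"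
  proof (rule Bochner_Integration.integrable_bound[OF pint wm], rule AE_I2)
    fix y assume "y \<in> space (Rd_leb d)"
    then have "0 \<le> p y" by (simp add: space_PiM p0)
    then show "norm (?w y) \<le> norm (p y)"
      by (simp add: posterior_weight_def abs_mult mult_left_le)
  qed
  have Z0: "0 \<le> ?Z" using ae0 by (rule integral_nonneg_AE)
  have "velocity d p f s f' s' x i = (\<integral>y. (?w y / ?Z) *\<^sub>R ?H y \<partial>Rd_leb d)"
    unfolding velocity_def posterior_def
  proof (rule integral_density)
    show "AE y in Rd_leb d. 0 \<le> ?w y / ?Z"
      using Z0 by (intro AE_I2 divide_nonneg_nonneg) (simp_all add: space_PiM w0)
  qed measurable
  also have "\<dots> = (\<integral>y. ?w y * ?H y \<partial>Rd_leb d) / ?Z"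
    by (simp add: mult.commute)
  finally have V: "velocity d p f s f' s' x i = (\<integral>y. ?w y * ?H y \<partial>Rd_leb d) / ?Z" .
  then show "velocity d p f s f' s' x i = (\<integral>y. ?w y * ?H y \<partial>Rd_leb d) / ?Z" .
  show "velocity d p f s f' s' x i * ?Z = (\<integral>y. ?w y * ?H y \<partial>Rd_leb d)"
  proof (cases "?Z = 0")
    case True
    then have "AE y in Rd_leb d. ?w y = 0"
      using integral_nonneg_eq_0_iff_AE[OF wint ae0] by simp
    then have "AE y in Rd_leb d. ?w y * ?H y = 0" by eventually_elim simp
    then have "(\<integral>y. ?w y * ?H y \<partial>Rd_leb d) = 0" by (rule integral_eq_zero_AE)
    with True show ?thesis by simp
  next
    case False
    then show ?thesis by (simp add: V)
  qed
qed

lemma velocity_is_cond_exp: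
  assumes p: "prob_density_on d p" and s: "s > 0" and i: "i < d"
    and int: "integrable (joint_law d p) (\<lambda>\<omega>. f' * fst \<omega> i + s' * snd \<omega> i)"
  shows "AE \<omega> in joint_law d p.
     real_cond_exp (joint_law d p)
       (vimage_algebra (space (joint_law d p)) (interpolant d f s) (Rd_leb d))
       (\<lambda>\<omega>. f' * fst \<omega> i + s' * snd \<omega> i) \<omega>
     = velocity d p f s f' s' (interpolant d f s \<omega>) i"
proof -
  let ?M = "joint_law d p" and ?X = "interpolant d f s"
  let ?F = "vimage_algebra (space ?M) ?X (Rd_leb d)"
  let ?h = "\<lambda>\<omega>. f' * fst \<omega> i + s' * snd \<omega> i" and ?V = "\<lambda>x. velocity d p f s f' s' x i"
  have pm[measurable]: "p \<in> borel_measurable (Rd_leb d)" and p0: "\<And>x. x \<in> Rd d \<Longrightarrow> 0 \<le> p x"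
    using p by (auto simp: prob_density_on_def)
  interpret L: sigma_finite_measure "Rd_leb d" by (rule sigma_finite_Rd_leb)
  interpret LL: pair_sigma_finite "Rd_leb d" "Rd_leb d" ..
  interpret M: prob_space ?M by (rule prob_space_joint_law[OF p])
  let ?LL = "Rd_leb d \<Otimes>\<^sub>M Rd_leb d"
  let ?T = "\<lambda>\<omega>. (?X \<omega>, fst \<omega>)"
  define w where "w x y = posterior_weight d p f s x y / (sqrt (2 * pi) * s) ^ d" for x y
  define H where "H x y = s' / s * (x i - f * y i) + f' * y i" for x y :: "nat \<Rightarrow> real"
  define q where "q x = (\<integral>y. w x y \<partial>Rd_leb d)" for x
  have setsM: "sets ?M = sets ?LL"
    unfolding joint_law_def std_gaussian_def by (intro sets_pair_measure_cong) auto
  have spaceM: "space ?M = Rd d \<times> Rd d"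
    using sets_eq_imp_space_eq[OF setsM] by (simp add: space_pair_measure space_PiM)
  have X[measurable]: "?X \<in> ?M \<rightarrow>\<^sub>M Rd_leb d" by measurable
  have T[measurable]: "?T \<in> ?M \<rightarrow>\<^sub>M ?LL"
  proof (intro measurable_Pair)
    show "fst \<in> ?M \<rightarrow>\<^sub>M Rd_leb d"
      unfolding measurable_cong_sets[OF setsM refl] by measurable
  qed measurable
  have wm[measurable]: "(\<lambda>(x, y). w x y) \<in> borel_measurable ?LL"
    unfolding w_def split_beta using posterior_weight_measurable[OF pm] by (simp add: split_beta)
  have Hm[measurable]: "(\<lambda>(x, y). H x y) \<in> borel_measurable ?LL"
    unfolding H_def split_beta using i by measurable
  have w0: "0 \<le> w x y" if "y \<in> Rd d" for x y
    using p0[OF that] s by (simp add: w_def posterior_weight_def)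
  have Vm[measurable]: "?V \<in> borel_measurable (Rd_leb d)"
  proof -
    have eq: "?V x = (\<integral>y. w x y * H x y \<partial>Rd_leb d) / q x" if "x \<in> space (Rd_leb d)" for x
      using velocity_eq(1)[OF p _ i, of x f s f' s'] that s
      by (simp add: w_def q_def H_def space_PiM)
    have "(\<lambda>(x, y). w x y * H x y) \<in> borel_measurable ?LL"
      using borel_measurable_times[OF wm Hm] by (simp add: split_beta')
    then have "(\<lambda>x. \<integral>y. w x y * H x y \<partial>Rd_leb d) \<in> borel_measurable (Rd_leb d)"
      by (rule L.borel_measurable_lebesgue_integral)
    moreover have "q \<in> borel_measurable (Rd_leb d)"
      unfolding q_def by (rule L.borel_measurable_lebesgue_integral[OF wm])
    ultimately have "(\<lambda>x. (\<integral>y. w x y * H x y \<partial>Rd_leb d) / q x) \<in> borel_measurable (Rd_leb d)"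
      by (rule borel_measurable_divide)
    then show ?thesis by (subst measurable_cong[OF eq])
  qed
  have Vq: "?V x * q x = (\<integral>y. w x y * H x y \<partial>Rd_leb d)" if "x \<in> space (Rd_leb d)" for x
    using velocity_eq(2)[OF p _ i, of x f s f' s'] that
    by (simp add: w_def q_def H_def space_PiM)
  have transfer: "integrable ?M (\<lambda>\<omega>. g (?T \<omega>)) \<longleftrightarrow> integrable ?LL (\<lambda>(x, y). w x y * g (x, y))"
       "(\<integral>\<omega>. g (?T \<omega>) \<partial>?M) = (\<integral>(x, y). w x y * g (x, y) \<partial>?LL)"
    if g[measurable]: "g \<in> borel_measurable ?LL" for g :: "_ \<Rightarrow> real"
  proof -
    let ?wc = "\<lambda>q. case q of (x, y) \<Rightarrow> w x y"
    have ew: "(\<lambda>(x, y). ennreal (w x y)) = (\<lambda>q. ennreal (?wc q))" by (rule ext) (simp add: split_beta)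
    have "distr ?M ?LL ?T = density ?LL (\<lambda>(x, y). ennreal (w x y))"
      unfolding w_def by (rule distr_joint_law[OF p s])
    then have D: "distr ?M ?LL ?T = density ?LL (\<lambda>q. ennreal (?wc q))"
      by (rule trans) (rule arg_cong[where f = "density ?LL", OF ew])
    have ae: "AE q in ?LL. 0 \<le> ?wc q"
    proof (rule AE_I2)
      fix q assume "q \<in> space ?LL"
      then have "snd q \<in> Rd d" by (simp add: space_pair_measure space_PiM mem_Times_iff)
      from w0[OF this, of "fst q"] show "0 \<le> ?wc q" by (simp add: split_beta)
    qed
    have gw: "(\<lambda>q. ?wc q * g q) = (\<lambda>(x, y). w x y * g (x, y))" by (rule ext) (simp add: split_beta)
    show "integrable ?M (\<lambda>\<omega>. g (?T \<omega>)) \<longleftrightarrow> integrable ?LL (\<lambda>(x, y). w x y * g (x, y))"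
      unfolding integrable_distr_eq[OF T g, symmetric] D integrable_real_density[OF wm ae g] gw ..
    show "(\<integral>\<omega>. g (?T \<omega>) \<partial>?M) = (\<integral>(x, y). w x y * g (x, y) \<partial>?LL)"
      unfolding integral_distr[OF T g, symmetric] D integral_real_density[OF wm ae g] gw ..
  qed
  have hH: "?h \<omega> = (case ?T \<omega> of (x, y) \<Rightarrow> H x y)" for \<omega>
    using s i by (simp add: H_def interpolant_def field_simps)
  have wH: "integrable ?LL (\<lambda>(x, y). w x y * H x y)"
    using transfer(1)[OF Hm] int unfolding hH by simp
  have wVm[measurable]: "(\<lambda>(x, y). w x y * ?V x) \<in> borel_measurable ?LL"
    unfolding split_beta using wm by (simp add: split_beta)
  have wint: "AE x in Rd_leb d. integrable (Rd_leb d) (w x)"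
  proof -
    have "integrable ?LL (\<lambda>(x, y). w x y * 1)"
      using transfer(1)[of "\<lambda>_. 1"] by simp
    from LL.AE_integrable_fst'[OF this] show ?thesis by simp
  qed
  have wV: "integrable ?LL (\<lambda>(x, y). w x y * ?V x)"
  proof (rule LL.Fubini_integrable[OF wVm])
    have "integrable (Rd_leb d) (\<lambda>x. \<bar>\<integral>y. w x y * H x y \<partial>Rd_leb d\<bar>)"
      using LL.integrable_fst'[OF wH] by simp
    moreover have "(\<integral>y. norm (case (x, y) of (x, y) \<Rightarrow> w x y * ?V x) \<partial>Rd_leb d)
        = \<bar>\<integral>y. w x y * H x y \<partial>Rd_leb d\<bar>" if x: "x \<in> space (Rd_leb d)" for x
    proof -
      have "(\<integral>y. norm (case (x, y) of (x, y) \<Rightarrow> w x y * ?V x) \<partial>Rd_leb d)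
          = (\<integral>y. w x y * \<bar>?V x\<bar> \<partial>Rd_leb d)"
        by (rule Bochner_Integration.integral_cong) (simp_all add: abs_mult space_PiM w0)
      also have "\<dots> = q x * \<bar>?V x\<bar>" by (simp add: q_def)
      also have "\<dots> = \<bar>?V x * q x\<bar>"
      proof -
        have "0 \<le> q x" unfolding q_def
          by (rule Bochner_Integration.integral_nonneg_AE, rule AE_I2) (simp add: space_PiM w0)
        then show ?thesis by (simp add: abs_mult)
      qed
      finally show ?thesis using Vq[OF x] by simp
    qed
    ultimately show "integrable (Rd_leb d) (\<lambda>x. \<integral>y. norm (case (x, y) of (x, y) \<Rightarrow> w x y * ?V x) \<partial>Rd_leb d)"
      by (simp cong: Bochner_Integration.integrable_cong)
    show "AE x in Rd_leb d. integrable (Rd_leb d) (\<lambda>y. case (x, y) of (x, y) \<Rightarrow> w x y * ?V x)"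
      using wint by eventually_elim simp
  qed
  have VX: "integrable ?M (\<lambda>\<omega>. ?V (?X \<omega>))"
    using transfer(1)[of "\<lambda>(x, y). ?V x"] wV by simp
  have sub: "subalgebra ?M ?F"
    unfolding subalgebra_def
    using measurable_sets[OF X] by (auto simp: sets_vimage_algebra2 measurable_space[OF X] Pi_def)
  interpret C: finite_measure_subalgebra ?M ?F
    by standard (rule sub)
  show ?thesis
  proof (rule C.real_cond_exp_charact)
    show "integrable ?M ?h" by (rule int)
    show "integrable ?M (\<lambda>\<omega>. ?V (?X \<omega>))" by (rule VX)
    have "?X \<in> ?F \<rightarrow>\<^sub>M Rd_leb d"
      by (rule measurable_vimage_algebra1) (use measurable_space[OF X] in auto)
    then show "(\<lambda>\<omega>. ?V (?X \<omega>)) \<in> borel_measurable ?F" by measurable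
    fix A assume "A \<in> sets ?F"
    then obtain B where B[measurable]: "B \<in> sets (Rd_leb d)" and A: "A = ?X -` B \<inter> space ?M"
      using measurable_space[OF X] by (auto simp: sets_vimage_algebra2 Pi_def)
    have BHm: "(\<lambda>(x, y). indicator B x * H x y) \<in> borel_measurable ?LL"
      and BVm: "(\<lambda>(x, y). indicator B x * ?V x :: real) \<in> borel_measurable ?LL"
      unfolding split_beta using Hm by (simp_all add: split_beta)
    have iH: "integrable ?LL (\<lambda>(x, y). w x y * (indicator B x * H x y))"
      by (rule Bochner_Integration.integrable_bound[OF wH])
         (use wm BHm in \<open>auto simp: split_beta' abs_mult indicator_def\<close>)
    have iV: "integrable ?LL (\<lambda>(x, y). w x y * (indicator B x * ?V x))"
      by (rule Bochner_Integration.integrable_bound[OF wV])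
         (use wm BVm in \<open>auto simp: split_beta' abs_mult indicator_def\<close>)
    have "(\<integral>\<omega>\<in>A. ?h \<omega> \<partial>?M) = (\<integral>\<omega>. (case ?T \<omega> of (x, y) \<Rightarrow> indicator B x * H x y) \<partial>?M)"
      unfolding set_lebesgue_integral_def
      by (rule Bochner_Integration.integral_cong) (auto simp: A hH indicator_def)
    also have "\<dots> = (\<integral>(x, y). w x y * (indicator B x * H x y) \<partial>?LL)"
      using transfer(2)[OF BHm] by simp
    also have "\<dots> = (\<integral>x. (\<integral>y. w x y * (indicator B x * H x y) \<partial>Rd_leb d) \<partial>Rd_leb d)"
      using LL.integral_fst'[OF iH] by simp
    also have "\<dots> = (\<integral>x. (\<integral>y. w x y * (indicator B x * ?V x) \<partial>Rd_leb d) \<partial>Rd_leb d)"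
    proof (rule Bochner_Integration.integral_cong[OF refl])
      fix x assume x: "x \<in> space (Rd_leb d)"
      have "(\<integral>y. w x y * (indicator B x * H x y) \<partial>Rd_leb d) = indicator B x * (?V x * q x)"
        unfolding Vq[OF x] by (simp flip: integral_mult_right_zero add: mult.left_commute)
      also have "\<dots> = (\<integral>y. w x y * (indicator B x * ?V x) \<partial>Rd_leb d)"
        by (simp add: q_def mult.commute mult.left_commute)
      finally show "(\<integral>y. w x y * (indicator B x * H x y) \<partial>Rd_leb d)
          = (\<integral>y. w x y * (indicator B x * ?V x) \<partial>Rd_leb d)" .
    qed
    also have "\<dots> = (\<integral>(x, y). w x y * (indicator B x * ?V x) \<partial>?LL)"
      using LL.integral_fst'[OF iV] by simp
    also have "\<dots> = (\<integral>\<omega>. (case ?T \<omega> of (x, y) \<Rightarrow> indicator B x * ?V x) \<partial>?M)"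
      using transfer(2)[OF BVm] by simp
    also have "\<dots> = (\<integral>\<omega>\<in>A. ?V (?X \<omega>) \<partial>?M)"
      unfolding set_lebesgue_integral_def
      by (rule Bochner_Integration.integral_cong) (auto simp: A indicator_def)
    finally show "(\<integral>\<omega>\<in>A. ?h \<omega> \<partial>?M) = (\<integral>\<omega>\<in>A. ?V (?X \<omega>) \<partial>?M)" .
  qed
qed

end

theory Submission
  imports Defs "HOL-Real_Asymp.Real_Asymp"
begin

text \<open>
  The Jacobian of the field is \<open>(\<sigma>'/\<sigma>) Id + (f' - f \<sigma>'/\<sigma>) (f/\<sigma>\<^sup>2) Cov\<close>, where \<open>Cov\<close> is the covariance
  of the posterior, so everything rests on a dimension-free bound for the variance of a unit linear
  functional \<open>X\<close> under a density \<open>exp (- W + a)\<close> with \<open>W\<close> strongly convex with modulus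
  \<open>\<kappa> = \<alpha> + f\<^sup>2/\<sigma>\<^sup>2\<close> and \<open>a\<close> Hoelder.  The midpoint Prekopa-Leindler inequality, applied to the tilts of
  the density by \<open>exp (r X)\<close> and \<open>exp (- r X)\<close>, gives for the Laplace transform \<open>M\<close>
  \<open>M r * M (- r) \<le> (M 0)\<^sup>2 * exp E\<close> with \<open>E = sup \<rho>. 2 K \<rho>\<^sup>\<beta> - \<kappa> \<rho>\<^sup>2 / 4 + r \<rho>\<close>.  With an independent copy of \<open>X\<close> this
  bounds the variance by \<open>(exp E - 1) / r\<^sup>2\<close>, and \<open>r\<^sup>2 = \<kappa>\<^sup>1\<^sup>-\<^sup>\<beta>\<^sup>/\<^sup>4\<close> yields
  \<open>Var X \<le> (1/\<kappa>) (1 + C \<kappa>\<^sup>-\<^sup>\<beta>\<^sup>/\<^sup>4)\<close>.  The sharp leading constant makes the non-integrable terms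
  \<open>\<sigma>'/\<sigma>\<close> cancel, and \<open>\<lambda>\<^sub>m\<^sub>a\<^sub>x\<close> is at most a constant times \<open>f' - \<sigma>' \<sigma>\<^sup>\<beta>\<^sup>/\<^sup>2\<^sup>-\<^sup>1\<close>, the derivative of a
  bounded increasing function.
\<close>

section \<open>The midpoint Prekopa-Leindler inequality\<close>

text \<open>Why the leading constant must be exactly 1: a variance bound c / \<kappa> with c > 1
  would leave a positive multiple of \<bar>\<sigma>'\<bar> / \<sigma> near t = 1, whose integral
  diverges logarithmically. Treating exp a as a multiplicative perturbation of a log-concave density
  would lose such a factor. Why the power \<beta>/4: put r^2 = \<kappa> \<eta>. The curvature
  confines \<rho> to the scale \<kappa>^(-1/2), so E is about \<eta> plus a Hoelder term of order K
  \<kappa>^(-\<beta>/2). Dividing exp E - 1 by r^2 gives 1/\<kappa> times 1 plus two errors, of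
  order \<kappa>^(-\<beta>/2) / \<eta> from the Hoelder term and \<eta> from the second order of
  exp. They balance at \<eta> = \<kappa>^(-\<beta>/4). Midpoints suffice because the opposite tilts
  by r X and - r X cancel there, up to r \<rho>. The Hessian bound is available only in the interior
  of {p > 0}, so that interior must first be shown to carry all the mass; this is the purpose of the
  measure theory of convex sets.\<close>

lemma emeasure_lborel_affine_vimage:
  fixes A :: "real set"
  assumes [measurable]: "A \<in> sets borel" and m: "m > 0"
  shows "emeasure lborel A = ennreal m * emeasure lborel {x. c + m * x \<in> A}"
proof -
  have "emeasure lborel A = emeasure (density (distr lborel borel (\<lambda>x. c + m * x)) (\<lambda>_. ennreal \<bar>m\<bar>)) A"
    using lborel_real_affine[of m c] m by simp
  also have "\<dots> = ennreal m * emeasure (distr lborel borel (\<lambda>x. c + m * x)) A"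
    using m by (subst emeasure_density) (auto simp: nn_integral_cmult)
  also have "\<dots> = ennreal m * emeasure lborel {x. c + m * x \<in> A}"
    by (subst emeasure_distr) (auto simp: vimage_def)
  finally show ?thesis .
qed

text \<open>With \<open>a\<close> nearly maximal in \<open>A\<close> and \<open>b\<close> nearly minimal in \<open>B\<close>, the sets \<open>(A + b) / 2\<close> and
  \<open>(a + B) / 2\<close> lie in \<open>C\<close> and hardly overlap.\<close>

lemma emeasure_midpoints_bounded:
  fixes A B C :: "real set"
  assumes [measurable]: "A \<in> sets borel" "B \<in> sets borel" "C \<in> sets borel"
    and ne: "A \<noteq> {}" "B \<noteq> {}" and bdd: "bdd_above A" "bdd_below B"
    and mid: "\<And>x y. x \<in> A \<Longrightarrow> y \<in> B \<Longrightarrow> (x + y) / 2 \<in> C"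
  shows "emeasure lborel A + emeasure lborel B \<le> 2 * emeasure lborel C"
proof (rule ennreal_le_epsilon)
  fix e :: real assume e: "0 < e"
  obtain a where a: "a \<in> A" "Sup A - e / 2 < a"
    using less_cSup_iff[OF ne(1) bdd(1), of "Sup A - e / 2"] e by auto
  obtain b where b: "b \<in> B" "b < Inf B + e / 2"
    using cInf_less_iff[OF ne(2) bdd(2), of "Inf B + e / 2"] e by auto
  let ?A = "{x. - b + 2 * x \<in> A}" and ?B = "{x. - a + 2 * x \<in> B}"
  have AC: "?A \<subseteq> C" using mid[OF _ b(1)] by fastforce
  have BC: "?B \<subseteq> C" using mid[OF a(1)] by fastforce
  \<comment> \<open>The near-optimal choice of \<open>a\<close> and \<open>b\<close>, each up to e /
    2, makes this interval shorter than e / 2.\<close>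
  have int: "?A \<inter> ?B \<subseteq> {(a + Inf B) / 2 .. (Sup A + b) / 2}"
    using cSup_upper[OF _ bdd(1)] cInf_lower[OF _ bdd(2)] by fastforce
  have mA: "?A \<in> sets lborel" and mB: "?B \<in> sets lborel" by measurable
  have "emeasure lborel (?A \<inter> ?B) \<le> emeasure lborel {(a + Inf B) / 2 .. (Sup A + b) / 2}"
    by (rule emeasure_mono[OF int]) simp
  also have "\<dots> \<le> ennreal (e / 2)"
    using a(2) b(2) e by (cases "(a + Inf B) / 2 \<le> (Sup A + b) / 2") (auto intro!: ennreal_leI simp: field_simps)
  finally have ov: "emeasure lborel (?A \<inter> ?B) \<le> ennreal (e / 2)" .
  have "emeasure lborel ?A + emeasure lborel ?B
      = emeasure lborel (?A \<union> ?B) + emeasure lborel (?A \<inter> ?B)"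
    by (rule emeasure_Un_Int) (use mA mB in auto)
  also have "\<dots> \<le> emeasure lborel C + ennreal (e / 2)"
    by (intro add_mono ov emeasure_mono) (use AC BC in auto)
  finally have *: "emeasure lborel ?A + emeasure lborel ?B \<le> emeasure lborel C + ennreal (e / 2)" .
  have "emeasure lborel A + emeasure lborel B = ennreal 2 * (emeasure lborel ?A + emeasure lborel ?B)"
    using emeasure_lborel_affine_vimage[of A 2 "- b"] emeasure_lborel_affine_vimage[of B 2 "- a"]
    by (simp add: distrib_left)
  also have "\<dots> \<le> ennreal 2 * (emeasure lborel C + ennreal (e / 2))"
    by (intro mult_left_mono *) simp
  also have "\<dots> = 2 * emeasure lborel C + ennreal e"
    using e by (simp add: distrib_left flip: ennreal_mult ennreal_numeral)
  finally show "emeasure lborel A + emeasure lborel B \<le> 2 * emeasure lborel C + ennreal e" .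
qed

text \<open>Cutting \<open>A\<close> only from above and \<open>B\<close> only from below already
  gives the bounded case. From \<open>n0\<close> on both truncations keep the chosen points and stay
  nonempty, and the measures converge from below.\<close>

lemma emeasure_midpoints:
  fixes A B C :: "real set"
  assumes [measurable]: "A \<in> sets borel" "B \<in> sets borel" "C \<in> sets borel"
    and ne: "A \<noteq> {}" "B \<noteq> {}"
    and mid: "\<And>x y. x \<in> A \<Longrightarrow> y \<in> B \<Longrightarrow> (x + y) / 2 \<in> C"
  shows "emeasure lborel A + emeasure lborel B \<le> 2 * emeasure lborel C"
proof -
  obtain a b where ab: "a \<in> A" "b \<in> B" using ne by auto
  obtain n0 :: nat where n0: "\<bar>a\<bar> + \<bar>b\<bar> \<le> real n0" using real_arch_simple by blast
  let ?A = "\<lambda>n::nat. A \<inter> {..real n}" and ?B = "\<lambda>n::nat. B \<inter> {- real n..}"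
  have UA: "(\<Union>n. ?A n) = A" using real_arch_simple by auto
  have UB: "(\<Union>n. ?B n) = B"
  proof -
    have "\<exists>n. - real n \<le> x" for x using real_arch_simple[of "- x"] by (auto simp: minus_le_iff)
    then show ?thesis by auto
  qed
  have "(\<lambda>n. emeasure lborel (?A n)) \<longlonglongrightarrow> emeasure lborel (\<Union>n. ?A n)"
    by (rule Lim_emeasure_incseq) (auto simp: incseq_def)
  moreover have "(\<lambda>n. emeasure lborel (?B n)) \<longlonglongrightarrow> emeasure lborel (\<Union>n. ?B n)"
    by (rule Lim_emeasure_incseq) (auto simp: incseq_def)
  ultimately have lim: "(\<lambda>n. emeasure lborel (?A n) + emeasure lborel (?B n))
      \<longlonglongrightarrow> emeasure lborel A + emeasure lborel B"
    unfolding UA UB by (rule tendsto_add)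
  show ?thesis
  proof (rule LIMSEQ_le_const2[OF lim], intro exI allI impI)
    fix n assume n: "n0 \<le> n"
    have "a \<le> real n" "- real n \<le> b" using n n0 by linarith+
    then show "emeasure lborel (?A n) + emeasure lborel (?B n) \<le> 2 * emeasure lborel C"
      using ab mid by (intro emeasure_midpoints_bounded) auto
  qed
qed

lemma nn_integral_eq_superlevel_sets:
  fixes f :: "real \<Rightarrow> ennreal"
  assumes [measurable]: "f \<in> borel_measurable borel"
  shows "(\<integral>\<^sup>+x. f x \<partial>lborel) = (\<integral>\<^sup>+t. indicator {0..} t * emeasure lborel {x. ennreal t < f x} \<partial>lborel)"
proof -
  have level: "(\<integral>\<^sup>+t. indicator {t. 0 \<le> t \<and> ennreal t < v} t \<partial>lborel) = v" for v
  proof (cases v)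
    case (real r)
    then have "{t. 0 \<le> t \<and> ennreal t < v} = {0..<r}" by (auto simp: ennreal_less_iff)
    then show ?thesis using real by simp
  next
    case top
    then have eq: "{t. 0 \<le> t \<and> ennreal t < v} = {0..}" by auto
    have "emeasure lborel {0::real..} = \<infinity>"
    proof (rule ccontr)
      assume "emeasure lborel {0::real..} \<noteq> \<infinity>"
      then obtain r where r: "0 \<le> r" "emeasure lborel {0::real..} = ennreal r"
        by (cases "emeasure lborel {0::real..}") auto
      have "ennreal (r + 1) = emeasure lborel {0..r + 1}" using r by simp
      also have "\<dots> \<le> emeasure lborel {0::real..}" by (rule emeasure_mono) auto
      finally show False using r by (simp add: ennreal_le_iff)
    qed
    then show ?thesis unfolding eq using top by simp
  qed
  have "(\<integral>\<^sup>+x. f x \<partial>lborel) = (\<integral>\<^sup>+x. (\<integral>\<^sup>+t. indicator {t. 0 \<le> t \<and> ennreal t < f x} t \<partial>lborel) \<partial>lborel)"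
    by (simp only: level)
  also have "\<dots> = (\<integral>\<^sup>+x. (\<integral>\<^sup>+t. indicator {0..} t * indicator {x. ennreal t < f x} x \<partial>lborel) \<partial>lborel)"
    by (intro nn_integral_cong) (auto simp: indicator_def)
  also have "\<dots> = (\<integral>\<^sup>+t. (\<integral>\<^sup>+x. indicator {0..} t * indicator {x. ennreal t < f x} x \<partial>lborel) \<partial>lborel)"
    by (rule lborel_pair.Fubini') simp
  also have "\<dots> = (\<integral>\<^sup>+t. indicator {0..} t * emeasure lborel {x. ennreal t < f x} \<partial>lborel)"
    by (intro nn_integral_cong) (simp add: nn_integral_cmult)
  finally show ?thesis .
qed

text \<open>Equal suprema let the superlevel sets be compared at the same level: below 1 both are
  nonempty and their midpoints lie in the superlevel set of \<open>h\<close>, from 1 on both are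
  empty. Integrating over the level gives an additive inequality, stronger than the product
  form.\<close>

lemma prekopa_leindler_normalized:
  fixes f g h :: "real \<Rightarrow> ennreal"
  assumes [measurable]: "f \<in> borel_measurable borel" "g \<in> borel_measurable borel" "h \<in> borel_measurable borel"
    and sup: "(SUP x. f x) = 1" "(SUP x. g x) = 1"
    and mid: "\<And>x y. f x * g y \<le> (h ((x + y) / 2))\<^sup>2"
  shows "(\<integral>\<^sup>+x. f x \<partial>lborel) + (\<integral>\<^sup>+x. g x \<partial>lborel) \<le> 2 * (\<integral>\<^sup>+x. h x \<partial>lborel)"
proof -
  have le1: "f x \<le> 1" "g x \<le> 1" for x
    using SUP_upper[of x UNIV f] SUP_upper[of x UNIV g] sup by simp_all
  have lev: "indicator {0..} t * emeasure lborel {x. ennreal t < f x} + indicator {0..} t * emeasure lborel {x. ennreal t < g x}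
      \<le> 2 * (indicator {0..} t * emeasure lborel {x. ennreal t < h x})" for t :: real
  proof (cases "0 \<le> t")
    case t: True
    show ?thesis
    proof (cases "t < 1")
      case True
      then have "ennreal t < 1" using t by (simp add: ennreal_less_iff flip: ennreal_1)
      then have ne: "{x. ennreal t < f x} \<noteq> {}" "{x. ennreal t < g x} \<noteq> {}"
        using less_SUP_iff[of "ennreal t" f UNIV] less_SUP_iff[of "ennreal t" g UNIV] sup by auto
      have "emeasure lborel {x. ennreal t < f x} + emeasure lborel {x. ennreal t < g x}
          \<le> 2 * emeasure lborel {x. ennreal t < h x}"
      proof (rule emeasure_midpoints[OF _ _ _ ne])
        fix x y assume xy: "x \<in> {x. ennreal t < f x}" "y \<in> {x. ennreal t < g x}"
        obtain r where r: "0 \<le> r" "f x = ennreal r" using le1(1)[of x] by (cases "f x") (auto simp: top_unique)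
        obtain q where q: "0 \<le> q" "g y = ennreal q" using le1(2)[of y] by (cases "g y") (auto simp: top_unique)
        have rq: "t < r" "t < q" using xy r q t by (auto simp: ennreal_less_iff)
        have "ennreal t < h ((x + y) / 2)"
        proof (rule ccontr)
          assume "\<not> ennreal t < h ((x + y) / 2)"
          then have "(h ((x + y) / 2))\<^sup>2 \<le> (ennreal t)\<^sup>2" by (intro power_mono) auto
          with mid[of x y] have "ennreal r * ennreal q \<le> (ennreal t)\<^sup>2" unfolding r q by (rule order_trans)
          then have "r * q \<le> t\<^sup>2" using r q t by (simp add: ennreal_power flip: ennreal_mult)
          moreover have "t * t < r * q" using rq t by (intro mult_strict_mono') auto
          ultimately show False by (simp add: power2_eq_square)
        qed
        then show "(x + y) / 2 \<in> {x. ennreal t < h x}" by simp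
      qed measurable
      then show ?thesis using t by simp
    next
      case False
      then have "1 \<le> ennreal t" by (simp flip: ennreal_1 add: ennreal_leI)
      then have "f x \<le> ennreal t" "g x \<le> ennreal t" for x
        using le1[of x] by (auto intro: order_trans)
      then have "{x. ennreal t < f x} = {}" "{x. ennreal t < g x} = {}"
        by (auto simp: not_less)
      then show ?thesis by simp
    qed
  qed simp
  show ?thesis
    unfolding nn_integral_eq_superlevel_sets[OF assms(1)] nn_integral_eq_superlevel_sets[OF assms(2)]
      nn_integral_eq_superlevel_sets[OF assms(3)]
    by (subst nn_integral_cmult[symmetric], measurable, subst nn_integral_add[symmetric], measurable,
        rule nn_integral_mono, rule lev)
qed

lemma ennreal_am_gm:
  fixes a b c :: ennreal
  assumes "a + b \<le> 2 * c"
  shows "a * b \<le> c\<^sup>2"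
proof (cases "c = \<infinity>")
  case True then show ?thesis by (simp add: power2_eq_square)
next
  case False
  then have ab: "a \<noteq> \<infinity>" "b \<noteq> \<infinity>" using assms by (auto simp: top_unique ennreal_mult_eq_top_iff)
  obtain c' where c': "0 \<le> c'" "c = ennreal c'" using False by (cases c) auto
  obtain a' where a': "0 \<le> a'" "a = ennreal a'" using ab by (cases a) auto
  obtain b' where b': "0 \<le> b'" "b = ennreal b'" using ab by (cases b) auto
  have "a' + b' \<le> 2 * c'"
    using assms c' a' b' by (simp flip: ennreal_plus ennreal_mult ennreal_numeral)
  then have "(a' + b')\<^sup>2 \<le> (2 * c')\<^sup>2" using a' b' by (intro power_mono) auto
  then have "a' * b' \<le> c'\<^sup>2" using zero_le_power2[of "a' - b'"] by (simp add: power2_eq_square algebra_simps)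
  then show ?thesis using a' b' c' by (simp add: ennreal_power flip: ennreal_mult)
qed

text \<open>Dividing \<open>f\<close>, \<open>g\<close>, \<open>h\<close> by F, G and sqrt (F G)
  normalises both suprema and preserves the midpoint hypothesis; the arithmetic-geometric mean
  inequality then turns the sum into a product. A vanishing supremum cannot be normalised and is
  split off.\<close>

lemma prekopa_leindler_bounded:
  fixes f g h :: "real \<Rightarrow> ennreal"
  assumes [measurable]: "f \<in> borel_measurable borel" "g \<in> borel_measurable borel" "h \<in> borel_measurable borel"
    and bdd: "(SUP x. f x) < \<infinity>" "(SUP x. g x) < \<infinity>"
    and mid: "\<And>x y. f x * g y \<le> (h ((x + y) / 2))\<^sup>2"
  shows "(\<integral>\<^sup>+x. f x \<partial>lborel) * (\<integral>\<^sup>+x. g x \<partial>lborel) \<le> (\<integral>\<^sup>+x. h x \<partial>lborel)\<^sup>2"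
proof (cases "(SUP x. f x) = 0 \<or> (SUP x. g x) = 0")
  case True
  then have "(\<forall>x. f x = 0) \<or> (\<forall>x. g x = 0)"
    by (metis SUP_upper UNIV_I le_zero_eq)
  then show ?thesis by auto
next
  case False
  obtain F where F: "0 \<le> F" "(SUP x. f x) = ennreal F" using bdd by (cases "SUP x. f x") auto
  obtain G where G: "0 \<le> G" "(SUP x. g x) = ennreal G" using bdd by (cases "SUP x. g x") auto
  have FG: "0 < F" "0 < G" using False F G by (auto simp: le_less)
  define c where "c = sqrt (F * G)"
  have c: "0 < c" "c\<^sup>2 = F * G" using FG by (simp_all add: c_def)
  let ?f = "\<lambda>x. ennreal (1 / F) * f x" and ?g = "\<lambda>x. ennreal (1 / G) * g x" and ?h = "\<lambda>x. ennreal (1 / c) * h x"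
  have "(\<integral>\<^sup>+x. ?f x \<partial>lborel) + (\<integral>\<^sup>+x. ?g x \<partial>lborel) \<le> 2 * (\<integral>\<^sup>+x. ?h x \<partial>lborel)"
  proof (rule prekopa_leindler_normalized)
    show "(SUP x. ?f x) = 1" using F FG by (simp add: SUP_mult_left_ennreal[symmetric] flip: ennreal_mult)
    show "(SUP x. ?g x) = 1" using G FG by (simp add: SUP_mult_left_ennreal[symmetric] flip: ennreal_mult)
    fix x y
    have "?f x * ?g y = (ennreal (1 / F) * ennreal (1 / G)) * (f x * g y)"
      by (simp only: mult.assoc mult.commute mult.left_commute)
    also have "\<dots> = ennreal (1 / (F * G)) * (f x * g y)"
      using FG by (simp flip: ennreal_mult)
    also have "\<dots> \<le> ennreal (1 / (F * G)) * (h ((x + y) / 2))\<^sup>2"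
      by (intro mult_left_mono mid) simp
    also have "\<dots> = (?h ((x + y) / 2))\<^sup>2"
      using c by (simp add: power_mult_distrib ennreal_power power_divide)
    finally show "?f x * ?g y \<le> (?h ((x + y) / 2))\<^sup>2" .
  qed measurable
  then have "ennreal (1 / F) * (\<integral>\<^sup>+x. f x \<partial>lborel) + ennreal (1 / G) * (\<integral>\<^sup>+x. g x \<partial>lborel)
      \<le> 2 * (ennreal (1 / c) * (\<integral>\<^sup>+x. h x \<partial>lborel))"
    by (simp add: nn_integral_cmult)
  from ennreal_am_gm[OF this]
  have "ennreal (F * G) * ((ennreal (1 / F) * (\<integral>\<^sup>+x. f x \<partial>lborel)) * (ennreal (1 / G) * (\<integral>\<^sup>+x. g x \<partial>lborel)))
      \<le> ennreal (F * G) * (ennreal (1 / c) * (\<integral>\<^sup>+x. h x \<partial>lborel))\<^sup>2"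
    by (intro mult_left_mono) auto
  moreover have "ennreal (F * G) * ((ennreal (1 / F) * u) * (ennreal (1 / G) * v)) = u * v" for u v
  proof -
    have "ennreal (F * G) * ((ennreal (1 / F) * u) * (ennreal (1 / G) * v))
        = (ennreal (F * G) * ennreal (1 / F) * ennreal (1 / G)) * (u * v)" by (simp only: mult.assoc mult.commute mult.left_commute)
    also have "ennreal (F * G) * ennreal (1 / F) * ennreal (1 / G) = 1"
      using FG by (simp flip: ennreal_mult)
    finally show ?thesis by simp
  qed
  moreover have "ennreal (F * G) * (ennreal (1 / c) * u)\<^sup>2 = u\<^sup>2" for u
  proof -
    have "ennreal (F * G) * (ennreal (1 / c) * u)\<^sup>2 = (ennreal (F * G) * ennreal ((1 / c)\<^sup>2)) * u\<^sup>2"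
      using c by (simp add: power_mult_distrib ennreal_power mult.assoc)
    also have "ennreal (F * G) * ennreal ((1 / c)\<^sup>2) = 1"
      using c FG by (simp flip: ennreal_mult add: power_divide)
    finally show ?thesis by simp
  qed
  ultimately show ?thesis by simp
qed

lemma nn_integral_SUP_min:
  fixes f :: "real \<Rightarrow> ennreal"
  assumes [measurable]: "f \<in> borel_measurable borel"
  shows "(\<integral>\<^sup>+x. f x \<partial>lborel) = (SUP n::nat. \<integral>\<^sup>+x. min (f x) (of_nat n) \<partial>lborel)"
proof -
  have "f x = (SUP n::nat. min (f x) (of_nat n))" for x
    by (simp add: inf_min[symmetric] inf_SUP[symmetric] ennreal_SUP_of_nat_eq_top)
  then have "(\<integral>\<^sup>+x. f x \<partial>lborel) = (\<integral>\<^sup>+x. (SUP n::nat. min (f x) (of_nat n)) \<partial>lborel)" by simp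
  also have "\<dots> = (SUP n::nat. \<integral>\<^sup>+x. min (f x) (of_nat n) \<partial>lborel)"
    by (rule nn_integral_monotone_convergence_SUP)
       (auto simp: incseq_def le_fun_def min_le_iff_disj)
  finally show ?thesis .
qed

text \<open>Lowering \<open>f\<close> and \<open>g\<close> keeps the midpoint hypothesis, so both
  may be truncated at independent heights with \<open>h\<close> untouched; monotone convergence
  removes the truncations one after the other.\<close>

lemma prekopa_leindler_real:
  fixes f g h :: "real \<Rightarrow> ennreal"
  assumes [measurable]: "f \<in> borel_measurable borel" "g \<in> borel_measurable borel" "h \<in> borel_measurable borel"
    and mid: "\<And>x y. f x * g y \<le> (h ((x + y) / 2))\<^sup>2"
  shows "(\<integral>\<^sup>+x. f x \<partial>lborel) * (\<integral>\<^sup>+x. g x \<partial>lborel) \<le> (\<integral>\<^sup>+x. h x \<partial>lborel)\<^sup>2"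
proof -
  have fin: "(SUP x. min (f x) (of_nat n)) < \<infinity>" for n :: nat and f :: "real \<Rightarrow> ennreal"
    by (rule le_less_trans[of _ "of_nat n"]) (auto intro!: SUP_least simp: of_nat_less_top)
  have trunc: "(\<integral>\<^sup>+x. min (f x) (of_nat n) \<partial>lborel) * (\<integral>\<^sup>+x. min (g x) (of_nat m) \<partial>lborel)
      \<le> (\<integral>\<^sup>+x. h x \<partial>lborel)\<^sup>2" for n m :: nat
  proof (rule prekopa_leindler_bounded[OF _ _ _ fin fin])
    fix x y
    have "min (f x) (of_nat n) * min (g y) (of_nat m) \<le> f x * g y" by (intro mult_mono) auto
    also note mid
    finally show "min (f x) (of_nat n) * min (g y) (of_nat m) \<le> (h ((x + y) / 2))\<^sup>2" .
  qed measurable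
  show ?thesis
    unfolding nn_integral_SUP_min[OF assms(1)] nn_integral_SUP_min[OF assms(2)]
    by (auto simp: SUP_mult_right_ennreal SUP_mult_left_ennreal intro!: SUP_least trunc)
qed

section \<open>Prekopa-Leindler in dimension d\<close>

definition Rd_mid :: "nat \<Rightarrow> (nat \<Rightarrow> real) \<Rightarrow> (nat \<Rightarrow> real) \<Rightarrow> nat \<Rightarrow> real" where
  "Rd_mid d x y = (\<lambda>i\<in>{..<d}. (x i + y i) / 2)"

lemma Rd_mid_in [simp]: "Rd_mid d x y \<in> Rd d"
  by (simp add: Rd_mid_def)

lemma Rd_upd: "x \<in> Rd d \<Longrightarrow> i < d \<Longrightarrow> x(i := a) \<in> Rd d"
  by (auto simp: PiE_def extensional_def)

lemma Rd_upd_Suc: "x \<in> Rd d \<Longrightarrow> x(d := a) \<in> Rd (Suc d)"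
  by (auto simp: PiE_def extensional_def)

lemma space_Rd_leb: "space (Rd_leb d) = Rd d"
  by (simp add: space_PiM)

lemma measurable_Rd_upd:
  assumes "h \<in> borel_measurable (Rd_leb (Suc d))"
  shows "(\<lambda>(x, a). h (x(d := a))) \<in> borel_measurable (Rd_leb d \<Otimes>\<^sub>M lborel)"
proof -
  have "(\<lambda>p. (fst p)(d := snd p)) \<in> Rd_leb d \<Otimes>\<^sub>M lborel \<rightarrow>\<^sub>M Rd_leb (Suc d)"
    using measurable_add_dim[of d "{..<d}" "\<lambda>_. lborel :: real measure"]
    by (simp add: lessThan_Suc split_beta')
  from measurable_compose[OF this assms] show ?thesis by (simp add: split_beta')
qed

lemma nn_integral_Rd_leb_Suc:
  assumes h: "h \<in> borel_measurable (Rd_leb (Suc d))"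
  shows "(\<integral>\<^sup>+x. h x \<partial>Rd_leb (Suc d)) = (\<integral>\<^sup>+x. (\<integral>\<^sup>+a. h (x(d := a)) \<partial>lborel) \<partial>Rd_leb d)"
proof -
  interpret product_sigma_finite "\<lambda>_::nat. lborel :: real measure"
    by (simp add: product_sigma_finite_def sigma_finite_lborel)
  show ?thesis
    using product_nn_integral_insert[of "{..<d}" d h] h by (simp add: lessThan_Suc)
qed

text \<open>Tensorisation: for fixed \<open>x\<close>, \<open>y\<close> the sections in the last
  coordinate satisfy the one-dimensional hypothesis, and the conclusion for them is precisely the
  midpoint hypothesis for the marginals, one dimension lower. In dimension 0 the space is a single
  point.\<close>

lemma prekopa_leindler:
  fixes f g h :: "(nat \<Rightarrow> real) \<Rightarrow> ennreal"
  assumes "f \<in> borel_measurable (Rd_leb d)" "g \<in> borel_measurable (Rd_leb d)" "h \<in> borel_measurable (Rd_leb d)"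
    and "\<And>x y. x \<in> Rd d \<Longrightarrow> y \<in> Rd d \<Longrightarrow> f x * g y \<le> (h (Rd_mid d x y))\<^sup>2"
  shows "(\<integral>\<^sup>+x. f x \<partial>Rd_leb d) * (\<integral>\<^sup>+x. g x \<partial>Rd_leb d) \<le> (\<integral>\<^sup>+x. h x \<partial>Rd_leb d)\<^sup>2"
  using assms
proof (induction d arbitrary: f g h)
  case 0
  have eq: "(\<integral>\<^sup>+x. k x \<partial>Rd_leb 0) = k (\<lambda>_. undefined)" for k :: "(nat \<Rightarrow> real) \<Rightarrow> ennreal"
    unfolding lessThan_0 PiM_empty by (simp add: nn_integral_count_space_finite)
  have "Rd_mid 0 (\<lambda>_. undefined) (\<lambda>_. undefined) = (\<lambda>_. undefined)"
    by (simp add: Rd_mid_def)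
  then show ?case using 0(4)[of "\<lambda>_. undefined" "\<lambda>_. undefined"] unfolding eq by simp
next
  case (Suc d)
  note m = measurable_Rd_upd[OF Suc.prems(1)] measurable_Rd_upd[OF Suc.prems(2)] measurable_Rd_upd[OF Suc.prems(3)]
  have int: "(\<lambda>x. \<integral>\<^sup>+a. k (x(d := a)) \<partial>lborel) \<in> borel_measurable (Rd_leb d)"
    if "(\<lambda>(x, a). k (x(d := a))) \<in> borel_measurable (Rd_leb d \<Otimes>\<^sub>M lborel)" for k :: "(nat \<Rightarrow> real) \<Rightarrow> ennreal"
    using lborel.borel_measurable_nn_integral[OF that] .
  have sec: "(\<lambda>a. k (x(d := a))) \<in> borel_measurable borel"
    if "(\<lambda>(x, a). k (x(d := a))) \<in> borel_measurable (Rd_leb d \<Otimes>\<^sub>M lborel)" "x \<in> Rd d"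
    for k :: "(nat \<Rightarrow> real) \<Rightarrow> ennreal" and x
    using measurable_Pair2[OF that(1), of x] that(2) by (simp add: space_Rd_leb)
  show ?case
    unfolding nn_integral_Rd_leb_Suc[OF Suc.prems(1)] nn_integral_Rd_leb_Suc[OF Suc.prems(2)]
      nn_integral_Rd_leb_Suc[OF Suc.prems(3)]
  proof (rule Suc.IH[OF int[OF m(1)] int[OF m(2)] int[OF m(3)]])
    fix x y assume xy: "x \<in> Rd d" "y \<in> Rd d"
    show "(\<integral>\<^sup>+a. f (x(d := a)) \<partial>lborel) * (\<integral>\<^sup>+a. g (y(d := a)) \<partial>lborel)
        \<le> (\<integral>\<^sup>+a. h ((Rd_mid d x y)(d := a)) \<partial>lborel)\<^sup>2"
    proof (rule prekopa_leindler_real[OF sec[OF m(1)] sec[OF m(2)] sec[OF m(3)]])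
      fix a b
      have "Rd_mid (Suc d) (x(d := a)) (y(d := b)) = (Rd_mid d x y)(d := (a + b) / 2)"
        by (auto simp: Rd_mid_def fun_eq_iff)
      then show "f (x(d := a)) * g (y(d := b)) \<le> (h ((Rd_mid d x y)(d := (a + b) / 2)))\<^sup>2"
        using Suc.prems(4)[OF Rd_upd_Suc[OF xy(1)] Rd_upd_Suc[OF xy(2)], of a b] by (simp only:)
    qed (use xy in auto)
  qed
qed

section \<open>Convex sets of positive measure\<close>

definition Rd_comb :: "nat \<Rightarrow> real \<Rightarrow> (nat \<Rightarrow> real) \<Rightarrow> (nat \<Rightarrow> real) \<Rightarrow> nat \<Rightarrow> real" where
  "Rd_comb d r x y = (\<lambda>i\<in>{..<d}. (1 - r) * x i + r * y i)"

definition convex_Rd :: "nat \<Rightarrow> (nat \<Rightarrow> real) set \<Rightarrow> bool" where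
  "convex_Rd d D \<longleftrightarrow> D \<subseteq> Rd d \<and> (\<forall>x\<in>D. \<forall>y\<in>D. \<forall>r\<in>{0..1}. Rd_comb d r x y \<in> D)"

text \<open>Cubes rather than balls: they are products, hence a base of the product topology, and
  their slices are cubes again.\<close>

definition Rd_box :: "nat \<Rightarrow> (nat \<Rightarrow> real) \<Rightarrow> real \<Rightarrow> (nat \<Rightarrow> real) set" where
  "Rd_box d c e = {x \<in> Rd d. \<forall>i<d. \<bar>x i - c i\<bar> < e}"

lemma Rd_comb_in [simp]: "Rd_comb d r x y \<in> Rd d"
  by (simp add: Rd_comb_def)

lemma Rd_comb_apply [simp]: "i < d \<Longrightarrow> Rd_comb d r x y i = (1 - r) * x i + r * y i"
  by (simp add: Rd_comb_def)

lemma Rd_eqI: "x \<in> Rd d \<Longrightarrow> y \<in> Rd d \<Longrightarrow> (\<And>i. i < d \<Longrightarrow> x i = y i) \<Longrightarrow> x = y"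
  by (rule PiE_ext) auto

lemma convex_RdD: "convex_Rd d D \<Longrightarrow> x \<in> D \<Longrightarrow> y \<in> D \<Longrightarrow> 0 \<le> r \<Longrightarrow> r \<le> 1 \<Longrightarrow> Rd_comb d r x y \<in> D"
  by (auto simp: convex_Rd_def)

lemma convex_Rd_slice:
  assumes "convex_Rd (Suc d) D"
  shows "convex_Rd d {x \<in> Rd d. x(d := a) \<in> D}"
  unfolding convex_Rd_def
proof (intro conjI ballI)
  fix x y and r :: real
  assume x: "x \<in> {x \<in> Rd d. x(d := a) \<in> D}" and y: "y \<in> {x \<in> Rd d. x(d := a) \<in> D}" and r: "r \<in> {0..1}"
  have "Rd_comb (Suc d) r (x(d := a)) (y(d := a)) = (Rd_comb d r x y)(d := a)"
    by (rule Rd_eqI[of _ "Suc d"]) (auto simp: Rd_upd_Suc less_Suc_eq algebra_simps)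
  then show "Rd_comb d r x y \<in> {x \<in> Rd d. x(d := a) \<in> D}"
    using convex_RdD[OF assms, of "x(d := a)" "y(d := a)" r] x y r by auto
qed auto

lemma null_sets_Rd_Suc:
  assumes D: "D \<in> sets (Rd_leb (Suc d))"
    and null: "AE a in lborel. {x \<in> Rd d. x(d := a) \<in> D} \<in> null_sets (Rd_leb d)"
  shows "D \<in> null_sets (Rd_leb (Suc d))"
proof -
  interpret product_sigma_finite "\<lambda>_::nat. lborel :: real measure"
    by (simp add: product_sigma_finite_def sigma_finite_lborel)
  have "emeasure (Rd_leb (Suc d)) D = (\<integral>\<^sup>+x. indicator D x \<partial>Rd_leb (Suc d))" using D by simp
  also have "\<dots> = (\<integral>\<^sup>+a. (\<integral>\<^sup>+x. indicator D (x(d := a)) \<partial>Rd_leb d) \<partial>lborel)"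
    using product_nn_integral_insert_rev[of "{..<d}" d "indicator D"] D by (simp add: lessThan_Suc)
  also have "\<dots> = (\<integral>\<^sup>+a. (0::ennreal) \<partial>(lborel :: real measure))"
  proof (rule nn_integral_cong_AE)
    show "AE a in lborel. (\<integral>\<^sup>+x. indicator D (x(d := a)) \<partial>Rd_leb d) = 0"
      using null
    proof eventually_elim
      fix a assume N: "{x \<in> Rd d. x(d := a) \<in> D} \<in> null_sets (Rd_leb d)"
      have "(\<integral>\<^sup>+x. indicator D (x(d := a)) \<partial>Rd_leb d) = (\<integral>\<^sup>+x. indicator {x \<in> Rd d. x(d := a) \<in> D} x \<partial>Rd_leb d)"
        by (rule nn_integral_cong) (auto simp: space_Rd_leb indicator_def)
      also have "\<dots> = 0" using N by (subst nn_integral_indicator) auto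
      finally show "(\<integral>\<^sup>+x. indicator D (x(d := a)) \<partial>Rd_leb d) = 0" .
    qed
  qed
  finally show ?thesis using D by auto
qed

lemma sets_Rd_slice:
  assumes D: "D \<in> sets (Rd_leb (Suc d))"
  shows "{x \<in> Rd d. x(d := a) \<in> D} \<in> sets (Rd_leb d)"
proof -
  have "(\<lambda>x. x(d := a)) \<in> Rd_leb d \<rightarrow>\<^sub>M Rd_leb (Suc d)"
    using measurable_compose[OF measurable_Pair2'[of a lborel "Rd_leb d"], of "\<lambda>p. (fst p)(d := snd p)"]
      measurable_add_dim[of d "{..<d}" "\<lambda>_. lborel :: real measure"]
    by (simp add: lessThan_Suc split_beta')
  from measurable_sets[OF this D] show ?thesis
    by (simp add: space_Rd_leb vimage_def Int_def conj_commute)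
qed

text \<open>By Fubini two different horizontal slices of \<open>D\<close> are non-null. By induction
  each contains a cube, and the convex hull of two cubes at different heights contains a cube around
  the midpoint of their centres.\<close>

lemma convex_nonnull_contains_box:
  assumes "D \<in> sets (Rd_leb d)" "convex_Rd d D" "D \<notin> null_sets (Rd_leb d)"
  shows "\<exists>c\<in>Rd d. \<exists>e>0. Rd_box d c e \<subseteq> D"
  using assms
proof (induction d arbitrary: D)
  case 0
  have "D \<noteq> {}" using 0(3) by auto
  then have "Rd 0 \<subseteq> D" using 0(2) by (auto simp: convex_Rd_def)
  then show ?case by (intro bexI[of _ "\<lambda>_. undefined"] exI[of _ 1]) (auto simp: Rd_box_def)
next
  case (Suc d)
  define S where "S a = {x \<in> Rd d. x(d := a) \<in> D}" for a
  have Sm: "S a \<in> sets (Rd_leb d)" for a unfolding S_def by (rule sets_Rd_slice[OF Suc.prems(1)])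
  have Sc: "convex_Rd d (S a)" for a unfolding S_def by (rule convex_Rd_slice[OF Suc.prems(2)])
  have "\<exists>s t. s < t \<and> S s \<notin> null_sets (Rd_leb d) \<and> S t \<notin> null_sets (Rd_leb d)"
  proof (rule ccontr)
    assume H: "\<not> ?thesis"
    \<comment> \<open>Two exceptional heights would be comparable and give the denied pair, so at
      most one height carries a non-null slice.\<close>
    obtain b where b: "\<And>a. a \<noteq> b \<Longrightarrow> S a \<in> null_sets (Rd_leb d)"
      by (metis H linorder_neqE_linordered_idom)
    have "AE a in lborel. a \<noteq> b"
      by (rule AE_I'[of "{b}"]) auto
    then have "AE a in lborel. S a \<in> null_sets (Rd_leb d)" by eventually_elim (rule b)
    then have "D \<in> null_sets (Rd_leb (Suc d))"
      unfolding S_def by (rule null_sets_Rd_Suc[OF Suc.prems(1)])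
    with Suc.prems(3) show False by simp
  qed
  then obtain s t where st: "s < t" "S s \<notin> null_sets (Rd_leb d)" "S t \<notin> null_sets (Rd_leb d)" by auto
  obtain c0 e0 where c0: "c0 \<in> Rd d" "0 < e0" "Rd_box d c0 e0 \<subseteq> S s"
    using Suc.IH[OF Sm Sc st(2)] by auto
  obtain c1 e1 where c1: "c1 \<in> Rd d" "0 < e1" "Rd_box d c1 e1 \<subseteq> S t"
    using Suc.IH[OF Sm Sc st(3)] by auto
  define e where "e = min e0 e1"
  define M where "M = (\<Sum>i<d. \<bar>c1 i - c0 i\<bar>)"
  have M: "\<bar>c1 i - c0 i\<bar> \<le> M" if "i < d" for i
    unfolding M_def using that by (intro member_le_sum) auto
  have M0: "0 \<le> M" unfolding M_def by (intro sum_nonneg) auto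
  have e: "0 < e" using c0 c1 by (simp add: e_def)
  define w where "w = t - s"
  have w: "0 < w" using st by (simp add: w_def)
  \<comment> \<open>The first entry bounds the total offset \<delta> + (\<delta> / w) M by
    \<open>e\<close>; the second keeps the parameter \<open>r\<close> of the height in
    [0, 1].\<close>
  define \<delta> where "\<delta> = min (e / (1 + M / w)) (w / 2)"
  have Mw: "0 < 1 + M / w" using M0 w by (simp add: add_pos_nonneg)
  have \<delta>: "0 < \<delta>" using e w Mw by (simp add: \<delta>_def)
  have \<delta>e: "\<delta> * (1 + M / w) \<le> e"
  proof -
    have "\<delta> * (1 + M / w) \<le> e / (1 + M / w) * (1 + M / w)"
      using Mw by (intro mult_right_mono) (auto simp: \<delta>_def)
    then show ?thesis using Mw by simp
  qed
  define c where "c = (Rd_mid d c0 c1)(d := (s + t) / 2)"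
  show ?case
  proof (intro bexI[of _ c] exI[of _ \<delta>] conjI subsetI)
    show "c \<in> Rd (Suc d)" unfolding c_def by (intro Rd_upd_Suc Rd_mid_in)
    fix z assume z: "z \<in> Rd_box (Suc d) c \<delta>"
    have zR: "z \<in> Rd (Suc d)" and zc: "\<And>i. i < Suc d \<Longrightarrow> \<bar>z i - c i\<bar> < \<delta>"
      using z by (auto simp: Rd_box_def)
    have zd: "\<bar>z d - (s + t) / 2\<bar> < \<delta>" using zc[of d] by (simp add: c_def)
    define r where "r = (z d - s) / w"
    have rhalf: "\<bar>r - 1/2\<bar> < \<delta> / w"
    proof -
      have "r - 1/2 = (z d - (s + t) / 2) / w" using w by (simp add: r_def w_def field_simps)
      then show ?thesis using zd w by (simp add: abs_divide divide_strict_right_mono)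
    qed
    have r: "0 \<le> r" "r \<le> 1"
    proof -
      have "\<delta> / w \<le> 1/2" using w by (simp add: \<delta>_def field_simps)
      then show "0 \<le> r" "r \<le> 1" using rhalf unfolding abs_less_iff by linarith+
    qed
    \<comment> \<open>The offset of \<open>z\<close> from the point at its height on the segment
      between the two centres. Adding the same offset to both centres exhibits \<open>z\<close> as a
      convex combination.\<close>
    define v where "v = (\<lambda>i. z i - ((1 - r) * c0 i + r * c1 i))"
    have v: "\<bar>v i\<bar> < e" if i: "i < d" for i
    proof -
      have "v i = (z i - c i) + (1/2 - r) * (c1 i - c0 i)"
        using i by (simp add: v_def c_def Rd_mid_def field_simps)
      then have "\<bar>v i\<bar> \<le> \<bar>z i - c i\<bar> + \<bar>1/2 - r\<bar> * \<bar>c1 i - c0 i\<bar>"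
        by (metis abs_mult abs_triangle_ineq)
      also have "\<dots> \<le> \<bar>z i - c i\<bar> + \<delta> / w * M"
        using rhalf M[OF i] by (intro add_left_mono mult_mono) (auto simp: abs_minus_commute)
      also have "\<dots> < \<delta> + \<delta> / w * M" using zc[of i] i by simp
      also have "\<dots> = \<delta> * (1 + M / w)" by (simp add: algebra_simps)
      finally show ?thesis using \<delta>e by simp
    qed
    define x0 where "x0 = (\<lambda>i\<in>{..<d}. c0 i + v i)"
    define x1 where "x1 = (\<lambda>i\<in>{..<d}. c1 i + v i)"
    have "x0 \<in> S s" using v by (intro subsetD[OF c0(3)]) (auto simp: Rd_box_def x0_def e_def)
    moreover have "x1 \<in> S t" using v by (intro subsetD[OF c1(3)]) (auto simp: Rd_box_def x1_def e_def)
    ultimately have "Rd_comb (Suc d) r (x0(d := s)) (x1(d := t)) \<in> D"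
      using r by (intro convex_RdD[OF Suc.prems(2)]) (auto simp: S_def)
    also have "Rd_comb (Suc d) r (x0(d := s)) (x1(d := t)) = z"
    proof (rule Rd_eqI[OF Rd_comb_in zR])
      fix i assume i: "i < Suc d"
      show "Rd_comb (Suc d) r (x0(d := s)) (x1(d := t)) i = z i"
      proof (cases "i = d")
        case True
        have "r * w = z d - s" using w by (simp add: r_def)
        then show ?thesis using True by (simp add: w_def algebra_simps)
      next
        case False
        then show ?thesis using i by (simp add: x0_def x1_def v_def algebra_simps)
      qed
    qed
    finally show "z \<in> D" .
  qed (rule \<delta>)
qed

text \<open>Shrinking \<open>D\<close> towards an interior point moves it into its interior and scales the measure by a
  factor close to \<open>1\<close>.\<close>

lemma convex_ae_interior:
  assumes D: "D \<in> sets (Rd_leb d)" and conv: "convex_Rd d D" and nn: "D \<notin> null_sets (Rd_leb d)"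
  shows "\<exists>U\<in>sets (Rd_leb d). (\<forall>x\<in>U. \<exists>e>0. Rd_box d x e \<subseteq> D) \<and> D - U \<in> null_sets (Rd_leb d)"
proof -
  obtain c e where c: "c \<in> Rd d" "0 < e" "Rd_box d c e \<subseteq> D"
    using convex_nonnull_contains_box[OF assms] by auto
  define \<epsilon> :: "nat \<Rightarrow> real" where "\<epsilon> n = 1 / (real n + 2)" for n
  have \<epsilon>: "0 < \<epsilon> n" "\<epsilon> n < 1" for n by (auto simp: \<epsilon>_def)
  \<comment> \<open>Inverse of the contraction towards \<open>c\<close> by the factor 1 - \<epsilon>
    n, so that \<open>V n A\<close> is the contracted copy of \<open>A\<close>.\<close>
  define pull where "pull n z = (\<lambda>i\<in>{..<d}. (z i - \<epsilon> n * c i) / (1 - \<epsilon> n))" for n z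
  have pull_m [measurable]: "pull n \<in> Rd_leb d \<rightarrow>\<^sub>M Rd_leb d" for n
    unfolding pull_def by measurable
  define V where "V n A = pull n -` A \<inter> Rd d" for n A
  have Vm: "V n A \<in> sets (Rd_leb d)" if "A \<in> sets (Rd_leb d)" for n A
    using measurable_sets[OF pull_m that, of n] by (simp add: V_def space_Rd_leb)
  define U where "U = (\<Union>n. V n D)"
  \<comment> \<open>Comparing measures needs them finite, so \<open>D\<close> is cut to cubes. They
    are centred at \<open>c\<close>, so that the contraction maps each cut into itself.\<close>
  define DR where "DR R = D \<inter> PiE {..<d} (\<lambda>i. {c i - R .. c i + R})" for R :: real
  have DRm: "DR R \<in> sets (Rd_leb d)" for R
    unfolding DR_def by (intro sets.Int D sets_PiM_I_finite) auto
  have DRfin: "emeasure (Rd_leb d) (DR R) < \<infinity>" for R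
  proof -
    interpret product_sigma_finite "\<lambda>_::nat. lborel :: real measure"
      by (simp add: product_sigma_finite_def sigma_finite_lborel)
    have "emeasure (Rd_leb d) (DR R) \<le> emeasure (Rd_leb d) (PiE {..<d} (\<lambda>i. {c i - R .. c i + R}))"
      unfolding DR_def by (intro emeasure_mono sets_PiM_I_finite) auto
    also have "\<dots> = (\<Prod>i<d. emeasure lborel {c i - R .. c i + R})"
      by (rule emeasure_PiM) auto
    also have "\<dots> < \<infinity>"
      unfolding emeasure_lborel_Icc_eq by (subst prod_ennreal) auto
    finally show ?thesis .
  qed
  have VDR: "V n (DR R) \<subseteq> DR R" for n R
  proof
    fix z assume z: "z \<in> V n (DR R)"
    let ?y = "pull n z"
    have yD: "?y \<in> DR R" and zR: "z \<in> Rd d" using z by (auto simp: V_def)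
    then have y: "?y \<in> D" "\<And>i. i < d \<Longrightarrow> c i - R \<le> ?y i \<and> ?y i \<le> c i + R"
      by (auto simp: DR_def PiE_iff)
    have cD: "c \<in> D" using c by (auto simp: Rd_box_def)
    have zeq: "z i = (1 - \<epsilon> n) * ?y i + \<epsilon> n * c i" if "i < d" for i
      using that \<epsilon>(2)[of n] by (simp add: pull_def)
    have "z = Rd_comb d (\<epsilon> n) ?y c"
      by (rule Rd_eqI[OF zR Rd_comb_in]) (simp add: zeq)
    then have "z \<in> D" using convex_RdD[OF conv y(1) cD, of "\<epsilon> n"] \<epsilon>[of n] by simp
    moreover have "\<bar>z i - c i\<bar> \<le> R" if i: "i < d" for i
    proof -
      have "z i - c i = (1 - \<epsilon> n) * (?y i - c i)" by (simp add: zeq[OF i] algebra_simps)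
      then have "\<bar>z i - c i\<bar> = (1 - \<epsilon> n) * \<bar>?y i - c i\<bar>" using \<epsilon>(2)[of n] by (simp add: abs_mult)
      also have "\<dots> \<le> 1 * \<bar>?y i - c i\<bar>" using \<epsilon>(1)[of n] by (intro mult_right_mono) auto
      also have "\<dots> \<le> R" using y(2)[OF i] by (simp add: abs_le_iff)
      finally show ?thesis .
    qed
    then have "\<And>i. i < d \<Longrightarrow> c i - R \<le> z i \<and> z i \<le> c i + R" by (auto simp: abs_le_iff algebra_simps)
    ultimately show "z \<in> DR R" using zR by (auto simp: DR_def PiE_iff)
  qed
  have scale: "emeasure (Rd_leb d) (V n A) = ennreal ((1 - \<epsilon> n) ^ d) * emeasure (Rd_leb d) A"
    if A: "A \<in> sets (Rd_leb d)" for n A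
  proof -
    have A': "A \<subseteq> Rd d" using sets.sets_into_space[OF A] by (simp add: space_Rd_leb)
    have "emeasure (Rd_leb d) (V n A) = (\<integral>\<^sup>+x. indicator (V n A) x \<partial>Rd_leb d)"
      using Vm[OF A] by simp
    also have "\<dots> = ennreal ((1 - \<epsilon> n) ^ d) * (\<integral>\<^sup>+z. indicator (V n A) (\<lambda>i\<in>{..<d}. \<epsilon> n * c i + (1 - \<epsilon> n) * z i) \<partial>Rd_leb d)"
      using \<epsilon>(2)[of n] Vm[OF A] by (intro nn_integral_Rd_leb_affine) auto
    also have "(\<integral>\<^sup>+z. indicator (V n A) (\<lambda>i\<in>{..<d}. \<epsilon> n * c i + (1 - \<epsilon> n) * z i) \<partial>Rd_leb d)
        = (\<integral>\<^sup>+z. indicator A z \<partial>Rd_leb d)"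
    proof (rule nn_integral_cong)
      fix z assume "z \<in> space (Rd_leb d)"
      then have z: "z \<in> Rd d" by (simp add: space_Rd_leb)
      have "pull n (\<lambda>i\<in>{..<d}. \<epsilon> n * c i + (1 - \<epsilon> n) * z i) = z"
        using \<epsilon>(2)[of n] z by (intro Rd_eqI[of _ d]) (auto simp: pull_def)
      then show "indicator (V n A) (\<lambda>i\<in>{..<d}. \<epsilon> n * c i + (1 - \<epsilon> n) * z i) = (indicator A z :: ennreal)"
        by (auto simp: V_def indicator_def)
    qed
    also have "\<dots> = emeasure (Rd_leb d) A" using A by simp
    finally show ?thesis .
  qed
  have Um: "U \<in> sets (Rd_leb d)" unfolding U_def using Vm[OF D] by auto
  have DRU: "DR R - U \<in> null_sets (Rd_leb d)" for R
  proof -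
    have sub: "V n (DR R) \<subseteq> DR R \<inter> U" for n
      using VDR[of n R] by (auto simp: U_def V_def DR_def)
    \<comment> \<open>The contracted copy lies in \<open>U\<close> and has (1 - \<epsilon> n)^d
      times the measure; in the limit \<open>U\<close> fills \<open>DR R\<close> up to a null
      set.\<close>
    have le: "ennreal ((1 - \<epsilon> n) ^ d) * emeasure (Rd_leb d) (DR R) \<le> emeasure (Rd_leb d) (DR R \<inter> U)" for n
      unfolding scale[OF DRm, symmetric] by (intro emeasure_mono sub) (use DRm Um in auto)
    have "\<epsilon> \<longlonglongrightarrow> 0" unfolding \<epsilon>_def by real_asymp
    then have "(\<lambda>n. (1 - \<epsilon> n) ^ d) \<longlonglongrightarrow> (1 - 0) ^ d" by (intro tendsto_intros)
    then have "(\<lambda>n. ennreal ((1 - \<epsilon> n) ^ d)) \<longlonglongrightarrow> ennreal 1" by (intro tendsto_ennrealI) simp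
    then have "(\<lambda>n. ennreal ((1 - \<epsilon> n) ^ d) * emeasure (Rd_leb d) (DR R)) \<longlonglongrightarrow> ennreal 1 * emeasure (Rd_leb d) (DR R)"
      by (intro tendsto_mult_ennreal tendsto_const) (use DRfin[of R] in auto)
    then have "ennreal 1 * emeasure (Rd_leb d) (DR R) \<le> emeasure (Rd_leb d) (DR R \<inter> U)"
      by (rule LIMSEQ_le_const2) (use le in auto)
    moreover have "emeasure (Rd_leb d) (DR R - U) = emeasure (Rd_leb d) (DR R) - emeasure (Rd_leb d) (DR R \<inter> U)"
    proof -
      have "DR R - U = DR R - (DR R \<inter> U)" by auto
      moreover have "emeasure (Rd_leb d) (DR R \<inter> U) \<noteq> \<infinity>"
        using emeasure_mono[of "DR R \<inter> U" "DR R" "Rd_leb d"] DRm[of R] DRfin[of R] by (auto simp: top_unique)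
      ultimately show ?thesis using DRm Um by (simp add: emeasure_Diff)
    qed
    ultimately have "emeasure (Rd_leb d) (DR R - U) = 0"
      using DRfin[of R] by (simp add: diff_eq_0_iff_ennreal)
    then show ?thesis using DRm Um by auto
  qed
  have "D - U = (\<Union>k::nat. DR (real k) - U)"
  proof -
    have "\<exists>k::nat. x \<in> DR (real k)" if x: "x \<in> D" for x
    proof -
      obtain k :: nat where k: "(\<Sum>i<d. \<bar>x i - c i\<bar>) \<le> real k" using real_arch_simple by blast
      have "\<bar>x i - c i\<bar> \<le> real k" if "i < d" for i
        using member_le_sum[of i "{..<d}" "\<lambda>i. \<bar>x i - c i\<bar>"] that k by auto
      then have "\<And>i. i < d \<Longrightarrow> c i - real k \<le> x i \<and> x i \<le> c i + real k" by (auto simp: abs_le_iff algebra_simps)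
      moreover have "x \<in> Rd d" using x conv by (auto simp: convex_Rd_def)
      ultimately show ?thesis using x by (intro exI[of _ k]) (auto simp: DR_def PiE_iff)
    qed
    then show ?thesis by (auto simp: DR_def)
  qed
  then have null: "D - U \<in> null_sets (Rd_leb d)" by (simp only:) (intro null_sets_UN DRU)
  have "\<exists>\<eta>>0. Rd_box d z \<eta> \<subseteq> D" if zU: "z \<in> U" for z
  proof -
    obtain n where n: "z \<in> V n D" using zU by (auto simp: U_def)
    let ?y = "pull n z"
    have y: "?y \<in> D" and zR: "z \<in> Rd d" using n by (auto simp: V_def)
    show ?thesis
    proof (intro exI[of _ "\<epsilon> n * e"] conjI subsetI)
      fix z' assume z': "z' \<in> Rd_box d z (\<epsilon> n * e)"
      \<comment> \<open>A displacement of \<open>z\<close> is absorbed by displacing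
        \<open>c\<close> by 1 / \<epsilon> n times as much while \<open>pull n z\<close> stays
        fixed.\<close>
      define c' where "c' = (\<lambda>i\<in>{..<d}. c i + (z' i - z i) / \<epsilon> n)"
      have "c' \<in> Rd_box d c e"
        using z' \<epsilon>[of n] by (auto simp: Rd_box_def c'_def abs_divide field_simps)
      then have "Rd_comb d (\<epsilon> n) ?y c' \<in> D"
        using c(3) \<epsilon>[of n] by (intro convex_RdD[OF conv y]) auto
      also have "Rd_comb d (\<epsilon> n) ?y c' = z'"
        using z' \<epsilon>[of n] by (intro Rd_eqI[of _ d]) (auto simp: Rd_box_def c'_def pull_def field_simps)
      finally show "z' \<in> D" .
    qed (use \<epsilon>[of n] c(2) in auto)
  qed
  with null Um show ?thesis by (intro bexI[of _ U]) auto
qed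

section \<open>Strong midpoint convexity from the Hessian\<close>

lemma openin_Rd_box: "openin (Rd_top d) (Rd_box d x e)"
proof -
  have "Rd_box d x e = PiE {..<d} (\<lambda>i. {x i - e <..< x i + e})"
  proof (rule Set.set_eqI)
    fix y show "y \<in> Rd_box d x e \<longleftrightarrow> y \<in> PiE {..<d} (\<lambda>i. {x i - e <..< x i + e})"
      unfolding Rd_box_def PiE_iff mem_Collect_eq abs_diff_less_iff greaterThanLessThan_iff by blast
  qed
  then show ?thesis by (simp add: openin_PiE)
qed

lemma openin_Rd_box_subset:
  assumes U: "openin (Rd_top d) U" and x: "x \<in> U"
  shows "\<exists>e>0. Rd_box d x e \<subseteq> U"
proof -
  have "\<exists>V. (\<forall>i\<in>{..<d}. open (V i)) \<and> x \<in> PiE {..<d} V \<and> PiE {..<d} V \<subseteq> U"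
    using U x unfolding openin_product_topology_alt by simp
  then obtain V where V: "\<And>i. i < d \<Longrightarrow> open (V i)" "x \<in> PiE {..<d} V" "PiE {..<d} V \<subseteq> U"
    by (auto simp del: PiE_iff)
  have "\<exists>e>0. \<forall>y. \<bar>y - x i\<bar> < e \<longrightarrow> y \<in> V i" if i: "i < d" for i
  proof -
    have "x i \<in> V i" using V(2) i by auto
    with V(1)[OF i] show ?thesis unfolding open_dist dist_real_def by blast
  qed
  then obtain e where e: "\<And>i. i < d \<Longrightarrow> 0 < e i" "\<And>i y. i < d \<Longrightarrow> \<bar>y - x i\<bar> < e i \<Longrightarrow> y \<in> V i"
    by metis
  define m where "m = Min (insert 1 (e ` {..<d}))"
  have m0: "0 < m" unfolding m_def using e(1) by (subst Min_gr_iff) auto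
  have m: "m \<le> e i" if "i < d" for i unfolding m_def using that by (intro Min_le) auto
  have "Rd_box d x m \<subseteq> PiE {..<d} V"
  proof
    fix y assume y: "y \<in> Rd_box d x m"
    then have "y i \<in> V i" if "i < d" for i
      using that m[OF that] by (intro e(2)[OF that]) (auto simp: Rd_box_def)
    with y show "y \<in> PiE {..<d} V" by (auto simp: Rd_box_def PiE_iff)
  qed
  with V(3) m0 show ?thesis by auto
qed

lemma interior_of_Rd: "x \<in> Rd_top d interior_of D \<longleftrightarrow> x \<in> Rd d \<and> (\<exists>e>0. Rd_box d x e \<subseteq> D)"
proof
  assume "x \<in> Rd_top d interior_of D"
  then obtain T where T: "openin (Rd_top d) T" "x \<in> T" "T \<subseteq> D" by (auto simp: interior_of_def)
  then show "x \<in> Rd d \<and> (\<exists>e>0. Rd_box d x e \<subseteq> D)"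
    using openin_Rd_box_subset[OF T(1,2)] openin_subset[OF T(1)] by (auto dest: subset_trans)
next
  assume "x \<in> Rd d \<and> (\<exists>e>0. Rd_box d x e \<subseteq> D)"
  then obtain e where e: "x \<in> Rd d" "0 < e" "Rd_box d x e \<subseteq> D" by auto
  then have "x \<in> Rd_box d x e" by (simp add: Rd_box_def)
  with e openin_Rd_box[of d x e] show "x \<in> Rd_top d interior_of D" by (auto simp: interior_of_def)
qed

lemma continuous_map_Rd_boxE:
  assumes U: "openin (Rd_top d) U" and g: "continuous_map (subtopology (Rd_top d) U) euclideanreal g"
    and x: "x \<in> U" and e: "0 < e"
  shows "\<exists>\<delta>>0. Rd_box d x \<delta> \<subseteq> U \<and> (\<forall>y\<in>Rd_box d x \<delta>. \<bar>g y - g x\<bar> < e)"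
proof -
  have UR: "U \<subseteq> Rd d" using openin_subset[OF U] by simp
  have "openin (subtopology (Rd_top d) U) {y \<in> topspace (subtopology (Rd_top d) U). g y \<in> {g x - e <..< g x + e}}"
    by (rule openin_continuous_map_preimage[OF g]) simp
  then have "openin (Rd_top d) {y \<in> U. g y \<in> {g x - e <..< g x + e}}"
  proof -
    have "{y \<in> topspace (subtopology (Rd_top d) U). g y \<in> {g x - e <..< g x + e}} = {y \<in> U. g y \<in> {g x - e <..< g x + e}}"
      using UR by auto
    then show ?thesis
      using \<open>openin (subtopology (Rd_top d) U) _\<close> openin_open_subtopology[OF U] by (simp only:)
  qed
  moreover have "x \<in> {y \<in> U. g y \<in> {g x - e <..< g x + e}}" using x e by auto
  ultimately obtain \<delta> where "0 < \<delta>" "Rd_box d x \<delta> \<subseteq> {y \<in> U. g y \<in> {g x - e <..< g x + e}}"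
    using openin_Rd_box_subset by blast
  moreover have "\<bar>g y - g x\<bar> < e" if "y \<in> {y \<in> U. g y \<in> {g x - e <..< g x + e}}" for y
    using that by (simp add: abs_diff_less_iff)
  ultimately show ?thesis by (intro exI[of _ \<delta>]) blast
qed

section \<open>Differentiation along segments\<close>

definition Rd_line :: "nat \<Rightarrow> (nat \<Rightarrow> real) \<Rightarrow> (nat \<Rightarrow> real) \<Rightarrow> real \<Rightarrow> nat \<Rightarrow> real" where
  "Rd_line d x w s = (\<lambda>i\<in>{..<d}. x i + s * w i)"

text \<open>\<open>Ck_on\<close> provides derivatives in one coordinate at a time. The increment is
  telescoped over the coordinates, and continuity of the partial derivatives makes each single step
  nearly linear by the mean value theorem.\<close>

lemma line_derivative_at_0:
  assumes U: "openin (Rd_top d) U" and x: "x \<in> U"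
    and diff: "\<And>i y. i < d \<Longrightarrow> y \<in> U \<Longrightarrow> (\<lambda>h. g (y(i := h))) differentiable (at (y i))"
    and cont: "\<And>i. i < d \<Longrightarrow> continuous_map (subtopology (Rd_top d) U) euclideanreal (partial_deriv i g)"
  shows "((\<lambda>s. g (Rd_line d x w s)) has_real_derivative (\<Sum>i<d. w i * partial_deriv i g x)) (at 0)"
proof -
  have xR: "x \<in> Rd d" using openin_subset[OF U] x by auto
  \<comment> \<open>The summand 1 keeps the divisor positive when the direction vanishes.\<close>
  define W where "W = (\<Sum>i<d. \<bar>w i\<bar>) + 1"
  have W: "\<bar>w i\<bar> \<le> W" if "i < d" for i
    using member_le_sum[of i "{..<d}" "\<lambda>i. \<bar>w i\<bar>"] that by (simp add: W_def)
  have W0: "0 < W" unfolding W_def by (intro add_nonneg_pos sum_nonneg) auto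
  have line0: "Rd_line d x w 0 = x"
    using xR by (intro Rd_eqI[of _ d]) (auto simp: Rd_line_def)
  show ?thesis
    unfolding DERIV_def
  proof (rule LIM_I)
    fix r :: real assume r: "0 < r"
    define \<epsilon> where "\<epsilon> = r / (2 * W)"
    have \<epsilon>: "0 < \<epsilon>" using r W0 by (simp add: \<epsilon>_def)
    have "\<exists>\<delta>>0. Rd_box d x \<delta> \<subseteq> U \<and> (\<forall>y\<in>Rd_box d x \<delta>. \<bar>partial_deriv i g y - partial_deriv i g x\<bar> < \<epsilon>)"
      if "i < d" for i
      by (rule continuous_map_Rd_boxE[OF U cont[OF that] x \<epsilon>])
    then obtain \<delta> where \<delta>: "\<And>i. i < d \<Longrightarrow> 0 < \<delta> i" "\<And>i. i < d \<Longrightarrow> Rd_box d x (\<delta> i) \<subseteq> U"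
      "\<And>i y. i < d \<Longrightarrow> y \<in> Rd_box d x (\<delta> i) \<Longrightarrow> \<bar>partial_deriv i g y - partial_deriv i g x\<bar> < \<epsilon>"
      by metis
    define m where "m = Min (insert 1 (\<delta> ` {..<d}))"
    have m0: "0 < m" unfolding m_def using \<delta>(1) by (subst Min_gr_iff) auto
    have m: "m \<le> \<delta> i" if "i < d" for i unfolding m_def using that by (intro Min_le) auto
    have bound: "norm ((g (Rd_line d x w (0 + h)) - g (Rd_line d x w 0)) / h - (\<Sum>i<d. w i * partial_deriv i g x)) < r"
      if h: "h \<noteq> 0" "\<bar>h\<bar> < m / W" for h
    proof -
      define z where "z k = (\<lambda>i\<in>{..<d}. x i + (if i < k then h * w i else 0))" for k :: nat
      have z0: "z 0 = x" using xR by (intro Rd_eqI[of _ d]) (auto simp: z_def)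
      have zd: "z d = Rd_line d x w h" by (auto simp: z_def Rd_line_def)
      have hw: "\<bar>h * w i\<bar> < m" if "i < d" for i
      proof -
        have "\<bar>h * w i\<bar> \<le> \<bar>h\<bar> * W" using W[OF that] by (simp add: abs_mult mult_left_mono)
        also have "\<dots> < m" using h(2) W0 by (simp add: pos_less_divide_eq)
        finally show ?thesis .
      qed
      have step: "\<bar>(g (z (Suc k)) - g (z k)) - h * w k * partial_deriv k g x\<bar> \<le> \<epsilon> * \<bar>h * w k\<bar>" if k: "k < d" for k
      proof -
        let ?S = "closed_segment (x k) (x k + h * w k)"
        have inbox: "(z k)(k := a) \<in> Rd_box d x (\<delta> k)" if a: "a \<in> ?S" for a
        proof -
          have "\<bar>a - x k\<bar> \<le> \<bar>h * w k\<bar>" using a by (auto simp: closed_segment_eq_real_ivl split: if_splits)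
          then have "\<bar>a - x k\<bar> < m" using hw[OF k] by simp
          then have "\<bar>((z k)(k := a)) i - x i\<bar> < \<delta> k" if i: "i < d" for i
            using hw[OF i] m[OF k] m0 i by (auto simp: z_def)
          then show ?thesis using k by (auto simp: Rd_box_def z_def Rd_upd)
        qed
        \<comment> \<open>After subtracting the linear part at \<open>x\<close>, the derivative is
          the oscillation of the partial derivative, below \<epsilon> on the segment.\<close>
        have der: "((\<lambda>a. g ((z k)(k := a)) - partial_deriv k g x * a) has_field_derivative
            (partial_deriv k g ((z k)(k := a)) - partial_deriv k g x)) (at a within ?S)" if a: "a \<in> ?S" for a
        proof -
          have "(z k)(k := a) \<in> U" using inbox[OF a] \<delta>(2)[OF k] by auto
          from diff[OF k this] have "(\<lambda>h. g ((z k)(k := h))) differentiable (at a)" by simp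
          then have "((\<lambda>h. g ((z k)(k := h))) has_real_derivative deriv (\<lambda>h. g ((z k)(k := h))) a) (at a)"
            by (simp add: real_differentiableE DERIV_imp_deriv real_differentiable_def) (metis DERIV_imp_deriv)
          then have "((\<lambda>h. g ((z k)(k := h))) has_real_derivative partial_deriv k g ((z k)(k := a))) (at a)"
            by (simp add: partial_deriv_def)
          then show ?thesis
            by (intro DERIV_diff) (auto intro: has_field_derivative_at_within intro!: derivative_eq_intros)
        qed
        have "norm ((g ((z k)(k := x k + h * w k)) - partial_deriv k g x * (x k + h * w k))
             - (g ((z k)(k := x k)) - partial_deriv k g x * x k)) \<le> \<epsilon> * norm ((x k + h * w k) - x k)"
        proof (rule field_differentiable_bound[OF _ der])
          fix a assume "a \<in> ?S"
          then show "norm (partial_deriv k g ((z k)(k := a)) - partial_deriv k g x) \<le> \<epsilon>"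
            using \<delta>(3)[OF k inbox] by (simp add: less_imp_le)
        qed auto
        moreover have "(z k)(k := x k + h * w k) = z (Suc k)"
          using k by (intro Rd_eqI[of _ d]) (auto simp: z_def Rd_upd)
        moreover have "(z k)(k := x k) = z k"
          using k by (intro Rd_eqI[of _ d]) (auto simp: z_def Rd_upd)
        ultimately show ?thesis by (simp add: algebra_simps)
      qed
      have "g (Rd_line d x w (0 + h)) - g (Rd_line d x w 0) = (\<Sum>k<d. g (z (Suc k)) - g (z k))"
        by (subst sum_lessThan_telescope) (simp add: zd z0 line0)
      then have "\<bar>(g (Rd_line d x w (0 + h)) - g (Rd_line d x w 0)) - h * (\<Sum>i<d. w i * partial_deriv i g x)\<bar>
          = \<bar>\<Sum>k<d. (g (z (Suc k)) - g (z k)) - h * w k * partial_deriv k g x\<bar>"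
        by (simp add: sum_subtractf sum_distrib_left mult.assoc)
      also have "\<dots> \<le> (\<Sum>k<d. \<epsilon> * \<bar>h * w k\<bar>)"
        by (rule order_trans[OF sum_abs]) (intro sum_mono step, simp)
      also have "\<dots> = \<epsilon> * \<bar>h\<bar> * (\<Sum>k<d. \<bar>w k\<bar>)" by (simp add: sum_distrib_left abs_mult mult.assoc)
      also have "\<dots> \<le> \<epsilon> * \<bar>h\<bar> * W" using \<epsilon> by (intro mult_left_mono) (auto simp: W_def)
      also have "\<dots> = \<bar>h\<bar> * (r / 2)" using W0 by (simp add: \<epsilon>_def)
      finally have *: "\<bar>(g (Rd_line d x w (0 + h)) - g (Rd_line d x w 0)) - h * (\<Sum>i<d. w i * partial_deriv i g x)\<bar> \<le> \<bar>h\<bar> * (r / 2)" .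
      have "(g (Rd_line d x w (0 + h)) - g (Rd_line d x w 0)) / h - (\<Sum>i<d. w i * partial_deriv i g x)
          = ((g (Rd_line d x w (0 + h)) - g (Rd_line d x w 0)) - h * (\<Sum>i<d. w i * partial_deriv i g x)) / h"
        using h(1) by (simp add: field_simps)
      then have "norm ((g (Rd_line d x w (0 + h)) - g (Rd_line d x w 0)) / h - (\<Sum>i<d. w i * partial_deriv i g x))
          \<le> (\<bar>h\<bar> * (r / 2)) / \<bar>h\<bar>"
        using * h(1) by (simp only: real_norm_def abs_divide divide_right_mono abs_ge_zero)
      also have "\<dots> < r" using h(1) r by simp
      finally show ?thesis .
    qed
    show "\<exists>s>0. \<forall>h. h \<noteq> 0 \<and> norm (h - 0) < s \<longrightarrow>
        norm ((g (Rd_line d x w (0 + h)) - g (Rd_line d x w 0)) / h - (\<Sum>i<d. w i * partial_deriv i g x)) < r"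
      using bound m0 W0 by (intro exI[of _ "m / W"]) auto
  qed
qed

lemma line_derivative:
  assumes U: "openin (Rd_top d) U" and x: "Rd_line d x w s \<in> U"
    and diff: "\<And>i y. i < d \<Longrightarrow> y \<in> U \<Longrightarrow> (\<lambda>h. g (y(i := h))) differentiable (at (y i))"
    and cont: "\<And>i. i < d \<Longrightarrow> continuous_map (subtopology (Rd_top d) U) euclideanreal (partial_deriv i g)"
  shows "((\<lambda>s. g (Rd_line d x w s)) has_real_derivative (\<Sum>i<d. w i * partial_deriv i g (Rd_line d x w s))) (at s)"
proof -
  have eq: "Rd_line d (Rd_line d x w s) w h = Rd_line d x w (h + s)" for h
    by (auto simp: Rd_line_def algebra_simps)
  show ?thesis
    using line_derivative_at_0[where w = w and g = g, OF U x diff cont] DERIV_shift[of "\<lambda>s. g (Rd_line d x w s)" _ 0 s]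
    unfolding eq by simp
qed

lemma Rd_norm_nonneg: "0 \<le> Rd_norm d x"
  by (simp add: L2_set_def sum_nonneg)

lemma Rd_norm_scale: "0 \<le> r \<Longrightarrow> Rd_norm d (\<lambda>i. r * x i) = r * Rd_norm d x"
  by (simp add: L2_set_right_distrib)

text \<open>Along the segment \<open>g\<close> minus \<alpha> R s^2 / 2 has nonnegative second
  derivative. At s = 1/2 the quadratic gains (\<alpha> R / 2) (1/2 - 1/4), the origin of \<alpha> /
  8.\<close>

lemma strong_midpoint_convexity:
  assumes U: "openin (Rd_top d) U" and conv: "convex_Rd d U"
    and C2: "Ck_on d 2 U g" and hess: "\<And>x. x \<in> U \<Longrightarrow> hessian_ge d \<alpha> g x"
    and x: "x \<in> U" and y: "y \<in> U"
  shows "g (Rd_mid d x y) \<le> (g x + g y) / 2 - \<alpha> / 8 * (Rd_norm d (\<lambda>i. x i - y i))\<^sup>2"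
proof -
  have xR: "x \<in> Rd d" "y \<in> Rd d" using openin_subset[OF U] x y by auto
  define w where "w = (\<lambda>i\<in>{..<d}. y i - x i)"
  define L where "L = Rd_line d x w"
  define R where "R = (Rd_norm d w)\<^sup>2"
  have Leq: "L s = Rd_comb d s x y" for s
    by (auto simp: L_def Rd_line_def Rd_comb_def w_def algebra_simps)
  have LU: "L s \<in> U" if "s \<in> {0..1}" for s
    using that unfolding Leq by (intro convex_RdD[OF conv x y]) auto
  have d1: "(\<lambda>h. g (y(i := h))) differentiable (at (y i))"
    and c1: "continuous_map (subtopology (Rd_top d) U) euclideanreal (partial_deriv i g)"
    and d2: "j < d \<Longrightarrow> (\<lambda>h. partial_deriv i g (y(j := h))) differentiable (at (y j))"
    and c2: "j < d \<Longrightarrow> continuous_map (subtopology (Rd_top d) U) euclideanreal (partial_deriv j (partial_deriv i g))"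
    if "i < d" "y \<in> U" for i j y
    using C2 that by (auto simp: numeral_2_eq_2)
  let ?f1 = "\<lambda>s. \<Sum>i<d. w i * partial_deriv i g (L s)"
  let ?f2 = "\<lambda>s. \<Sum>i<d. w i * (\<Sum>j<d. w j * partial_deriv j (partial_deriv i g) (L s))"
  have D1: "((\<lambda>s. g (L s)) has_real_derivative ?f1 s) (at s)" if "s \<in> {0..1}" for s
    unfolding L_def using LU[OF that] x by (intro line_derivative[OF U] d1 c1) (auto simp: L_def)
  have D2: "(?f1 has_real_derivative ?f2 s) (at s)" if "s \<in> {0..1}" for s
  proof (rule DERIV_sum)
    fix i assume i: "i \<in> {..<d}"
    have "((\<lambda>s. partial_deriv i g (L s)) has_real_derivative (\<Sum>j<d. w j * partial_deriv j (partial_deriv i g) (L s))) (at s)"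
      unfolding L_def using LU[OF that] x i by (intro line_derivative[OF U] d2 c2) (auto simp: L_def)
    then show "((\<lambda>s. w i * partial_deriv i g (L s)) has_real_derivative w i * (\<Sum>j<d. w j * partial_deriv j (partial_deriv i g) (L s))) (at s)"
      by (rule DERIV_cmult)
  qed
  have hess2: "\<alpha> * R \<le> ?f2 s" if "s \<in> {0..1}" for s
  proof -
    have "w \<in> Rd d" by (simp add: w_def)
    then have "\<alpha> * R \<le> (\<Sum>i<d. \<Sum>j<d. partial_deriv j (partial_deriv i g) (L s) * w i * w j)"
      using hess[OF LU[OF that]] by (auto simp: hessian_ge_def R_def)
    also have "\<dots> = ?f2 s" by (simp add: sum_distrib_left ac_simps)
    finally show ?thesis .
  qed
  have cvx: "convex_on {0..1} (\<lambda>s. g (L s) - \<alpha> * R / 2 * s\<^sup>2)"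
  proof (rule f''_ge0_imp_convex[where f' = "\<lambda>s. ?f1 s - \<alpha> * R * s" and f'' = "\<lambda>s. ?f2 s - \<alpha> * R"])
    fix s :: real assume s: "s \<in> {0..1}"
    show "((\<lambda>s. g (L s) - \<alpha> * R / 2 * s\<^sup>2) has_real_derivative ?f1 s - \<alpha> * R * s) (at s)"
      using D1[OF s] by (auto intro!: derivative_eq_intros)
    show "((\<lambda>s. ?f1 s - \<alpha> * R * s) has_real_derivative ?f2 s - \<alpha> * R) (at s)"
      by (intro DERIV_diff D2[OF s]) (auto intro!: derivative_eq_intros)
    show "0 \<le> ?f2 s - \<alpha> * R" using hess2[OF s] by simp
  qed auto
  have "g (L ((1 - 1/2) *\<^sub>R 0 + (1/2) *\<^sub>R 1)) - \<alpha> * R / 2 * ((1 - 1/2) *\<^sub>R 0 + (1/2) *\<^sub>R (1::real))\<^sup>2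
      \<le> (1 - 1/2) * (g (L 0) - \<alpha> * R / 2 * 0\<^sup>2) + (1/2) * (g (L 1) - \<alpha> * R / 2 * 1\<^sup>2)"
    using cvx by (rule convex_onD) auto
  moreover have "L 0 = x" by (rule Rd_eqI[of _ d]) (simp_all add: Leq xR)
  moreover have "L 1 = y" by (rule Rd_eqI[of _ d]) (simp_all add: Leq xR)
  moreover have "L (1/2) = Rd_mid d x y" by (auto simp: Leq Rd_comb_def Rd_mid_def field_simps)
  moreover have "R = (Rd_norm d (\<lambda>i. x i - y i))\<^sup>2"
    by (simp add: R_def L2_set_def sum_nonneg w_def power2_commute)
  ultimately show ?thesis by (simp add: field_simps power2_eq_square)
qed

text \<open>Twice the midpoint inequality for \<open>u\<close> gives \<alpha> / 4, and comparing
  \<open>a\<close> at both endpoints with \<open>a\<close> at the midpoint gives 2 K. The set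
  \<open>U\<close> is a measurable subset of the interior of the domain of \<open>u\<close>, where
  the Hessian is available, and has full measure in that domain.\<close>

lemma weakly_log_concave_midpoint:
  assumes p: "prob_density_on d p" and wlc: "weakly_log_concave d \<alpha> \<beta> K p" and K: "0 \<le> K" and \<beta>: "0 \<le> \<beta>"
  shows "\<exists>U\<in>sets (Rd_leb d). (AE y in Rd_leb d. y \<notin> U \<longrightarrow> p y = 0) \<and>
    (\<forall>x\<in>U. \<forall>y\<in>U. p x * p y \<le> (p (Rd_mid d x y))\<^sup>2 *
       exp (2 * K * Rd_norm d (\<lambda>i. x i - y i) powr \<beta> - \<alpha> / 4 * (Rd_norm d (\<lambda>i. x i - y i))\<^sup>2))"
proof -
  have pm[measurable]: "p \<in> borel_measurable (Rd_leb d)" and p0: "\<And>x. x \<in> Rd d \<Longrightarrow> 0 \<le> p x"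
    and p1: "(\<integral>\<^sup>+x. ennreal (p x) \<partial>Rd_leb d) = 1"
    using p by (auto simp: prob_density_on_def)
  define D where "D = {x \<in> Rd d. 0 < p x}"
  define I where "I = Rd_top d interior_of D"
  have "\<exists>u a. (\<forall>x\<in>Rd d. u x \<noteq> -\<infinity>) \<and>
      (\<forall>x\<in>Rd d. p x = (if u x = \<infinity> then 0 else exp (- real_of_ereal (u x) + a x))) \<and>
      convex_ereal_fun d u \<and>
      (Ck_on d 2 I (\<lambda>x. real_of_ereal (u x)) \<and> (\<forall>x\<in>I. hessian_ge d \<alpha> (\<lambda>x. real_of_ereal (u x)) x)) \<and>
      (\<forall>x\<in>Rd d. \<forall>y\<in>Rd d. \<bar>a x - a y\<bar> \<le> K * Rd_norm d (\<lambda>i. x i - y i) powr \<beta>)"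
    using wlc unfolding weakly_log_concave_def Let_def D_def[symmetric] I_def[symmetric] .
  then obtain u a where ua: "(\<forall>x\<in>Rd d. u x \<noteq> -\<infinity>) \<and>
      (\<forall>x\<in>Rd d. p x = (if u x = \<infinity> then 0 else exp (- real_of_ereal (u x) + a x))) \<and>
      convex_ereal_fun d u \<and>
      (Ck_on d 2 I (\<lambda>x. real_of_ereal (u x)) \<and> (\<forall>x\<in>I. hessian_ge d \<alpha> (\<lambda>x. real_of_ereal (u x)) x)) \<and>
      (\<forall>x\<in>Rd d. \<forall>y\<in>Rd d. \<bar>a x - a y\<bar> \<le> K * Rd_norm d (\<lambda>i. x i - y i) powr \<beta>)"
    by (elim exE)
  have u1: "u x \<noteq> -\<infinity>" if "x \<in> Rd d" for x using ua that by blast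
  have pu: "p x = (if u x = \<infinity> then 0 else exp (- real_of_ereal (u x) + a x))" if "x \<in> Rd d" for x
    using ua that by blast
  have uc: "convex_ereal_fun d u" and C2: "Ck_on d 2 I (\<lambda>x. real_of_ereal (u x))" using ua by blast+
  have hess: "hessian_ge d \<alpha> (\<lambda>x. real_of_ereal (u x)) x" if "x \<in> I" for x using ua that by blast
  have hold: "\<bar>a x - a y\<bar> \<le> K * Rd_norm d (\<lambda>i. x i - y i) powr \<beta>" if "x \<in> Rd d" "y \<in> Rd d" for x y
    using ua that by blast
  have Du: "x \<in> D \<longleftrightarrow> x \<in> Rd d \<and> u x \<noteq> \<infinity>" for x
    by (cases "x \<in> Rd d"; cases "u x = \<infinity>") (simp_all only: D_def mem_Collect_eq pu if_True if_False exp_gt_zero, simp_all)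
  have Dconv: "convex_Rd d D"
    unfolding convex_Rd_def
  proof (intro conjI ballI)
    show "D \<subseteq> Rd d" by (auto simp: D_def)
    fix x y and r :: real assume xy: "x \<in> D" "y \<in> D" and r: "r \<in> {0..1}"
    obtain a' b' where ab: "u x = ereal a'" "u y = ereal b'"
      using xy u1 unfolding Du by (metis ereal_cases)
    have "u (Rd_comb d r x y) \<le> ereal (1 - r) * u x + ereal r * u y"
      using uc xy r unfolding convex_ereal_fun_def Rd_comb_def Du by blast
    then have "u (Rd_comb d r x y) \<noteq> \<infinity>" unfolding ab by auto
    then show "Rd_comb d r x y \<in> D" unfolding Du by simp
  qed
  have Dm: "D \<in> sets (Rd_leb d)"
  proof -
    have "{x \<in> space (Rd_leb d). 0 < p x} \<in> sets (Rd_leb d)" by measurable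
    then show ?thesis by (simp add: D_def space_Rd_leb)
  qed
  have Dnn: "D \<notin> null_sets (Rd_leb d)"
  proof
    assume "D \<in> null_sets (Rd_leb d)"
    then have "AE x in Rd_leb d. x \<notin> D" by (rule AE_not_in)
    then have "AE x in Rd_leb d. ennreal (p x) = 0"
      using AE_space by eventually_elim (auto simp: D_def space_Rd_leb not_less ennreal_eq_0_iff)
    then have "(\<integral>\<^sup>+x. ennreal (p x) \<partial>Rd_leb d) = 0" by (simp add: nn_integral_0_iff_AE)
    with p1 show False by simp
  qed
  obtain U where Um: "U \<in> sets (Rd_leb d)" and UI: "\<And>x. x \<in> U \<Longrightarrow> \<exists>e>0. Rd_box d x e \<subseteq> D"
    and DU: "D - U \<in> null_sets (Rd_leb d)"
    using convex_ae_interior[OF Dm Dconv Dnn] by auto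
  have UR: "U \<subseteq> Rd d" using sets.sets_into_space[OF Um] by (simp add: space_Rd_leb)
  have UsubI: "U \<subseteq> I" using UI UR by (auto simp: I_def interior_of_Rd)
  have Iopen: "openin (Rd_top d) I" by (simp add: I_def)
  have ID: "I \<subseteq> D" by (simp add: I_def interior_of_subset)
  have Iconv: "convex_Rd d I"
    unfolding convex_Rd_def
  proof (intro conjI ballI)
    show "I \<subseteq> Rd d" using ID by (auto simp: D_def)
    fix x y and r :: real assume xy: "x \<in> I" "y \<in> I" and r: "r \<in> {0..1}"
    obtain e1 where e1: "0 < e1" "Rd_box d x e1 \<subseteq> D" using xy by (auto simp: I_def interior_of_Rd)
    obtain e2 where e2: "0 < e2" "Rd_box d y e2 \<subseteq> D" using xy by (auto simp: I_def interior_of_Rd)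
    have "Rd_box d (Rd_comb d r x y) (min e1 e2) \<subseteq> D"
    proof
      fix z assume z: "z \<in> Rd_box d (Rd_comb d r x y) (min e1 e2)"
      \<comment> \<open>Moving both endpoints by the same small offset moves the combination by it,
        so interior points combine to interior points.\<close>
      define v where "v i = z i - Rd_comb d r x y i" for i
      have v: "\<bar>v i\<bar> < min e1 e2" if "i < d" for i using z that by (auto simp: Rd_box_def v_def)
      define x' where "x' = (\<lambda>i\<in>{..<d}. x i + v i)"
      define y' where "y' = (\<lambda>i\<in>{..<d}. y i + v i)"
      have "x' \<in> D" using v by (intro subsetD[OF e1(2)]) (auto simp: Rd_box_def x'_def)
      moreover have "y' \<in> D" using v by (intro subsetD[OF e2(2)]) (auto simp: Rd_box_def y'_def)
      ultimately have "Rd_comb d r x' y' \<in> D" using r by (intro convex_RdD[OF Dconv]) auto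
      also have "Rd_comb d r x' y' = z"
        using z by (intro Rd_eqI[of _ d]) (auto simp: Rd_box_def x'_def y'_def v_def algebra_simps)
      finally show "z \<in> D" .
    qed
    then show "Rd_comb d r x y \<in> I"
      using e1 e2 unfolding I_def interior_of_Rd by (intro conjI exI[of _ "min e1 e2"]) auto
  qed
  have "AE y in Rd_leb d. y \<notin> U \<longrightarrow> p y = 0"
    using AE_not_in[OF DU] AE_space
    by eventually_elim (use p0 in \<open>force simp: D_def space_Rd_leb not_less\<close>)
  moreover have "p x * p y \<le> (p (Rd_mid d x y))\<^sup>2 *
       exp (2 * K * Rd_norm d (\<lambda>i. x i - y i) powr \<beta> - \<alpha> / 4 * (Rd_norm d (\<lambda>i. x i - y i))\<^sup>2)"
    if xy: "x \<in> U" "y \<in> U" for x y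
  proof -
    let ?m = "Rd_mid d x y" and ?\<rho> = "Rd_norm d (\<lambda>i. x i - y i)" and ?u = "\<lambda>x. real_of_ereal (u x)"
    have xI: "x \<in> I" "y \<in> I" using xy UsubI by auto
    have "?m = Rd_comb d (1/2) x y" by (auto simp: Rd_comb_def Rd_mid_def field_simps)
    then have mI: "?m \<in> I" using convex_RdD[OF Iconv xI, of "1/2"] by simp
    have pexp: "p z = exp (- ?u z + a z)" "z \<in> Rd d" if "z \<in> I" for z
      using pu[of z] Du[of z] that ID by auto
    have mid: "?u ?m \<le> (?u x + ?u y) / 2 - \<alpha> / 8 * ?\<rho>\<^sup>2"
      by (rule strong_midpoint_convexity[OF Iopen Iconv C2 hess xI])
    \<comment> \<open>The endpoints are at distance \<rho> / 2 from the midpoint; the factor 2 powr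
      (- \<beta>) is given away.\<close>
    have half: "\<bar>a z - a ?m\<bar> \<le> K * ?\<rho> powr \<beta>" if "z = x \<or> z = y" for z
    proof -
      have zR: "z \<in> Rd d" using that pexp(2) xI by auto
      have "Rd_norm d (\<lambda>i. z i - ?m i) = 1/2 * ?\<rho>"
      proof -
        have "(\<Sum>i<d. (z i - ?m i)\<^sup>2) = (\<Sum>i<d. (1/2 * (x i - y i))\<^sup>2)"
          using that by (intro sum.cong refl) (auto simp: Rd_mid_def power2_eq_square field_simps)
        then have "Rd_norm d (\<lambda>i. z i - ?m i) = Rd_norm d (\<lambda>i. 1/2 * (x i - y i))" by (simp add: L2_set_def)
        then show ?thesis by (simp only: Rd_norm_scale)
      qed
      then have "Rd_norm d (\<lambda>i. z i - ?m i) \<le> ?\<rho>"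
        using Rd_norm_nonneg[where d = d and x = "\<lambda>i. x i - y i"] by linarith
      from powr_mono2[OF \<beta> Rd_norm_nonneg this]
      have "Rd_norm d (\<lambda>i. z i - ?m i) powr \<beta> \<le> ?\<rho> powr \<beta>" .
      then show ?thesis using hold[OF zR Rd_mid_in] K by (meson mult_left_mono order_trans)
    qed
    have "a x + a y \<le> 2 * a ?m + 2 * K * ?\<rho> powr \<beta>"
      using half[of x] half[of y] by auto
    then have "(- ?u x + a x) + (- ?u y + a y) \<le> 2 * (- ?u ?m + a ?m) + (2 * K * ?\<rho> powr \<beta> - \<alpha> / 4 * ?\<rho>\<^sup>2)"
      using mid by (simp add: field_simps)
    then have "exp ((- ?u x + a x) + (- ?u y + a y)) \<le> exp (2 * (- ?u ?m + a ?m) + (2 * K * ?\<rho> powr \<beta> - \<alpha> / 4 * ?\<rho>\<^sup>2))"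
      by simp
    then show ?thesis
      unfolding pexp(1)[OF xI(1)] pexp(1)[OF xI(2)] pexp(1)[OF mI]
      by (simp only: exp_add exp_double)
  qed
  ultimately show ?thesis using Um by (intro bexI[of _ U]) auto
qed

section \<open>Variance of Gaussian tilts\<close>

definition Rd_dot :: "nat \<Rightarrow> (nat \<Rightarrow> real) \<Rightarrow> (nat \<Rightarrow> real) \<Rightarrow> real" where
  "Rd_dot d x y = (\<Sum>i<d. x i * y i)"

text \<open>Up to a factor depending on \<open>x\<close> only, the posterior weight at \<open>x\<close> is the tilt with
  \<open>k = f\<^sup>2 / s\<^sup>2\<close> and \<open>b = f x / s\<^sup>2\<close>.\<close>

definition tilt :: "nat \<Rightarrow> ((nat \<Rightarrow> real) \<Rightarrow> real) \<Rightarrow> real \<Rightarrow> (nat \<Rightarrow> real) \<Rightarrow> (nat \<Rightarrow> real) \<Rightarrow> real" where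
  "tilt d p k b y = p y * exp (Rd_dot d b y - k / 2 * Rd_dot d y y)"

definition tilt_mean :: "nat \<Rightarrow> ((nat \<Rightarrow> real) \<Rightarrow> real) \<Rightarrow> real \<Rightarrow> (nat \<Rightarrow> real) \<Rightarrow> ((nat \<Rightarrow> real) \<Rightarrow> real) \<Rightarrow> real" where
  "tilt_mean d p k b F = (\<integral>y. F y * tilt d p k b y \<partial>Rd_leb d) / (\<integral>y. tilt d p k b y \<partial>Rd_leb d)"

lemma Rd_norm_eq_dot: "(Rd_norm d x)\<^sup>2 = Rd_dot d x x"
  by (simp add: L2_set_def Rd_dot_def sum_nonneg power2_eq_square)

lemma Rd_dot_add_scale: "Rd_dot d (\<lambda>i. b i + r * w i) y = Rd_dot d b y + r * Rd_dot d w y"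
  by (simp add: Rd_dot_def distrib_right sum.distrib sum_distrib_left mult.assoc)

lemma Rd_dot_commute: "Rd_dot d x y = Rd_dot d y x"
  by (simp add: Rd_dot_def mult.commute)

lemma Rd_dot_diff_right: "Rd_dot d w (\<lambda>i. x i - y i) = Rd_dot d w x - Rd_dot d w y"
  by (simp add: Rd_dot_def right_diff_distrib sum_subtractf)

lemma Rd_dot_le_norm: "Rd_dot d x y \<le> Rd_norm d x * Rd_norm d y"
proof -
  have "\<bar>Rd_dot d x y\<bar> \<le> (\<Sum>i<d. \<bar>x i\<bar> * \<bar>y i\<bar>)"
    unfolding Rd_dot_def by (rule order_trans[OF sum_abs]) (simp add: abs_mult)
  also have "\<dots> \<le> Rd_norm d x * Rd_norm d y" by (rule L2_set_mult_ineq)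
  finally show ?thesis by simp
qed

lemma Rd_dot_mid: "Rd_dot d b (Rd_mid d x y) = (Rd_dot d b x + Rd_dot d b y) / 2"
proof -
  have "Rd_dot d b (Rd_mid d x y) = (\<Sum>i<d. (b i * x i + b i * y i) / 2)"
    unfolding Rd_dot_def by (intro sum.cong refl) (simp add: Rd_mid_def field_simps)
  then show ?thesis by (simp add: Rd_dot_def sum.distrib flip: sum_divide_distrib)
qed

lemma Rd_parallelogram:
  "Rd_dot d x x + Rd_dot d y y
    = 2 * Rd_dot d (Rd_mid d x y) (Rd_mid d x y) + (Rd_norm d (\<lambda>i. x i - y i))\<^sup>2 / 2"
proof -
  have "Rd_dot d x x + Rd_dot d y y = (\<Sum>i<d. 2 * (Rd_mid d x y i * Rd_mid d x y i) + ((x i - y i) * (x i - y i)) / 2)"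
    unfolding Rd_dot_def sum.distrib[symmetric] by (intro sum.cong refl) (simp add: Rd_mid_def field_simps)
  then show ?thesis
    unfolding Rd_norm_eq_dot by (simp add: Rd_dot_def sum.distrib sum_distrib_left flip: sum_divide_distrib)
qed

lemma Rd_dot_measurable [measurable]: "Rd_dot d b \<in> borel_measurable (Rd_leb d)"
  unfolding Rd_dot_def[abs_def] by measurable

lemma Rd_dot_self_measurable [measurable]: "(\<lambda>y. Rd_dot d y y) \<in> borel_measurable (Rd_leb d)"
  unfolding Rd_dot_def[abs_def] by measurable

text \<open>The family is closed under exponential weights, so integrability of a tilt for every
  \<open>b\<close> yields all Laplace transforms and, by domination, all moments needed.\<close>

lemma tilt_exp: "exp (r * Rd_dot d w y) * tilt d p k b y = tilt d p k (\<lambda>i. b i + r * w i) y"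
  by (simp add: tilt_def Rd_dot_add_scale algebra_simps flip: exp_add)

text \<open>This is 2 cosh x \<ge> 2 + x^2; two differentiations reduce it to z + 1/z \<ge> 2. It
  bounds the variance by Laplace transforms and also dominates polynomials by exponentials.\<close>

lemma two_plus_square_le_exp: "2 + x\<^sup>2 \<le> exp x + exp (- x)" for x :: real
proof -
  have nonneg: "2 + x\<^sup>2 \<le> exp x + exp (- x)" if x: "0 \<le> x" for x :: real
  proof -
    have d1: "0 \<le> exp t - exp (- t) - 2 * t" if t: "0 \<le> t" for t :: real
    proof -
      have "(\<lambda>t. exp t - exp (- t) - 2 * t) 0 \<le> (\<lambda>t. exp t - exp (- t) - 2 * t) t"
      proof (rule DERIV_nonneg_imp_nondecreasing[OF t])
        fix u :: real
        have "0 \<le> exp u + exp (- u) - 2"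
        proof -
          have "exp (- u) = inverse (exp u)" by (rule exp_minus)
          moreover have "2 \<le> z + inverse z" if "0 < z" for z :: real
          proof -
            have "0 \<le> (z - 1)\<^sup>2 / z" using that by simp
            also have "\<dots> = z + inverse z - 2" using that by (simp add: power2_eq_square field_simps)
            finally show ?thesis by simp
          qed
          ultimately show ?thesis by simp
        qed
        then show "\<exists>y. ((\<lambda>t. exp t - exp (- t) - 2 * t) has_real_derivative y) (at u) \<and> 0 \<le> y"
          by (intro exI[of _ "exp u + exp (- u) - 2"]) (auto intro!: derivative_eq_intros)
      qed
      then show ?thesis by simp
    qed
    have "(\<lambda>t. exp t + exp (- t) - t\<^sup>2) 0 \<le> (\<lambda>t. exp t + exp (- t) - t\<^sup>2) x"
    proof (rule DERIV_nonneg_imp_nondecreasing[OF x])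
      fix u :: real assume "0 \<le> u"
      then show "\<exists>y. ((\<lambda>t. exp t + exp (- t) - t\<^sup>2) has_real_derivative y) (at u) \<and> 0 \<le> y"
        using d1[of u] by (intro exI[of _ "exp u - exp (- u) - 2 * u"]) (auto intro!: derivative_eq_intros)
    qed
    then show ?thesis by simp
  qed
  show ?thesis using nonneg[of x] nonneg[of "- x"] by (cases "0 \<le> x") auto
qed

locale Rd_density =
  fixes d :: nat and p :: "(nat \<Rightarrow> real) \<Rightarrow> real"
  assumes density: "prob_density_on d p"
begin

lemma p_measurable [measurable]: "p \<in> borel_measurable (Rd_leb d)"
  and p_nonneg: "x \<in> Rd d \<Longrightarrow> 0 \<le> p x"
  and p_integral: "(\<integral>\<^sup>+x. ennreal (p x) \<partial>Rd_leb d) = 1"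
  using density by (auto simp: prob_density_on_def)

lemma p_integrable: "integrable (Rd_leb d) p"
  by (rule integrableI_nonneg) (auto simp: p_integral p_nonneg space_Rd_leb intro!: AE_I2)

lemma tilt_measurable [measurable]: "tilt d p k b \<in> borel_measurable (Rd_leb d)"
  unfolding tilt_def[abs_def] by measurable

lemma tilt_nonneg: "y \<in> Rd d \<Longrightarrow> 0 \<le> tilt d p k b y"
  by (simp add: tilt_def p_nonneg)

text \<open>Completing the square in each coordinate bounds the exponent by \<bar>b\<bar>^2 / (2 k),
  so integrability is inherited from \<open>p\<close> for every \<open>b\<close>.\<close>

lemma tilt_integrable:
  assumes k: "0 < k"
  shows "integrable (Rd_leb d) (tilt d p k b)"
proof (rule Bochner_Integration.integrable_bound)
  let ?C = "exp (Rd_dot d b b / (2 * k))"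
  show "integrable (Rd_leb d) (\<lambda>y. ?C * p y)" using p_integrable by simp
  show "AE y in Rd_leb d. norm (tilt d p k b y) \<le> norm (?C * p y)"
  proof (rule AE_I2)
    fix y assume "y \<in> space (Rd_leb d)"
    then have y: "y \<in> Rd d" by (simp add: space_Rd_leb)
    have "b i * y i - k / 2 * (y i * y i) \<le> b i * b i / (2 * k)" for i
    proof -
      have "0 \<le> (k * y i - b i)\<^sup>2 / (2 * k)" using k by simp
      also have "\<dots> = b i * b i / (2 * k) - (b i * y i - k / 2 * (y i * y i))"
        using k by (simp add: power2_eq_square field_simps)
      finally show ?thesis by simp
    qed
    then have "(\<Sum>i<d. b i * y i - k / 2 * (y i * y i)) \<le> (\<Sum>i<d. b i * b i / (2 * k))"
      by (intro sum_mono)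
    then have "Rd_dot d b y - k / 2 * Rd_dot d y y \<le> Rd_dot d b b / (2 * k)"
      by (simp add: Rd_dot_def sum_subtractf sum_distrib_left flip: sum_divide_distrib)
    then show "norm (tilt d p k b y) \<le> norm (?C * p y)"
      using p_nonneg[OF y] by (simp add: tilt_def mult.commute mult_left_mono)
  qed
qed measurable

lemma tilt_exp_integrable:
  assumes k: "0 < k"
  shows "integrable (Rd_leb d) (\<lambda>y. exp (r * Rd_dot d w y) * tilt d p k b y)"
  unfolding tilt_exp by (rule tilt_integrable[OF k])

lemma tilt_integrable_bound:
  assumes k: "0 < k" and F [measurable]: "F \<in> borel_measurable (Rd_leb d)"
    and b: "\<And>y. y \<in> Rd d \<Longrightarrow> \<bar>F y\<bar> \<le> G y" and G: "integrable (Rd_leb d) (\<lambda>y. G y * tilt d p k b y)"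
  shows "integrable (Rd_leb d) (\<lambda>y. F y * tilt d p k b y)"
proof (rule Bochner_Integration.integrable_bound[OF G])
  show "AE y in Rd_leb d. norm (F y * tilt d p k b y) \<le> norm (G y * tilt d p k b y)"
  proof (rule AE_I2)
    fix y assume "y \<in> space (Rd_leb d)"
    then have y: "y \<in> Rd d" by (simp add: space_Rd_leb)
    then show "norm (F y * tilt d p k b y) \<le> norm (G y * tilt d p k b y)"
      using b[OF y] tilt_nonneg[OF y, of k b] by (auto simp: abs_mult intro!: mult_right_mono)
  qed
qed measurable

lemma tilt_square_integrable:
  assumes k: "0 < k"
  shows "integrable (Rd_leb d) (\<lambda>y. (Rd_dot d w y)\<^sup>2 * tilt d p k b y)"
proof (rule tilt_integrable_bound[OF k])
  show "integrable (Rd_leb d) (\<lambda>y. (exp (1 * Rd_dot d w y) + exp ((- 1) * Rd_dot d w y)) * tilt d p k b y)"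
    unfolding distrib_right by (intro Bochner_Integration.integrable_add tilt_exp_integrable k)
  fix y show "\<bar>(Rd_dot d w y)\<^sup>2\<bar> \<le> exp (1 * Rd_dot d w y) + exp ((- 1) * Rd_dot d w y)"
    using two_plus_square_le_exp[of "Rd_dot d w y"] by simp
qed measurable

lemma tilt_linear_integrable:
  assumes k: "0 < k"
  shows "integrable (Rd_leb d) (\<lambda>y. Rd_dot d w y * tilt d p k b y)"
proof (rule tilt_integrable_bound[OF k])
  show "integrable (Rd_leb d) (\<lambda>y. (1 + (Rd_dot d w y)\<^sup>2) * tilt d p k b y)"
    unfolding distrib_right mult_1 by (intro Bochner_Integration.integrable_add tilt_square_integrable tilt_integrable k)
  fix y
  have "\<bar>x\<bar> \<le> 1 + x\<^sup>2" for x :: real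
    using zero_le_power2[of "\<bar>x\<bar> - 1"] zero_le_power2[of x] by (simp add: power2_eq_square algebra_simps abs_if split: if_splits)
  then show "\<bar>Rd_dot d w y\<bar> \<le> 1 + (Rd_dot d w y)\<^sup>2" .
qed measurable

lemma tilt_integral_pos:
  assumes k: "0 < k"
  shows "0 < (\<integral>y. tilt d p k b y \<partial>Rd_leb d)"
proof -
  have ae: "AE y in Rd_leb d. 0 \<le> tilt d p k b y"
    by (rule AE_I2) (simp add: space_Rd_leb tilt_nonneg)
  have "(\<integral>y. tilt d p k b y \<partial>Rd_leb d) \<noteq> 0"
  proof
    assume "(\<integral>y. tilt d p k b y \<partial>Rd_leb d) = 0"
    then have "AE y in Rd_leb d. tilt d p k b y = 0"
      using integral_nonneg_eq_0_iff_AE[OF tilt_integrable[OF k] ae] by simp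
    then have "AE y in Rd_leb d. ennreal (p y) = 0" by eventually_elim (simp add: tilt_def)
    then have "(\<integral>\<^sup>+x. ennreal (p x) \<partial>Rd_leb d) = 0" by (simp add: nn_integral_0_iff_AE)
    then show False by (simp add: p_integral)
  qed
  moreover have "0 \<le> (\<integral>y. tilt d p k b y \<partial>Rd_leb d)" by (rule integral_nonneg_AE[OF ae])
  ultimately show ?thesis by simp
qed

text \<open>Averaging the pointwise bound \<open>2 + r\<^sup>2 (X - X')\<^sup>2 \<le> exp (r (X - X')) + exp (r (X' - X))\<close> over an
  independent copy \<open>X'\<close> of \<open>X\<close>.\<close>

lemma laplace_product_ge:
  fixes b w :: "nat \<Rightarrow> real"
  assumes k: "0 < k"
  defines "M \<equiv> \<lambda>r. \<integral>y. tilt d p k (\<lambda>i. b i + r * w i) y \<partial>Rd_leb d"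
    and "M1 \<equiv> \<integral>y. Rd_dot d w y * tilt d p k b y \<partial>Rd_leb d"
    and "M2 \<equiv> \<integral>y. (Rd_dot d w y)\<^sup>2 * tilt d p k b y \<partial>Rd_leb d"
  shows "(M 0)\<^sup>2 + r\<^sup>2 * (M 0 * M2 - M1\<^sup>2) \<le> M r * M (- r)"
proof -
  let ?X = "Rd_dot d w" and ?q = "tilt d p k b"
  have Mexp: "M r = (\<integral>y. exp (r * ?X y) * ?q y \<partial>Rd_leb d)" for r
    by (simp add: M_def tilt_exp)
  have M0: "M 0 = (\<integral>y. ?q y \<partial>Rd_leb d)" by (simp add: M_def)
  note ints = tilt_integrable[OF k] tilt_exp_integrable[OF k] tilt_linear_integrable[OF k] tilt_square_integrable[OF k]
  \<comment> \<open>Here \<open>x\<close> is the value of one copy, held fixed while the other is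
    integrated out. Two successive single integrals replace the product measure.\<close>
  have inner: "2 * M 0 + r\<^sup>2 * (M2 - 2 * x * M1 + x\<^sup>2 * M 0) \<le> exp (- (r * x)) * M r + exp (r * x) * M (- r)" for x
  proof -
    have "2 * M 0 + r\<^sup>2 * (M2 - 2 * x * M1 + x\<^sup>2 * M 0)
        = (\<integral>y. 2 * ?q y + r\<^sup>2 * ((?X y)\<^sup>2 * ?q y - 2 * x * (?X y * ?q y) + x\<^sup>2 * ?q y) \<partial>Rd_leb d)"
      unfolding M0 M1_def M2_def using ints by simp
    also have "\<dots> \<le> (\<integral>y. exp (- (r * x)) * (exp (r * ?X y) * ?q y) + exp (r * x) * (exp (- r * ?X y) * ?q y) \<partial>Rd_leb d)"
    proof (rule integral_mono)
      fix y assume "y \<in> space (Rd_leb d)"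
      then have y: "0 \<le> ?q y" by (simp add: space_Rd_leb tilt_nonneg)
      have "(2 + (r * (?X y - x))\<^sup>2) * ?q y \<le> (exp (r * (?X y - x)) + exp (- (r * (?X y - x)))) * ?q y"
        by (intro mult_right_mono two_plus_square_le_exp y)
      then show "2 * ?q y + r\<^sup>2 * ((?X y)\<^sup>2 * ?q y - 2 * x * (?X y * ?q y) + x\<^sup>2 * ?q y)
          \<le> exp (- (r * x)) * (exp (r * ?X y) * ?q y) + exp (r * x) * (exp (- r * ?X y) * ?q y)"
        by (simp add: algebra_simps power2_eq_square exp_diff exp_minus divide_inverse)
    qed (use ints ints(2)[of "- r" w b] in auto)
    also have "\<dots> = exp (- (r * x)) * M r + exp (r * x) * M (- r)"
      unfolding Mexp using ints(2)[of r w b] ints(2)[of "- r" w b] by simp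
    finally show ?thesis .
  qed
  \<comment> \<open>Second averaging: \<open>inner\<close> at x = X y, integrated against the
    tilt.\<close>
  have "2 * M 0 * M 0 + r\<^sup>2 * (M2 * M 0 - 2 * M1 * M1 + M2 * M 0)
      = (\<integral>y. (2 * M 0 + r\<^sup>2 * M2) * ?q y - 2 * r\<^sup>2 * M1 * (?X y * ?q y) + r\<^sup>2 * M 0 * ((?X y)\<^sup>2 * ?q y) \<partial>Rd_leb d)"
  proof -
    have "(\<integral>y. (2 * M 0 + r\<^sup>2 * M2) * ?q y - 2 * r\<^sup>2 * M1 * (?X y * ?q y) + r\<^sup>2 * M 0 * ((?X y)\<^sup>2 * ?q y) \<partial>Rd_leb d)
        = (2 * M 0 + r\<^sup>2 * M2) * M 0 - 2 * r\<^sup>2 * M1 * M1 + r\<^sup>2 * M 0 * M2"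
      using ints by (simp add: M0[symmetric] M1_def[symmetric] M2_def[symmetric])
    then show ?thesis by (simp add: algebra_simps)
  qed
  also have "\<dots> \<le> (\<integral>y. M r * (exp (- r * ?X y) * ?q y) + M (- r) * (exp (r * ?X y) * ?q y) \<partial>Rd_leb d)"
  proof (rule integral_mono)
    fix y assume "y \<in> space (Rd_leb d)"
    then have y: "0 \<le> ?q y" by (simp add: space_Rd_leb tilt_nonneg)
    show "(2 * M 0 + r\<^sup>2 * M2) * ?q y - 2 * r\<^sup>2 * M1 * (?X y * ?q y) + r\<^sup>2 * M 0 * ((?X y)\<^sup>2 * ?q y)
        \<le> M r * (exp (- r * ?X y) * ?q y) + M (- r) * (exp (r * ?X y) * ?q y)"
      using mult_right_mono[OF inner[of "?X y"] y] by (simp add: algebra_simps)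
  qed (use ints ints(2)[of "- r" w b] in auto)
  also have "\<dots> = 2 * (M r * M (- r))"
    using ints(2)[of r w b] ints(2)[of "- r" w b] by (simp add: Mexp[of r] Mexp[of "- r"])
  finally show ?thesis by (simp add: power2_eq_square algebra_simps)
qed

text \<open>Prekopa-Leindler applied to the two opposite exponential tilts of the density.\<close>

lemma laplace_product_le:
  fixes b w :: "nat \<Rightarrow> real"
  assumes k: "0 < k" and r: "0 \<le> r" and w: "Rd_norm d w = 1"
    and wlc: "weakly_log_concave d \<alpha> \<beta> K p" and K: "0 \<le> K" and \<beta>: "0 \<le> \<beta>"
    and E: "\<And>\<rho>. 0 \<le> \<rho> \<Longrightarrow> 2 * K * \<rho> powr \<beta> - (\<alpha> + k) / 4 * \<rho>\<^sup>2 + r * \<rho> \<le> E"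
  defines "M \<equiv> \<lambda>r. \<integral>y. tilt d p k (\<lambda>i. b i + r * w i) y \<partial>Rd_leb d"
  shows "M r * M (- r) \<le> (M 0)\<^sup>2 * exp E"
proof -
  obtain U where U [measurable]: "U \<in> sets (Rd_leb d)" and ae: "AE y in Rd_leb d. y \<notin> U \<longrightarrow> p y = 0"
    and mid: "\<And>x y. x \<in> U \<Longrightarrow> y \<in> U \<Longrightarrow> p x * p y \<le> (p (Rd_mid d x y))\<^sup>2 *
       exp (2 * K * Rd_norm d (\<lambda>i. x i - y i) powr \<beta> - \<alpha> / 4 * (Rd_norm d (\<lambda>i. x i - y i))\<^sup>2)"
    using weakly_log_concave_midpoint[OF density wlc K \<beta>] by auto
  let ?t = "\<lambda>r. tilt d p k (\<lambda>i. b i + r * w i)"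
  \<comment> \<open>The cut-off to \<open>U\<close> makes the midpoint bound hold for all pairs of
    points and costs nothing, as \<open>p\<close> vanishes almost everywhere outside.\<close>
  have nn: "(\<integral>\<^sup>+y. ennreal (?t r y * indicator U y) \<partial>Rd_leb d) = ennreal (M r)" for r
  proof -
    have "(\<integral>\<^sup>+y. ennreal (?t r y * indicator U y) \<partial>Rd_leb d) = (\<integral>\<^sup>+y. ennreal (?t r y) \<partial>Rd_leb d)"
      by (rule nn_integral_cong_AE) (use ae in eventually_elim, auto simp: indicator_def tilt_def)
    also have "\<dots> = ennreal (M r)"
      unfolding M_def by (rule nn_integral_eq_integral[OF tilt_integrable[OF k]])
        (auto intro!: AE_I2 tilt_nonneg simp: space_Rd_leb)
    finally show ?thesis .
  qed
  have Mnn: "0 \<le> M r" for r unfolding M_def using tilt_integral_pos[OF k] by (simp add: less_imp_le)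
  \<comment> \<open>The factor exp E is split evenly, since the midpoint function enters
    Prekopa-Leindler squared.\<close>
  have "ennreal (M r) * ennreal (M (- r)) \<le> (\<integral>\<^sup>+y. ennreal (exp (E / 2) * ?t 0 y) \<partial>Rd_leb d)\<^sup>2"
    unfolding nn[symmetric]
  proof (rule prekopa_leindler)
    fix x y assume xy: "x \<in> Rd d" "y \<in> Rd d"
    let ?m = "Rd_mid d x y"
    show "ennreal (?t r x * indicator U x) * ennreal (?t (- r) y * indicator U y) \<le> (ennreal (exp (E / 2) * ?t 0 ?m))\<^sup>2"
    proof (cases "x \<in> U \<and> y \<in> U")
      case True
      define \<rho> where "\<rho> = Rd_norm d (\<lambda>i. x i - y i)"
      have \<rho>: "0 \<le> \<rho>" by (simp add: \<rho>_def Rd_norm_nonneg)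
      have "r * (Rd_dot d w x - Rd_dot d w y) \<le> r * \<rho>"
        using Rd_dot_le_norm[of d w "\<lambda>i. x i - y i"] w r by (simp add: Rd_dot_diff_right \<rho>_def mult_left_mono)
      \<comment> \<open>The parallelogram identity turns the Gaussian factor into an extra - k
        \<rho>^2 / 4, so the moduli add up to \<alpha> + k. The \<open>b\<close> terms match
        exactly, and the opposite tilts leave at most r \<rho>.\<close>
      then have ex: "(Rd_dot d b x + r * Rd_dot d w x - k / 2 * Rd_dot d x x) + (Rd_dot d b y + (- r) * Rd_dot d w y - k / 2 * Rd_dot d y y)
          + (2 * K * \<rho> powr \<beta> - \<alpha> / 4 * \<rho>\<^sup>2) \<le> 2 * (Rd_dot d b ?m - k / 2 * Rd_dot d ?m ?m) + E"
      proof -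
        have "k / 2 * Rd_dot d x x + k / 2 * Rd_dot d y y = k * Rd_dot d ?m ?m + k / 4 * \<rho>\<^sup>2"
          using arg_cong[OF Rd_parallelogram[of d x y], of "\<lambda>u. k / 2 * u"] by (simp add: \<rho>_def algebra_simps)
        moreover have "Rd_dot d b x + Rd_dot d b y = 2 * Rd_dot d b ?m" by (simp add: Rd_dot_mid)
        moreover have "r * Rd_dot d w x - r * Rd_dot d w y \<le> r * \<rho>"
          using \<open>r * (Rd_dot d w x - Rd_dot d w y) \<le> r * \<rho>\<close> by (simp add: algebra_simps)
        moreover have "2 * K * \<rho> powr \<beta> - (\<alpha> / 4 * \<rho>\<^sup>2 + k / 4 * \<rho>\<^sup>2) + r * \<rho> \<le> E"
          using E[OF \<rho>] by (simp add: field_simps)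
        ultimately show ?thesis by (simp add: algebra_simps)
      qed
      have "?t r x * ?t (- r) y = p x * p y * exp ((Rd_dot d b x + r * Rd_dot d w x - k / 2 * Rd_dot d x x)
          + (Rd_dot d b y + (- r) * Rd_dot d w y - k / 2 * Rd_dot d y y))"
        unfolding tilt_def Rd_dot_add_scale exp_add by (simp only: mult.assoc mult.commute mult.left_commute)
      also have "\<dots> \<le> ((p ?m)\<^sup>2 * exp (2 * K * \<rho> powr \<beta> - \<alpha> / 4 * \<rho>\<^sup>2)) * exp ((Rd_dot d b x + r * Rd_dot d w x - k / 2 * Rd_dot d x x)
          + (Rd_dot d b y + (- r) * Rd_dot d w y - k / 2 * Rd_dot d y y))"
        using mid[of x y] True by (intro mult_right_mono) (auto simp: \<rho>_def)
      also have "\<dots> = (p ?m)\<^sup>2 * exp ((Rd_dot d b x + r * Rd_dot d w x - k / 2 * Rd_dot d x x)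
          + (Rd_dot d b y + (- r) * Rd_dot d w y - k / 2 * Rd_dot d y y) + (2 * K * \<rho> powr \<beta> - \<alpha> / 4 * \<rho>\<^sup>2))"
        by (simp only: exp_add mult.assoc mult.commute mult.left_commute)
      also have "\<dots> \<le> (p ?m)\<^sup>2 * exp (2 * (Rd_dot d b ?m - k / 2 * Rd_dot d ?m ?m) + E)"
        using ex by (intro mult_left_mono) auto
      also have "\<dots> = (exp (E / 2) * ?t 0 ?m)\<^sup>2"
        unfolding tilt_def Rd_dot_add_scale
        by (simp add: power_mult_distrib exp_add exp_double flip: exp_of_nat_mult)
      finally have "?t r x * ?t (- r) y \<le> (exp (E / 2) * ?t 0 ?m)\<^sup>2" .
      then show ?thesis
        using True tilt_nonneg[OF xy(1)] tilt_nonneg[OF xy(2)] tilt_nonneg[of ?m]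
        by (simp add: ennreal_power flip: ennreal_mult)
    qed auto
  qed measurable
  also have "(\<integral>\<^sup>+y. ennreal (exp (E / 2) * ?t 0 y) \<partial>Rd_leb d) = ennreal (exp (E / 2) * M 0)"
  proof -
    have "(\<integral>\<^sup>+y. ennreal (exp (E / 2) * ?t 0 y) \<partial>Rd_leb d) = ennreal (\<integral>y. exp (E / 2) * ?t 0 y \<partial>Rd_leb d)"
      by (rule nn_integral_eq_integral)
        (auto intro!: AE_I2 mult_nonneg_nonneg integrable_mult_right tilt_integrable k simp: space_Rd_leb tilt_nonneg)
    then show ?thesis by (simp add: M_def)
  qed
  finally have "M r * M (- r) \<le> (exp (E / 2) * M 0)\<^sup>2"
    using Mnn by (simp add: ennreal_power flip: ennreal_mult)
  also have "\<dots> = (M 0)\<^sup>2 * exp E" by (simp add: power_mult_distrib flip: exp_of_nat_mult)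
  finally show ?thesis .
qed

definition tilt_var :: "real \<Rightarrow> (nat \<Rightarrow> real) \<Rightarrow> (nat \<Rightarrow> real) \<Rightarrow> real" where
  "tilt_var k b w = tilt_mean d p k b (\<lambda>y. (Rd_dot d w y)\<^sup>2) - (tilt_mean d p k b (Rd_dot d w))\<^sup>2"

text \<open>\<open>M0 * M2 - M1\<^sup>2\<close> is the variance times \<open>M0\<^sup>2\<close>, so
  the lower and upper bounds on the product of Laplace transforms can be compared after dividing by
  the common square.\<close>

lemma tilt_var_le:
  assumes k: "0 < k" and r: "0 < r" and w: "Rd_norm d w = 1"
    and wlc: "weakly_log_concave d \<alpha> \<beta> K p" and K: "0 \<le> K" and \<beta>: "0 \<le> \<beta>"
    and E: "\<And>\<rho>. 0 \<le> \<rho> \<Longrightarrow> 2 * K * \<rho> powr \<beta> - (\<alpha> + k) / 4 * \<rho>\<^sup>2 + r * \<rho> \<le> E"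
  shows "tilt_var k b w \<le> (exp E - 1) / r\<^sup>2"
proof -
  define M0 where "M0 = (\<integral>y. tilt d p k b y \<partial>Rd_leb d)"
  define M1 where "M1 = (\<integral>y. Rd_dot d w y * tilt d p k b y \<partial>Rd_leb d)"
  define M2 where "M2 = (\<integral>y. (Rd_dot d w y)\<^sup>2 * tilt d p k b y \<partial>Rd_leb d)"
  have M0: "0 < M0" unfolding M0_def by (rule tilt_integral_pos[OF k])
  have "M0\<^sup>2 + r\<^sup>2 * (M0 * M2 - M1\<^sup>2) \<le> M0\<^sup>2 * exp E"
    using laplace_product_ge[OF k, of b w r] laplace_product_le[OF k less_imp_le[OF r] w wlc K \<beta> E, of b]
    by (simp add: M0_def M1_def M2_def)
  then have "r\<^sup>2 * (M0 * M2 - M1\<^sup>2) \<le> M0\<^sup>2 * (exp E - 1)" by (simp add: algebra_simps)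
  then have "(M0 * M2 - M1\<^sup>2) / M0\<^sup>2 \<le> (exp E - 1) / r\<^sup>2"
    using M0 r by (simp add: field_simps)
  moreover have "tilt_var k b w = (M0 * M2 - M1\<^sup>2) / M0\<^sup>2"
    using M0 by (simp add: tilt_var_def tilt_mean_def M0_def M1_def M2_def power_divide diff_divide_distrib power2_eq_square)
  ultimately show ?thesis by simp
qed

end

section \<open>Choice of the tilt strength r\<close>

lemma powr_le_1_plus_square:
  fixes x \<beta> :: real
  assumes "0 \<le> x" "0 \<le> \<beta>" "\<beta> \<le> 2"
  shows "x powr \<beta> \<le> 1 + x\<^sup>2"
proof (cases "x \<le> 1")
  case True
  then have "x powr \<beta> \<le> 1" using assms by (intro powr_le1) auto
  then show ?thesis using zero_le_power2[of x] by linarith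
next
  case False
  then have "x powr \<beta> \<le> x powr 2" using assms by (intro powr_mono) auto
  then show ?thesis using False by (simp add: powr_numeral)
qed

text \<open>The two regimes are \<open>\<kappa>\<close> large, with \<open>r\<^sup>2 = \<kappa> powr (1 - \<beta>/4)\<close>, and \<open>\<kappa>\<close> bounded, with \<open>r\<^sup>2 = \<kappa>\<close>.\<close>

lemma exponent_choice:
  fixes \<alpha> \<beta> K :: real
  assumes \<alpha>: "0 < \<alpha>" and K: "0 \<le> K" and \<beta>: "0 < \<beta>" "\<beta> \<le> 1"
  shows "\<exists>C\<ge>0. \<forall>\<kappa>\<ge>\<alpha>. \<exists>r>0. \<exists>E. (\<forall>\<rho>\<ge>0. 2 * K * \<rho> powr \<beta> - \<kappa> / 4 * \<rho>\<^sup>2 + r * \<rho> \<le> E) \<and>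
    (exp E - 1) / r\<^sup>2 \<le> 1 / \<kappa> * (1 + C * (1 / \<kappa>) powr (\<beta> / 4))"
proof -
  \<comment> \<open>Below this threshold \<eta> and K \<eta> are at most 1/16, which gives \<theta>
    \<le> 1/2 and E \<le> 1 in the first regime.\<close>
  define \<eta>0 where "\<eta>0 = 1 / (16 * (K + 1))"
  have \<eta>0: "0 < \<eta>0" using K by (simp add: \<eta>0_def)
  \<comment> \<open>Length scale beyond which the quadratic term wins: 2 K R powr (\<beta> - 2)
    \<le> 2 K / R \<le> \<alpha> / 8, half of the available \<alpha> / 4.\<close>
  define R where "R = max 1 (16 * K / \<alpha>)"
  have R: "1 \<le> R" "16 * K / \<alpha> \<le> R" by (auto simp: R_def)
  define E2 where "E2 = 2 * K * R powr \<beta> + 2"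
  \<comment> \<open>One entry per regime: the first collects 2 K + 16 K + 4 from the expansion of
    exp E, the second makes C \<eta> exceed exp E2 once \<eta> \<ge> \<eta>0.\<close>
  define C where "C = max (18 * K + 4) (exp E2 / \<eta>0)"
  have C0: "0 \<le> C" using K by (simp add: C_def le_max_iff_disj)
  show ?thesis
  proof (rule exI[of _ C], intro conjI C0 allI impI)
    fix \<kappa> assume \<kappa>: "\<alpha> \<le> \<kappa>"
    then have \<kappa>0: "0 < \<kappa>" using \<alpha> by linarith
    define \<eta> where "\<eta> = (1 / \<kappa>) powr (\<beta> / 4)"
    have \<eta>: "0 < \<eta>" using \<kappa>0 by (simp add: \<eta>_def)
    show "\<exists>r>0. \<exists>E. (\<forall>\<rho>\<ge>0. 2 * K * \<rho> powr \<beta> - \<kappa> / 4 * \<rho>\<^sup>2 + r * \<rho> \<le> E) \<and>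
      (exp E - 1) / r\<^sup>2 \<le> 1 / \<kappa> * (1 + C * (1 / \<kappa>) powr (\<beta> / 4))"
    proof (cases "\<eta> \<le> \<eta>0")
      case True
      then have K\<eta>: "(K + 1) * \<eta> \<le> 1 / 16" using K by (simp add: \<eta>0_def field_simps)
      have \<eta>16: "\<eta> \<le> 1 / 16" and K\<eta>16: "K * \<eta> \<le> 1 / 16"
        using K\<eta> \<eta> mult_nonneg_nonneg[OF K less_imp_le[OF \<eta>]] unfolding distrib_right by linarith+
      have K\<eta>2: "K * \<eta>\<^sup>2 \<le> 1 / 256"
      proof -
        have "K * \<eta>\<^sup>2 = (K * \<eta>) * \<eta>" by (simp add: power2_eq_square)
        also have "\<dots> \<le> (1 / 16) * (1 / 16)" using K\<eta>16 \<eta>16 \<eta> K by (intro mult_mono) auto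
        finally show ?thesis by simp
      qed
      define r where "r = sqrt (\<eta> * \<kappa>)"
      have r: "0 < r" "r\<^sup>2 = \<eta> * \<kappa>" using \<eta> \<kappa>0 by (simp_all add: r_def)
      \<comment> \<open>The Hoelder term costs 2 K \<eta>^2 and the fraction \<theta> = 8 K \<eta>^2
        of the quadratic. Maximising r \<rho> against the remaining fraction gives \<eta> / (1 -
        \<theta>), at most \<eta> (1 + 2 \<theta>).\<close>
      define E where "E = 2 * K * \<eta>\<^sup>2 + \<eta> * (1 + 16 * K * \<eta>\<^sup>2)"
      have bound: "2 * K * \<rho> powr \<beta> - \<kappa> / 4 * \<rho>\<^sup>2 + r * \<rho> \<le> E" if \<rho>: "0 \<le> \<rho>" for \<rho>
      proof -
        have "\<eta>\<^sup>2 = (1 / \<kappa>) powr (\<beta> / 2)" using \<kappa>0 by (simp add: \<eta>_def power2_eq_square flip: powr_add)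
        also have "\<dots> = (1 / sqrt \<kappa>) powr \<beta>"
          using \<kappa>0 by (simp add: powr_divide powr_half_sqrt[symmetric] powr_powr)
        finally have \<eta>2: "\<eta>\<^sup>2 = (1 / sqrt \<kappa>) powr \<beta>" .
        \<comment> \<open>Measuring \<rho> in units of \<kappa>^(-1/2) extracts the small factor
          \<eta>^2 = \<kappa>^(-\<beta>/2).\<close>
        have "\<rho> powr \<beta> = (\<rho> * sqrt \<kappa>) powr \<beta> * \<eta>\<^sup>2"
          unfolding \<eta>2 using \<rho> \<kappa>0 by (simp flip: powr_mult)
        also have "\<dots> \<le> (1 + (\<rho> * sqrt \<kappa>)\<^sup>2) * \<eta>\<^sup>2"
          using \<rho> \<kappa>0 \<beta> by (intro mult_right_mono powr_le_1_plus_square) auto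
        finally have "\<rho> powr \<beta> \<le> (1 + \<rho>\<^sup>2 * \<kappa>) * \<eta>\<^sup>2" using \<kappa>0 by (simp add: power_mult_distrib)
        then have h1: "2 * K * \<rho> powr \<beta> \<le> 2 * K * ((1 + \<rho>\<^sup>2 * \<kappa>) * \<eta>\<^sup>2)" using K by (intro mult_left_mono) auto
        define \<theta> where "\<theta> = 8 * K * \<eta>\<^sup>2"
        have \<theta>: "0 \<le> \<theta>" "\<theta> \<le> 1 / 2" using K\<eta>2 K by (auto simp: \<theta>_def)
        have h2: "r * \<rho> \<le> \<eta> * (1 + 2 * \<theta>) + \<kappa> / 4 * (1 - \<theta>) * \<rho>\<^sup>2"
        proof -
          have "0 \<le> (r * (1 + 2 * \<theta>) - \<kappa> * \<rho> / 2)\<^sup>2 / (\<kappa> * (1 + 2 * \<theta>))" using \<kappa>0 \<theta> by simp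
          also have "\<dots> = r\<^sup>2 * (1 + 2 * \<theta>) / \<kappa> - r * \<rho> + \<kappa> / 4 * (1 / (1 + 2 * \<theta>)) * \<rho>\<^sup>2"
            using \<kappa>0 \<theta> by (simp add: power2_eq_square field_simps)
          finally have "r * \<rho> \<le> \<eta> * (1 + 2 * \<theta>) + \<kappa> / 4 * (1 / (1 + 2 * \<theta>)) * \<rho>\<^sup>2"
            using \<kappa>0 by (simp add: r(2))
          moreover have "1 / (1 + 2 * \<theta>) \<le> 1 - \<theta>"
          proof -
            have "\<theta> * (2 * \<theta>) \<le> \<theta> * 1" using \<theta> by (intro mult_left_mono) auto
            then have "1 \<le> (1 - \<theta>) * (1 + 2 * \<theta>)" by (simp add: algebra_simps)
            then show ?thesis using \<theta> by (simp add: pos_divide_le_eq)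
          qed
          then have "\<kappa> / 4 * (1 / (1 + 2 * \<theta>)) * \<rho>\<^sup>2 \<le> \<kappa> / 4 * (1 - \<theta>) * \<rho>\<^sup>2"
            using \<kappa>0 by (intro mult_right_mono mult_left_mono) auto
          ultimately show ?thesis by linarith
        qed
        have "2 * K * ((1 + \<rho>\<^sup>2 * \<kappa>) * \<eta>\<^sup>2) = 2 * K * \<eta>\<^sup>2 + \<kappa> / 4 * \<theta> * \<rho>\<^sup>2"
          by (simp add: \<theta>_def algebra_simps)
        moreover have "\<eta> * (1 + 2 * \<theta>) = \<eta> * (1 + 16 * K * \<eta>\<^sup>2)" by (simp add: \<theta>_def)
        moreover have "\<kappa> / 4 * (1 - \<theta>) * \<rho>\<^sup>2 = \<kappa> / 4 * \<rho>\<^sup>2 - \<kappa> / 4 * \<theta> * \<rho>\<^sup>2"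
          by (simp only: right_diff_distrib left_diff_distrib mult_1_right)
        ultimately show ?thesis using h1 h2 unfolding E_def by linarith
      qed
      have E0: "0 \<le> E" using K \<eta> by (simp add: E_def)
      have Eeq: "E = \<eta> * (1 + 2 * (K * \<eta>) + 16 * (K * \<eta>\<^sup>2))"
        by (simp add: E_def power2_eq_square algebra_simps)
      have E2: "E \<le> 2 * \<eta>" unfolding Eeq using K\<eta>16 K\<eta>2 \<eta> by (subst mult.commute) (intro mult_right_mono, auto)
      have E1: "E \<le> 1" using E2 \<eta>16 by simp
      have "exp E \<le> 1 + E + E\<^sup>2" by (rule exp_bound[OF E0 E1])
      then have "exp E - 1 \<le> E + E\<^sup>2" by simp
      also have "E\<^sup>2 \<le> (2 * \<eta>)\<^sup>2" by (rule power_mono[OF E2 E0])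
      finally have "exp E - 1 \<le> E + (2 * \<eta>)\<^sup>2" by simp
      also have "\<dots> = \<eta> * (1 + 2 * (K * \<eta>) + 16 * (K * \<eta>) * \<eta> + 4 * \<eta>)"
        by (simp add: Eeq power2_eq_square algebra_simps)
      also have "\<dots> \<le> \<eta> * (1 + C * \<eta>)"
      proof (intro mult_left_mono)
        have "(K * \<eta>) * \<eta> \<le> (K * \<eta>) * 1" using K \<eta> \<eta>16 by (intro mult_left_mono) auto
        moreover have "(18 * K + 4) * \<eta> \<le> C * \<eta>" using \<eta> by (intro mult_right_mono) (auto simp: C_def)
        ultimately show "1 + 2 * (K * \<eta>) + 16 * (K * \<eta>) * \<eta> + 4 * \<eta> \<le> 1 + C * \<eta>"
          by (simp add: algebra_simps)
      qed (use \<eta> in auto)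
      finally have "(exp E - 1) / r\<^sup>2 \<le> (\<eta> * (1 + C * \<eta>)) / r\<^sup>2" by (intro divide_right_mono) auto
      also have "\<dots> = 1 / \<kappa> * (1 + C * \<eta>)" using \<eta> \<kappa>0 by (simp add: r(2))
      finally show ?thesis using bound r(1) unfolding \<eta>_def by blast
    next
      case False
      \<comment> \<open>Here \<eta> > \<eta>0, so \<kappa> is bounded and the error term C \<eta>
        alone absorbs the whole bound; no sharp constant is at stake.\<close>
      define r where "r = sqrt \<kappa>"
      have r: "0 < r" "r\<^sup>2 = \<kappa>" using \<kappa>0 by (simp_all add: r_def)
      have bound: "2 * K * \<rho> powr \<beta> - \<kappa> / 4 * \<rho>\<^sup>2 + r * \<rho> \<le> E2" if \<rho>: "0 \<le> \<rho>" for \<rho>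
      proof -
        have "\<rho> powr \<beta> = R powr \<beta> * (\<rho> / R) powr \<beta>" using \<rho> R(1) by (simp flip: powr_mult)
        also have "\<dots> \<le> R powr \<beta> * (1 + (\<rho> / R)\<^sup>2)"
          using \<rho> R(1) \<beta> by (intro mult_left_mono powr_le_1_plus_square) auto
        also have "\<dots> = R powr \<beta> + (R powr \<beta> / R\<^sup>2) * \<rho>\<^sup>2" by (simp add: algebra_simps power_divide)
        finally have h: "\<rho> powr \<beta> \<le> R powr \<beta> + (R powr \<beta> / R\<^sup>2) * \<rho>\<^sup>2" .
        have "R powr \<beta> \<le> R powr 1" using \<beta> R(1) by (intro powr_mono) auto
        then have "R powr \<beta> / R\<^sup>2 \<le> R / R\<^sup>2" using R(1) by (intro divide_right_mono) auto
        also have "\<dots> = 1 / R" using R(1) by (simp add: power2_eq_square)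
        finally have "K * (R powr \<beta> / R\<^sup>2) \<le> K * (1 / R)" using K by (intro mult_left_mono) auto
        also have "\<dots> \<le> \<alpha> / 16" using R \<alpha> by (simp add: field_simps)
        also have "\<dots> \<le> \<kappa> / 16" using \<kappa> by simp
        finally have "K * (R powr \<beta> / R\<^sup>2) * \<rho>\<^sup>2 \<le> \<kappa> / 16 * \<rho>\<^sup>2" by (intro mult_right_mono) auto
        moreover have "K * \<rho> powr \<beta> \<le> K * R powr \<beta> + K * (R powr \<beta> / R\<^sup>2) * \<rho>\<^sup>2"
          using mult_left_mono[OF h K] by (simp only: distrib_left mult.assoc)
        ultimately have h1: "2 * K * \<rho> powr \<beta> \<le> 2 * K * R powr \<beta> + \<kappa> / 8 * \<rho>\<^sup>2" by linarith
        have "0 \<le> (r * \<rho> - 4)\<^sup>2" by simp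
        then have "8 * (r * \<rho>) \<le> r\<^sup>2 * \<rho>\<^sup>2 + 16" by (simp add: power2_eq_square algebra_simps)
        then have "r * \<rho> \<le> \<kappa> / 8 * \<rho>\<^sup>2 + 2" by (simp add: r(2))
        then show ?thesis using h1 unfolding E2_def by (simp add: algebra_simps)
      qed
      have "(exp E2 - 1) / r\<^sup>2 \<le> exp E2 / \<kappa>" using \<kappa>0 by (simp add: r(2) divide_right_mono)
      also have "\<dots> = 1 / \<kappa> * (exp E2 / \<eta>0 * \<eta>0)" using \<eta>0 by simp
      also have "\<dots> \<le> 1 / \<kappa> * (C * \<eta>)"
        using \<kappa>0 False \<eta>0 C0 by (intro mult_left_mono mult_mono) (auto simp: C_def)
      also have "\<dots> \<le> 1 / \<kappa> * (1 + C * \<eta>)" using \<kappa>0 by (intro mult_left_mono) auto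
      finally show ?thesis using bound r(1) unfolding \<eta>_def by blast
    qed
  qed
qed

text \<open>\<open>C\<close> comes from the one-variable problem in \<open>exponent_choice\<close>
  and is fixed before \<open>d\<close>, \<open>p\<close>, \<open>k\<close>, \<open>b\<close> and
  \<open>w\<close>; the final constant owes its independence of the dimension to this order.\<close>

lemma tilt_var_bound:
  fixes \<alpha> \<beta> K :: real
  assumes \<alpha>: "0 < \<alpha>" and K: "0 \<le> K" and \<beta>: "0 < \<beta>" "\<beta> \<le> 1"
  obtains C where "0 \<le> C"
    "\<And>d p k b w. prob_density_on d p \<Longrightarrow> weakly_log_concave d \<alpha> \<beta> K p \<Longrightarrow> 0 < k \<Longrightarrow> Rd_norm d w = 1 \<Longrightarrow>
      Rd_density.tilt_var d p k b w \<le> 1 / (\<alpha> + k) * (1 + C * (1 / (\<alpha> + k)) powr (\<beta> / 4))"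
proof -
  obtain C where C: "0 \<le> C" "\<And>\<kappa>. \<alpha> \<le> \<kappa> \<Longrightarrow> \<exists>r>0. \<exists>E. (\<forall>\<rho>\<ge>0. 2 * K * \<rho> powr \<beta> - \<kappa> / 4 * \<rho>\<^sup>2 + r * \<rho> \<le> E) \<and>
    (exp E - 1) / r\<^sup>2 \<le> 1 / \<kappa> * (1 + C * (1 / \<kappa>) powr (\<beta> / 4))"
    using exponent_choice[OF assms] by blast
  show ?thesis
  proof (rule that[OF C(1)])
    fix d p k b w
    assume H: "prob_density_on d p" "weakly_log_concave d \<alpha> \<beta> K p" "0 < (k::real)" "Rd_norm d w = 1"
    interpret Rd_density d p by standard (rule H(1))
    obtain r E where rE: "0 < r" "\<forall>\<rho>\<ge>0. 2 * K * \<rho> powr \<beta> - (\<alpha> + k) / 4 * \<rho>\<^sup>2 + r * \<rho> \<le> E"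
      "(exp E - 1) / r\<^sup>2 \<le> 1 / (\<alpha> + k) * (1 + C * (1 / (\<alpha> + k)) powr (\<beta> / 4))"
      using C(2)[of "\<alpha> + k"] H(3) by auto
    have "tilt_var k b w \<le> (exp E - 1) / r\<^sup>2"
      using rE(2) by (intro tilt_var_le[OF H(3) rE(1) H(4) H(2) K]) (use \<beta> in auto)
    with rE(3) show "tilt_var k b w \<le> 1 / (\<alpha> + k) * (1 + C * (1 / (\<alpha> + k)) powr (\<beta> / 4))" by linarith
  qed
qed

section \<open>The Jacobian of the velocity field\<close>

lemma exp_taylor1_bound: "\<bar>exp x - 1 - x\<bar> \<le> x\<^sup>2 * exp \<bar>x\<bar>" for x :: real
proof -
  have "\<bar>exp x - (\<Sum>m<2. x ^ m / fact m)\<bar> \<le> exp \<bar>x\<bar> * \<bar>x\<bar> ^ 2 / fact 2"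
  proof -
    obtain t where t: "\<bar>t\<bar> \<le> \<bar>x\<bar>" "exp x = (\<Sum>m<2. x ^ m / fact m) + exp t / fact 2 * x ^ 2"
      using Maclaurin_exp_le[of x 2] by auto
    then have "\<bar>exp x - (\<Sum>m<2. x ^ m / fact m)\<bar> = exp t / fact 2 * \<bar>x\<bar> ^ 2" by (simp add: abs_mult)
    also have "\<dots> \<le> exp \<bar>x\<bar> / fact 2 * \<bar>x\<bar> ^ 2"
      using t(1) by (intro mult_right_mono divide_right_mono) auto
    finally show ?thesis by simp
  qed
  then have "\<bar>exp x - 1 - x\<bar> \<le> exp \<bar>x\<bar> * x\<^sup>2 / 2" by (simp add: numeral_2_eq_2 algebra_simps)
  also have "\<dots> \<le> x\<^sup>2 * exp \<bar>x\<bar>" by simp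
  finally show ?thesis .
qed

definition Rd_axis :: "nat \<Rightarrow> nat \<Rightarrow> real" where
  "Rd_axis i = (\<lambda>j. if j = i then 1 else 0)"

lemma Rd_dot_axis: "i < d \<Longrightarrow> Rd_dot d (Rd_axis i) y = y i"
proof -
  assume i: "i < d"
  have "Rd_dot d (Rd_axis i) y = (\<Sum>j<d. if j = i then y j else 0)"
    unfolding Rd_dot_def by (intro sum.cong refl) (auto simp: Rd_axis_def)
  with i show ?thesis by simp
qed

lemma Rd_dot_eq_sum_axis: "Rd_dot d w y = (\<Sum>i<d. w i * Rd_dot d (Rd_axis i) y)"
  by (simp add: Rd_dot_axis) (simp add: Rd_dot_def)

context Rd_density
begin

text \<open>Differentiation under the integral through a quadratic remainder: for \<bar>h\<bar>
  \<le> 1 the error is at most h^2 times one fixed integral. The exponential bound on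
  \<open>F\<close> covers constants and linear functionals at once.\<close>

lemma tilt_integral_deriv_0:
  assumes k: "0 < k" and F [measurable]: "F \<in> borel_measurable (Rd_leb d)"
    and b: "\<And>y. y \<in> Rd d \<Longrightarrow> \<bar>F y\<bar> \<le> exp (Rd_dot d v y) + exp (- Rd_dot d v y)"
  shows "((\<lambda>h. \<integral>y. F y * tilt d p k (\<lambda>i. b i + h * w i) y \<partial>Rd_leb d) has_real_derivative
    (\<integral>y. F y * Rd_dot d w y * tilt d p k b y \<partial>Rd_leb d)) (at 0)"
proof -
  let ?X = "Rd_dot d w" and ?V = "Rd_dot d v" and ?q = "tilt d p k b"
  \<comment> \<open>The second factor is (exp X + exp (- X))^2; it dominates 1, \<bar>X\<bar>, exp
    (h X) and X^2 exp \<bar>X\<bar>, and expands into tilts.\<close>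
  let ?G = "\<lambda>y. (exp (?V y) + exp (- ?V y)) * (exp (2 * ?X y) + 2 + exp (- 2 * ?X y))"
  have Gint: "integrable (Rd_leb d) (\<lambda>y. ?G y * ?q y)"
  proof -
    have *: "integrable (Rd_leb d) (\<lambda>y. exp (s * ?V y) * (exp (t * ?X y) * ?q y))" for s t
      unfolding tilt_exp by (rule tilt_integrable[OF k])
    have "integrable (Rd_leb d) (\<lambda>y. exp (1 * ?V y) * (exp (2 * ?X y) * ?q y) + 2 * (exp (1 * ?V y) * (exp (0 * ?X y) * ?q y))
      + exp (1 * ?V y) * (exp (- 2 * ?X y) * ?q y) + exp (- 1 * ?V y) * (exp (2 * ?X y) * ?q y) + 2 * (exp (- 1 * ?V y) * (exp (0 * ?X y) * ?q y))
      + exp (- 1 * ?V y) * (exp (- 2 * ?X y) * ?q y))"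
      by (intro Bochner_Integration.integrable_add integrable_mult_right *)
    then show ?thesis by (simp add: algebra_simps)
  qed
  have G1: "1 \<le> exp (2 * x) + 2 + exp (- 2 * x)" for x :: real
    using exp_gt_zero[of "2 * x"] exp_gt_zero[of "- 2 * x"] by linarith
  have absle: "\<bar>x\<bar> \<le> exp x + exp (- x)" and sqle: "x\<^sup>2 \<le> exp x + exp (- x)" for x :: real
    using two_plus_square_le_exp[of x] zero_le_power2[of "\<bar>x\<bar> - 1"]
    by (auto simp: power2_eq_square algebra_simps)
  have ex2: "exp x * exp x = exp (2 * x)" for x :: real by (simp flip: exp_add)
  have prodle: "z * exp \<bar>x\<bar> \<le> exp (2 * x) + 2 + exp (- 2 * x)" if "z \<le> exp x + exp (- x)" for x z :: real
  proof -
    have "exp \<bar>x\<bar> \<le> exp x + exp (- x)" by (cases "0 \<le> x") auto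
    then have "z * exp \<bar>x\<bar> \<le> (exp x + exp (- x)) * exp \<bar>x\<bar>" using that by (intro mult_right_mono) auto
    also have "\<dots> \<le> (exp x + exp (- x)) * (exp x + exp (- x))"
      using \<open>exp \<bar>x\<bar> \<le> exp x + exp (- x)\<close> by (intro mult_left_mono) (auto intro: add_nonneg_nonneg)
    also have "\<dots> = exp (2 * x) + 2 + exp (- 2 * x)"
      using ex2[of x] ex2[of "- x"] by (simp add: algebra_simps flip: exp_add)
    finally show ?thesis .
  qed
  have Fb: "\<bar>F y * g\<bar> \<le> ?G y" if "y \<in> Rd d" "\<bar>g\<bar> \<le> exp (2 * ?X y) + 2 + exp (- 2 * ?X y)" for y g
    unfolding abs_mult using b[OF that(1)] that(2) by (intro mult_mono) auto
  have Fint: "integrable (Rd_leb d) (\<lambda>y. F y * ?q y)"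
    by (rule tilt_integrable_bound[OF k F _ Gint]) (use Fb[of _ 1] G1 in auto)
  have FXint: "integrable (Rd_leb d) (\<lambda>y. F y * ?X y * ?q y)"
  proof (rule tilt_integrable_bound[OF k _ _ Gint])
    fix y assume "y \<in> Rd d"
    moreover have "\<bar>?X y\<bar> \<le> exp (2 * ?X y) + 2 + exp (- 2 * ?X y)"
    proof -
      have "\<bar>?X y\<bar> * 1 \<le> \<bar>?X y\<bar> * exp \<bar>?X y\<bar>" by (intro mult_left_mono) auto
      also have "\<dots> \<le> exp (2 * ?X y) + 2 + exp (- 2 * ?X y)" by (rule prodle[OF absle])
      finally show ?thesis by simp
    qed
    ultimately show "\<bar>F y * ?X y\<bar> \<le> ?G y" by (rule Fb)
  qed measurable
  have FEint: "integrable (Rd_leb d) (\<lambda>y. F y * exp (h * ?X y) * ?q y)" if h: "\<bar>h\<bar> \<le> 1" for h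
  proof (rule tilt_integrable_bound[OF k _ _ Gint])
    fix y assume "y \<in> Rd d"
    moreover have "\<bar>exp (h * ?X y)\<bar> \<le> exp (2 * ?X y) + 2 + exp (- 2 * ?X y)"
    proof -
      have "\<bar>h * ?X y\<bar> \<le> 1 * \<bar>?X y\<bar>" unfolding abs_mult using h by (intro mult_right_mono) auto
      then have "exp (h * ?X y) \<le> 1 * exp \<bar>?X y\<bar>" by simp
      also have "\<dots> \<le> exp (2 * ?X y) + 2 + exp (- 2 * ?X y)"
        using two_plus_square_le_exp[of "?X y"] zero_le_power2[of "?X y"] by (intro prodle) linarith
      finally show ?thesis by simp
    qed
    ultimately show "\<bar>F y * exp (h * ?X y)\<bar> \<le> ?G y" by (rule Fb)
  qed measurable
  define B where "B = (\<integral>y. ?G y * ?q y \<partial>Rd_leb d)"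
  define I where "I h = (\<integral>y. F y * exp (h * ?X y) * ?q y \<partial>Rd_leb d)" for h
  define I' where "I' = (\<integral>y. F y * ?X y * ?q y \<partial>Rd_leb d)"
  have I0: "I 0 = (\<integral>y. F y * ?q y \<partial>Rd_leb d)" by (simp add: I_def)
  have quad: "\<bar>I h - I 0 - h * I'\<bar> \<le> h\<^sup>2 * B" if h: "\<bar>h\<bar> \<le> 1" for h
  proof -
    have "I h - I 0 - h * I' = (\<integral>y. F y * exp (h * ?X y) * ?q y - F y * ?q y - h * (F y * ?X y * ?q y) \<partial>Rd_leb d)"
      unfolding I0 unfolding I_def I'_def using FEint[OF h] Fint FXint by simp
    then have "\<bar>I h - I 0 - h * I'\<bar> \<le> (\<integral>y. \<bar>F y * exp (h * ?X y) * ?q y - F y * ?q y - h * (F y * ?X y * ?q y)\<bar> \<partial>Rd_leb d)"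
      by (simp only: integral_abs_bound)
    also have "\<dots> \<le> (\<integral>y. h\<^sup>2 * (?G y * ?q y) \<partial>Rd_leb d)"
    proof (rule integral_mono)
      show "integrable (Rd_leb d) (\<lambda>y. \<bar>F y * exp (h * ?X y) * ?q y - F y * ?q y - h * (F y * ?X y * ?q y)\<bar>)"
        using FEint[OF h] Fint FXint by (intro integrable_abs Bochner_Integration.integrable_diff integrable_mult_right)
      show "integrable (Rd_leb d) (\<lambda>y. h\<^sup>2 * (?G y * ?q y))" by (intro integrable_mult_right Gint)
      fix y assume "y \<in> space (Rd_leb d)"
      then have y: "y \<in> Rd d" by (simp add: space_Rd_leb)
      have "\<bar>exp (h * ?X y) - 1 - h * ?X y\<bar> \<le> (h * ?X y)\<^sup>2 * exp \<bar>h * ?X y\<bar>" by (rule exp_taylor1_bound)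
      also have "\<dots> \<le> (h * ?X y)\<^sup>2 * exp \<bar>?X y\<bar>"
      proof -
        have "\<bar>h * ?X y\<bar> \<le> 1 * \<bar>?X y\<bar>" unfolding abs_mult using h by (intro mult_right_mono) auto
        then show ?thesis by (intro mult_left_mono) auto
      qed
      also have "\<dots> = h\<^sup>2 * ((?X y)\<^sup>2 * exp \<bar>?X y\<bar>)" by (simp add: power_mult_distrib)
      finally have e: "\<bar>exp (h * ?X y) - 1 - h * ?X y\<bar> \<le> h\<^sup>2 * ((?X y)\<^sup>2 * exp \<bar>?X y\<bar>)" .
      have "\<bar>F y * exp (h * ?X y) * ?q y - F y * ?q y - h * (F y * ?X y * ?q y)\<bar>
          = \<bar>F y\<bar> * \<bar>exp (h * ?X y) - 1 - h * ?X y\<bar> * ?q y"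
      proof -
        have "F y * exp (h * ?X y) * ?q y - F y * ?q y - h * (F y * ?X y * ?q y)
            = F y * (exp (h * ?X y) - 1 - h * ?X y) * ?q y" by (simp add: algebra_simps)
        then show ?thesis using tilt_nonneg[OF y, of k b] by (simp add: abs_mult)
      qed
      also have "\<dots> \<le> \<bar>F y\<bar> * (h\<^sup>2 * ((?X y)\<^sup>2 * exp \<bar>?X y\<bar>)) * ?q y"
        using tilt_nonneg[OF y] by (intro mult_right_mono mult_left_mono e) auto
      also have "\<dots> = h\<^sup>2 * (\<bar>F y * ((?X y)\<^sup>2 * exp \<bar>?X y\<bar>)\<bar> * ?q y)" by (simp add: abs_mult)
      also have "\<dots> \<le> h\<^sup>2 * (?G y * ?q y)"
        using tilt_nonneg[OF y] prodle[OF sqle, of "?X y"]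
        by (intro mult_left_mono mult_right_mono Fb[OF y]) auto
      finally show "\<bar>F y * exp (h * ?X y) * ?q y - F y * ?q y - h * (F y * ?X y * ?q y)\<bar> \<le> h\<^sup>2 * (?G y * ?q y)" .
    qed
    also have "\<dots> = h\<^sup>2 * B" by (simp add: B_def)
    finally show ?thesis .
  qed
  have B0: "0 \<le> B" using quad[of 1] by simp
  have "(I has_real_derivative I') (at 0)"
    unfolding DERIV_def
  proof (rule LIM_I)
    fix r :: real assume r: "0 < r"
    define s where "s = min 1 (r / (B + 1))"
    have s: "0 < s" using r B0 by (simp add: s_def)
    have "\<bar>(I (0 + h) - I 0) / h - I'\<bar> < r" if h: "h \<noteq> 0" "\<bar>h\<bar> < s" for h
    proof -
      have "(I (0 + h) - I 0) / h - I' = (I h - I 0 - h * I') / h" using h(1) by (simp add: field_simps)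
      then have "\<bar>(I (0 + h) - I 0) / h - I'\<bar> = \<bar>I h - I 0 - h * I'\<bar> / \<bar>h\<bar>" by (simp only: abs_divide)
      also have "\<dots> \<le> (h\<^sup>2 * B) / \<bar>h\<bar>" using quad[of h] h by (intro divide_right_mono) (auto simp: s_def)
      also have "\<dots> = \<bar>h\<bar> * B" using h(1) by (simp add: power2_eq_square field_simps)
      also have "\<dots> \<le> \<bar>h\<bar> * (B + 1)" by (intro mult_left_mono) auto
      also have "\<dots> < r" using h(2) B0 by (simp add: s_def pos_less_divide_eq)
      finally show ?thesis .
    qed
    then show "\<exists>s>0. \<forall>h. h \<noteq> 0 \<and> norm (h - 0) < s \<longrightarrow> norm ((I (0 + h) - I 0) / h - I') < r"
      using s by (intro exI[of _ s]) auto
  qed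
  then show ?thesis
    by (simp add: I_def[abs_def] I'_def mult.assoc tilt_exp)
qed

section \<open>Covariances as derivatives of tilted means\<close>

definition tilt_cov :: "real \<Rightarrow> (nat \<Rightarrow> real) \<Rightarrow> (nat \<Rightarrow> real) \<Rightarrow> (nat \<Rightarrow> real) \<Rightarrow> real" where
  "tilt_cov k b v w = tilt_mean d p k b (\<lambda>y. Rd_dot d v y * Rd_dot d w y)
     - tilt_mean d p k b (Rd_dot d v) * tilt_mean d p k b (Rd_dot d w)"

text \<open>The quotient rule for numerator and normalising constant, whose derivatives are the
  mixed second moment and the mean: the usual exponential-family identity.\<close>

lemma tilt_mean_deriv_0:
  assumes k: "0 < k"
  shows "((\<lambda>h. tilt_mean d p k (\<lambda>i. b i + h * w i) (Rd_dot d v)) has_real_derivative tilt_cov k b v w) (at 0)"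
proof -
  let ?Z = "\<integral>y. tilt d p k b y \<partial>Rd_leb d"
  let ?N = "\<integral>y. Rd_dot d v y * tilt d p k b y \<partial>Rd_leb d"
  have Z: "0 < ?Z" by (rule tilt_integral_pos[OF k])
  have absle: "\<bar>x\<bar> \<le> exp x + exp (- x)" for x :: real
    using two_plus_square_le_exp[of x] zero_le_power2[of "\<bar>x\<bar> - 1"]
    by (auto simp: power2_eq_square algebra_simps)
  have dN: "((\<lambda>h. \<integral>y. Rd_dot d v y * tilt d p k (\<lambda>i. b i + h * w i) y \<partial>Rd_leb d) has_real_derivative
    (\<integral>y. Rd_dot d v y * Rd_dot d w y * tilt d p k b y \<partial>Rd_leb d)) (at 0)"
    by (rule tilt_integral_deriv_0[OF k, where v = v]) (auto intro: absle)
  have dZ: "((\<lambda>h. \<integral>y. tilt d p k (\<lambda>i. b i + h * w i) y \<partial>Rd_leb d) has_real_derivative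
    (\<integral>y. Rd_dot d w y * tilt d p k b y \<partial>Rd_leb d)) (at 0)"
    using tilt_integral_deriv_0[OF k, of "\<lambda>_. 1" "\<lambda>_. 0" b w] by (simp add: Rd_dot_def)
  show ?thesis
    unfolding tilt_mean_def[abs_def] tilt_cov_def
    by (rule DERIV_cong[OF DERIV_divide[OF dN dZ]])
       (use Z in \<open>simp_all add: tilt_mean_def diff_divide_distrib power2_eq_square\<close>)
qed

lemma tilt_product_integrable:
  assumes k: "0 < k"
  shows "integrable (Rd_leb d) (\<lambda>y. Rd_dot d v y * Rd_dot d w y * tilt d p k b y)"
proof (rule tilt_integrable_bound[OF k])
  show "integrable (Rd_leb d) (\<lambda>y. ((Rd_dot d v y)\<^sup>2 + (Rd_dot d w y)\<^sup>2) * tilt d p k b y)"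
    unfolding distrib_right by (intro Bochner_Integration.integrable_add tilt_square_integrable k)
  fix y
  have "2 * (\<bar>Rd_dot d v y\<bar> * \<bar>Rd_dot d w y\<bar>) \<le> (Rd_dot d v y)\<^sup>2 + (Rd_dot d w y)\<^sup>2"
    using zero_le_power2[of "\<bar>Rd_dot d v y\<bar> - \<bar>Rd_dot d w y\<bar>"]
    by (simp add: power2_diff)
  moreover have "0 \<le> \<bar>Rd_dot d v y\<bar> * \<bar>Rd_dot d w y\<bar>" by simp
  ultimately show "\<bar>Rd_dot d v y * Rd_dot d w y\<bar> \<le> (Rd_dot d v y)\<^sup>2 + (Rd_dot d w y)\<^sup>2"
    unfolding abs_mult by linarith
qed measurable

text \<open>The Jacobian is known through its entries, the bound through variances of linear
  functionals; bilinearity of the covariance connects the two.\<close>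

lemma tilt_var_eq_cov:
  assumes k: "0 < k"
  shows "tilt_var k b w = (\<Sum>i<d. \<Sum>j<d. tilt_cov k b (Rd_axis i) (Rd_axis j) * w i * w j)"
proof -
  let ?A = "\<lambda>i. Rd_dot d (Rd_axis i)" and ?q = "tilt d p k b" and ?Z = "\<integral>y. tilt d p k b y \<partial>Rd_leb d"
  let ?m = "\<lambda>i. tilt_mean d p k b (?A i)" and ?c = "\<lambda>i j. tilt_mean d p k b (\<lambda>y. ?A i y * ?A j y)"
  have m1: "tilt_mean d p k b (Rd_dot d w) = (\<Sum>i<d. w i * ?m i)"
  proof -
    have "(\<integral>y. Rd_dot d w y * ?q y \<partial>Rd_leb d) = (\<integral>y. (\<Sum>i<d. w i * (?A i y * ?q y)) \<partial>Rd_leb d)"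
      by (subst Rd_dot_eq_sum_axis) (simp add: sum_distrib_right mult.assoc)
    also have "\<dots> = (\<Sum>i<d. w i * (\<integral>y. ?A i y * ?q y \<partial>Rd_leb d))"
      using tilt_linear_integrable[OF k] by (subst Bochner_Integration.integral_sum) auto
    finally show ?thesis by (simp add: tilt_mean_def sum_divide_distrib)
  qed
  have m2: "tilt_mean d p k b (\<lambda>y. (Rd_dot d w y)\<^sup>2) = (\<Sum>i<d. \<Sum>j<d. w i * w j * ?c i j)"
  proof -
    have "(\<integral>y. (Rd_dot d w y)\<^sup>2 * ?q y \<partial>Rd_leb d) = (\<integral>y. (\<Sum>i<d. \<Sum>j<d. w i * w j * (?A i y * ?A j y * ?q y)) \<partial>Rd_leb d)"
      unfolding power2_eq_square Rd_dot_eq_sum_axis[of d w] sum_product unfolding sum_distrib_right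
      by (intro Bochner_Integration.integral_cong sum.cong refl) (simp only: mult.assoc mult.commute mult.left_commute)
    also have "\<dots> = (\<Sum>i<d. \<Sum>j<d. w i * w j * (\<integral>y. ?A i y * ?A j y * ?q y \<partial>Rd_leb d))"
      using tilt_product_integrable[OF k]
      by (subst Bochner_Integration.integral_sum) (auto simp: Bochner_Integration.integral_sum)
    finally show ?thesis by (simp add: tilt_mean_def sum_divide_distrib)
  qed
  have "tilt_var k b w = (\<Sum>i<d. \<Sum>j<d. w i * w j * ?c i j) - (\<Sum>i<d. w i * ?m i) * (\<Sum>j<d. w j * ?m j)"
    unfolding tilt_var_def m1 m2 by (simp only: power2_eq_square)
  also have "\<dots> = (\<Sum>i<d. \<Sum>j<d. w i * w j * ?c i j - (w i * ?m i) * (w j * ?m j))"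
    by (simp add: sum_product sum_subtractf)
  also have "\<dots> = (\<Sum>i<d. \<Sum>j<d. tilt_cov k b (Rd_axis i) (Rd_axis j) * w i * w j)"
    by (intro sum.cong refl) (simp add: tilt_cov_def algebra_simps)
  finally show ?thesis .
qed

lemma tilt_cov_sym: "tilt_cov k b v w = tilt_cov k b w v"
  by (simp add: tilt_cov_def mult.commute)

section \<open>The velocity field in terms of tilts\<close>

lemma posterior_weight_eq_tilt:
  assumes s: "s \<noteq> 0"
  shows "posterior_weight d p f s x y
    = exp (- Rd_dot d x x / (2 * s\<^sup>2)) * tilt d p (f\<^sup>2 / s\<^sup>2) (\<lambda>i. f / s\<^sup>2 * x i) y"
proof -
  have norm: "(Rd_norm d (\<lambda>i. x i - f * y i))\<^sup>2 = Rd_dot d x x - 2 * f * Rd_dot d x y + f\<^sup>2 * Rd_dot d y y"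
    unfolding Rd_norm_eq_dot unfolding Rd_dot_def
    by (simp add: sum_distrib_left power2_eq_square algebra_simps flip: sum.distrib sum_subtractf)
  have lin: "Rd_dot d (\<lambda>i. f / s\<^sup>2 * x i) y = f / s\<^sup>2 * Rd_dot d x y"
    by (simp add: Rd_dot_def sum_distrib_left mult.assoc)
  have key: "- (A - 2 * f * B + f\<^sup>2 * C) / (2 * S) = - A / (2 * S) + (f / S * B - f\<^sup>2 / S / 2 * C)"
    if "S \<noteq> 0" for A B C S :: real
    using that by (simp add: field_simps)
  have s2: "s\<^sup>2 \<noteq> 0" using s by simp
  show ?thesis
    unfolding posterior_weight_def tilt_def norm lin key[OF s2] exp_add by (simp only: mult.left_commute)
qed

text \<open>Collecting the terms in y leaves the coefficient f' - f s' / s, and the Gaussian factor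
  in \<open>x\<close> alone cancels between numerator and normalisation.\<close>

lemma velocity_eq_tilt_mean:
  assumes s: "0 < s" and f: "0 < f" and x: "x \<in> Rd d" and i: "i < d"
  shows "velocity d p f s f' s' x i = s' / s * x i
    + (f' - f * s' / s) * tilt_mean d p (f\<^sup>2 / s\<^sup>2) (\<lambda>i. f / s\<^sup>2 * x i) (Rd_dot d (Rd_axis i))"
proof -
  let ?b = "\<lambda>i. f / s\<^sup>2 * x i" and ?k = "f\<^sup>2 / s\<^sup>2"
  let ?c = "exp (- Rd_dot d x x / (2 * s\<^sup>2))" and ?q = "tilt d p ?k ?b"
  let ?Z = "\<integral>y. ?q y \<partial>Rd_leb d" and ?N = "\<integral>y. Rd_dot d (Rd_axis i) y * ?q y \<partial>Rd_leb d"
  have k: "0 < ?k" using s f by simp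
  have Z: "0 < ?Z" by (rule tilt_integral_pos[OF k])
  have W: "posterior_weight d p f s x y = ?c * ?q y" for y
    using s by (intro posterior_weight_eq_tilt) simp
  have "velocity d p f s f' s' x i
      = (\<integral>y. (?c * ?q y) * (s' / s * (x i - f * y i) + f' * y i) \<partial>Rd_leb d) / (\<integral>y. ?c * ?q y \<partial>Rd_leb d)"
    using velocity_eq(1)[OF density x i, of f s f' s'] unfolding W .
  also have "(\<integral>y. (?c * ?q y) * (s' / s * (x i - f * y i) + f' * y i) \<partial>Rd_leb d)
      = (\<integral>y. ?c * (s' / s * x i * ?q y + (f' - f * s' / s) * (Rd_dot d (Rd_axis i) y * ?q y)) \<partial>Rd_leb d)"
    using i s by (intro Bochner_Integration.integral_cong refl) (simp add: Rd_dot_axis field_simps)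
  also have "\<dots> = ?c * (s' / s * x i * ?Z + (f' - f * s' / s) * ?N)"
    using tilt_integrable[OF k, of ?b] tilt_linear_integrable[OF k, of "Rd_axis i" ?b] by simp
  also have "(\<integral>y. ?c * ?q y \<partial>Rd_leb d) = ?c * ?Z" by simp
  also have "?c * (s' / s * x i * ?Z + (f' - f * s' / s) * ?N) / (?c * ?Z)
      = s' / s * x i + (f' - f * s' / s) * (?N / ?Z)"
    using Z by (simp add: add_divide_distrib)
  finally show ?thesis by (simp only: tilt_mean_def)
qed

text \<open>Apart from the explicit linear term, \<open>x j\<close> enters only through
  \<open>b\<close>, with slope f / s^2 in direction \<open>Rd_axis j\<close>; the chain rule then
  produces the covariance.\<close>

lemma partial_deriv_velocity:
  assumes s: "0 < s" and f: "0 < f" and x: "x \<in> Rd d" and i: "i < d" and j: "j < d"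
  shows "partial_deriv j (\<lambda>x. velocity d p f s f' s' x i) x = s' / s * (if i = j then 1 else 0)
    + (f' - f * s' / s) * (f / s\<^sup>2) * tilt_cov (f\<^sup>2 / s\<^sup>2) (\<lambda>i. f / s\<^sup>2 * x i) (Rd_axis i) (Rd_axis j)"
proof -
  let ?b = "\<lambda>i. f / s\<^sup>2 * x i" and ?k = "f\<^sup>2 / s\<^sup>2" and ?A = "Rd_dot d (Rd_axis i)"
  let ?m = "\<lambda>h. tilt_mean d p ?k (\<lambda>i. ?b i + h * Rd_axis j i) ?A"
  have k: "0 < ?k" using s f by simp
  have eq: "velocity d p f s f' s' (x(j := h)) i = s' / s * (x(j := h)) i
      + (f' - f * s' / s) * ?m (f / s\<^sup>2 * (h - x j))" for h
  proof -
    have "(\<lambda>i. f / s\<^sup>2 * (x(j := h)) i) = (\<lambda>i. ?b i + f / s\<^sup>2 * (h - x j) * Rd_axis j i)"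
    proof
      fix l show "f / s\<^sup>2 * (x(j := h)) l = ?b l + f / s\<^sup>2 * (h - x j) * Rd_axis j l"
        by (cases "l = j") (simp_all add: Rd_axis_def right_diff_distrib)
    qed
    then show ?thesis
      using velocity_eq_tilt_mean[OF s f Rd_upd[OF x j] i, of f' s' h] by simp
  qed
  have "(?m has_real_derivative tilt_cov ?k ?b (Rd_axis i) (Rd_axis j)) (at (f / s\<^sup>2 * (x j - x j)))"
    using tilt_mean_deriv_0[OF k, of ?b "Rd_axis j" "Rd_axis i"] by simp
  then have "((\<lambda>h. ?m (f / s\<^sup>2 * (h - x j))) has_real_derivative
      tilt_cov ?k ?b (Rd_axis i) (Rd_axis j) * (f / s\<^sup>2)) (at (x j))"
  proof (rule DERIV_chain2)
    have "((\<lambda>h. f / s\<^sup>2 * (h - x j)) has_real_derivative f / s\<^sup>2 * (1 - 0)) (at (x j))"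
      by (intro DERIV_cmult DERIV_diff DERIV_ident DERIV_const)
    then show "((\<lambda>h. f / s\<^sup>2 * (h - x j)) has_real_derivative f / s\<^sup>2) (at (x j))" by simp
  qed
  moreover have "((\<lambda>h. (x(j := h)) i) has_real_derivative (if i = j then 1 else 0)) (at (x j))"
    by (cases "i = j") (auto intro!: derivative_eq_intros)
  ultimately have "((\<lambda>h. velocity d p f s f' s' (x(j := h)) i) has_real_derivative
      s' / s * (if i = j then 1 else 0) + (f' - f * s' / s) * (tilt_cov ?k ?b (Rd_axis i) (Rd_axis j) * (f / s\<^sup>2))) (at (x j))"
    unfolding eq by (intro DERIV_add DERIV_cmult)
  then show ?thesis unfolding partial_deriv_def by (simp add: DERIV_imp_deriv mult_ac)
qed

text \<open>Tilts decrease pointwise in \<open>k\<close>, so the one at the left endpoint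
  \<open>k0\<close> dominates all others.\<close>

lemma tilt_integral_continuous:
  assumes k0: "0 < k0" and F [measurable]: "F \<in> borel_measurable (Rd_leb d)"
    and int: "integrable (Rd_leb d) (\<lambda>y. F y * tilt d p k0 b y)"
  shows "continuous_on {k0..} (\<lambda>k. \<integral>y. F y * tilt d p k b y \<partial>Rd_leb d)"
  unfolding continuous_on_sequentially
proof (intro allI ballI impI, elim conjE)
  fix u :: "nat \<Rightarrow> real" and k
  assume u: "\<forall>n. u n \<in> {k0..}" "u \<longlonglongrightarrow> k" and k: "k \<in> {k0..}"
  show "((\<lambda>k. \<integral>y. F y * tilt d p k b y \<partial>Rd_leb d) \<circ> u) \<longlonglongrightarrow> (\<integral>y. F y * tilt d p k b y \<partial>Rd_leb d)"
    unfolding o_def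
  proof (rule integral_dominated_convergence[where w = "\<lambda>y. \<bar>F y * tilt d p k0 b y\<bar>"])
    show "AE y in Rd_leb d. (\<lambda>n. F y * tilt d p (u n) b y) \<longlonglongrightarrow> F y * tilt d p k b y"
      unfolding tilt_def by (intro AE_I2 tendsto_intros u(2)) simp_all
    show "AE y in Rd_leb d. norm (F y * tilt d p (u n) b y) \<le> \<bar>F y * tilt d p k0 b y\<bar>" for n
    proof (rule AE_I2)
      fix y assume "y \<in> space (Rd_leb d)"
      then have y: "y \<in> Rd d" by (simp add: space_Rd_leb)
      have "0 \<le> Rd_dot d y y" by (simp flip: Rd_norm_eq_dot)
      then have "tilt d p (u n) b y \<le> tilt d p k0 b y"
        unfolding tilt_def using u(1) p_nonneg[OF y]
        by (intro mult_left_mono) (auto intro!: mult_right_mono)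
      then show "norm (F y * tilt d p (u n) b y) \<le> \<bar>F y * tilt d p k0 b y\<bar>"
        using tilt_nonneg[OF y] by (auto simp: abs_mult intro!: mult_left_mono)
    qed
    show "(\<lambda>y. F y * tilt d p k b y) \<in> borel_measurable (Rd_leb d)" by measurable
    show "(\<lambda>y. F y * tilt d p (u n) b y) \<in> borel_measurable (Rd_leb d)" for n by measurable
    show "integrable (Rd_leb d) (\<lambda>y. \<bar>F y * tilt d p k0 b y\<bar>)" by (rule integrable_abs[OF int])
  qed
qed

lemma tilt_var_continuous: "continuous_on {0<..} (\<lambda>k. tilt_var k b w)"
proof -
  have closed: "continuous_on {k0..} (\<lambda>k. tilt_var k b w)" if k0: "0 < k0" for k0
  proof -
    have c: "continuous_on {k0..} (\<lambda>k. \<integral>y. F y * tilt d p k b y \<partial>Rd_leb d)"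
      if "F = (\<lambda>_. 1) \<or> F = Rd_dot d w \<or> F = (\<lambda>y. (Rd_dot d w y)\<^sup>2)" for F
      using that by (intro tilt_integral_continuous[OF k0])
        (auto simp: tilt_integrable[OF k0] tilt_linear_integrable[OF k0] tilt_square_integrable[OF k0])
    have nz: "\<forall>k\<in>{k0..}. (\<integral>y. tilt d p k b y \<partial>Rd_leb d) \<noteq> 0"
    proof
      fix k assume "k \<in> {k0..}"
      then have "0 < k" using k0 by auto
      from tilt_integral_pos[OF this, of b] show "(\<integral>y. tilt d p k b y \<partial>Rd_leb d) \<noteq> 0" by simp
    qed
    show ?thesis
      unfolding tilt_var_def tilt_mean_def
      using c[of "\<lambda>_. 1"] c[of "Rd_dot d w"] c[of "\<lambda>y. (Rd_dot d w y)\<^sup>2"] nz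
      by (intro continuous_intros) auto
  qed
  have "continuous_on {k0<..} (\<lambda>k. tilt_var k b w)" if "0 < k0" for k0
    by (rule continuous_on_subset[OF closed[OF that]]) auto
  then have "continuous_on (\<Union>k0\<in>{0<..}. {k0<..}) (\<lambda>k. tilt_var k b w)"
    by (intro continuous_on_open_UN) auto
  moreover have "(\<Union>k0\<in>{0<..}. {k0<..}) = {0::real<..}"
    by (auto intro: less_trans simp: Bex_def greaterThan_def) (metis dense)
  ultimately show ?thesis by simp
qed

end

section \<open>The largest eigenvalue as the maximum of the quadratic form\<close>

text \<open>For small \<open>e\<close> of the sign of \<open>a\<close> the linear term would win; e
  = a / n is small enough. It serves as the first-order condition at a maximiser.\<close>

lemma linear_term_zero:
  fixes a c :: real
  assumes "\<And>e. 2 * e * a + e\<^sup>2 * c \<le> 0"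
  shows "a = 0"
proof (rule ccontr)
  assume a: "a \<noteq> 0"
  define n where "n = \<bar>c\<bar> + 1"
  have n: "0 < n" "- c \<le> n" by (auto simp: n_def)
  have "2 * (a / n) * a + (a / n)\<^sup>2 * c = a\<^sup>2 / n\<^sup>2 * (2 * n + c)"
    using n by (simp add: power2_eq_square field_simps)
  moreover have "0 < a\<^sup>2 / n\<^sup>2 * (2 * n + c)" using a n by (intro mult_pos_pos) auto
  ultimately show False using assms[of "a / n"] by simp
qed

definition quad_form :: "nat \<Rightarrow> (nat \<Rightarrow> nat \<Rightarrow> real) \<Rightarrow> (nat \<Rightarrow> real) \<Rightarrow> real" where
  "quad_form d M w = (\<Sum>i<d. \<Sum>j<d. M i j * w i * w j)"

lemma quad_form_scale: "quad_form d M (\<lambda>i. r * w i) = r\<^sup>2 * quad_form d M w"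
  by (simp add: quad_form_def sum_distrib_left power2_eq_square mult_ac)

lemma quad_form_cong: "(\<And>i. i < d \<Longrightarrow> w i = w' i) \<Longrightarrow> quad_form d M w = quad_form d M w'"
  by (simp add: quad_form_def)

text \<open>The unit sphere is closed in the cube with sides [-1, 1], a compact product, and the
  form is continuous.\<close>

lemma quad_form_attains_max:
  assumes d: "1 \<le> d"
  shows "\<exists>w\<in>Rd d. Rd_norm d w = 1 \<and> (\<forall>v. Rd_norm d v = 1 \<longrightarrow> quad_form d M v \<le> quad_form d M w)"
proof -
  let ?B = "PiE {..<d} (\<lambda>_. {-1..1::real})"
  define S where "S = {w \<in> Rd d. Rd_norm d w = 1}"
  have comp: "continuous_map (Rd_top d) euclideanreal (\<lambda>w. w i)" if "i < d" for i
    using continuous_map_product_projection[of i "{..<d}" "\<lambda>_. euclideanreal"] that by simp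
  have cB: "compactin (Rd_top d) ?B" by (simp add: compactin_PiE)
  have "continuous_map (Rd_top d) euclideanreal (\<lambda>w. \<Sum>i<d. w i * w i)"
    by (intro continuous_map_sum continuous_map_real_mult comp) auto
  then have "closedin (Rd_top d) {w \<in> topspace (Rd_top d). (\<Sum>i<d. w i * w i) \<in> {1}}"
    by (rule closedin_continuous_map_preimage) simp
  moreover have "(\<Sum>i<d. w i * w i) = 1 \<longleftrightarrow> Rd_norm d w = 1" for w :: "nat \<Rightarrow> real"
    by (simp add: L2_set_def power2_eq_square)
  ultimately have clS: "closedin (Rd_top d) S" by (simp add: S_def)
  have "S \<subseteq> ?B"
  proof
    fix w assume w: "w \<in> S"
    have "\<bar>w i\<bar> \<le> 1" if "i < d" for i
      using member_le_L2_set[of "{..<d}" i "\<lambda>i. \<bar>w i\<bar>"] that w by (simp add: S_def L2_set_def)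
    then have "\<And>i. i < d \<Longrightarrow> - 1 \<le> w i \<and> w i \<le> 1" by (auto simp: abs_le_iff) 
    then show "w \<in> ?B" using w by (auto simp: S_def PiE_iff)
  qed
  then have cS: "compactin (Rd_top d) S" by (rule closed_compactin[OF cB _ clS])
  have "continuous_map (Rd_top d) euclideanreal (quad_form d M)"
    unfolding quad_form_def[abs_def]
    by (intro continuous_map_sum continuous_map_real_mult comp) auto
  from image_compactin[OF cS this] have cim: "compact (quad_form d M ` S)" by simp
  have "restrict (Rd_axis 0) {..<d} \<in> S"
  proof -
    have "(\<Sum>i<d. (restrict (Rd_axis 0) {..<d} i)\<^sup>2) = (\<Sum>i<d. if i = 0 then 1 else 0 :: real)"
      by (intro sum.cong refl) (auto simp: Rd_axis_def)
    also have "\<dots> = 1" using d by simp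
    finally show ?thesis by (simp add: S_def L2_set_def)
  qed
  then have "quad_form d M ` S \<noteq> {}" by auto
  from compact_attains_sup[OF cim this]
  obtain w where w: "w \<in> S" "\<And>v. v \<in> S \<Longrightarrow> quad_form d M v \<le> quad_form d M w" by auto
  have "quad_form d M v \<le> quad_form d M w" if v: "Rd_norm d v = 1" for v
  proof -
    have "restrict v {..<d} \<in> S" using v by (simp add: S_def L2_set_def)
    moreover have "quad_form d M (restrict v {..<d}) = quad_form d M v" by (rule quad_form_cong) simp
    ultimately show ?thesis using w(2) by metis
  qed
  then show ?thesis using w(1) by (auto simp: S_def)
qed

text \<open>Rayleigh's principle without diagonalisation: a maximiser on the sphere is an
  eigenvector by its first-order condition, and every eigenvalue is the value of the form at a
  normalised eigenvector.\<close>

lemma lambda_max_quad_form: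
  assumes d: "1 \<le> d" and sym: "\<And>i j. i < d \<Longrightarrow> j < d \<Longrightarrow> M i j = M j i"
  obtains w where "w \<in> Rd d" "Rd_norm d w = 1" "lambda_max (mat d d (\<lambda>(i, j). M i j)) = quad_form d M w"
    "\<And>v. Rd_norm d v = 1 \<Longrightarrow> quad_form d M v \<le> quad_form d M w"
proof -
  obtain w where w: "w \<in> Rd d" "Rd_norm d w = 1"
    and max: "\<And>v. Rd_norm d v = 1 \<Longrightarrow> quad_form d M v \<le> quad_form d M w"
    using quad_form_attains_max[OF d, of M] by auto
  define A where "A = mat d d (\<lambda>(i, j). M i j)"
  define \<mu> where "\<mu> = quad_form d M w"
  have A: "A \<in> carrier_mat d d" by (simp add: A_def)
  have symA: "(1/2) \<cdot>\<^sub>m (A + transpose_mat A) = A"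
    by (rule eq_matI) (auto simp: A_def sym)
  have ww: "Rd_dot d w w = 1" using w(2) by (simp flip: Rd_norm_eq_dot)
  have le: "quad_form d M v \<le> \<mu> * Rd_dot d v v" for v
  proof (cases "Rd_norm d v = 0")
    case True
    then have "v i = 0" if "i < d" for i using that by (simp add: L2_set_eq_0_iff)
    then have "quad_form d M v = 0" by (simp add: quad_form_def)
    then show ?thesis using True by (simp flip: Rd_norm_eq_dot)
  next
    case False
    then have n: "0 < Rd_norm d v" using Rd_norm_nonneg[where d = d and x = v] by linarith
    have "Rd_norm d (\<lambda>i. 1 / Rd_norm d v * v i) = 1" using n by (subst Rd_norm_scale) auto
    from max[OF this] have "(1 / Rd_norm d v)\<^sup>2 * quad_form d M v \<le> \<mu>" by (simp only: quad_form_scale \<mu>_def)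
    then show ?thesis using n by (simp add: field_simps power_divide flip: Rd_norm_eq_dot)
  qed
  have eig: "(\<Sum>j<d. M i j * w j) = \<mu> * w i" if i: "i < d" for i
  proof -
    define L where "L = (\<Sum>j<d. M i j * w j)"
    \<comment> \<open>Perturbing the maximiser along axis \<open>i\<close> and using the homogeneous
      bound \<open>le\<close> needs no renormalisation to the sphere.\<close>
    have "2 * e * (L - \<mu> * w i) + e\<^sup>2 * (M i i - \<mu>) \<le> 0" for e
    proof -
      let ?v = "\<lambda>l. w l + e * Rd_axis i l"
      have row: "(\<Sum>j<d. M l j * ?v j) = (\<Sum>j<d. M l j * w j) + e * M l i" for l
      proof -
        have "(\<Sum>j<d. M l j * ?v j) = (\<Sum>j<d. M l j * w j + (if j = i then e * M l i else 0))"
          by (intro sum.cong refl) (auto simp: Rd_axis_def algebra_simps)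
        then show ?thesis using i by (simp add: sum.distrib)
      qed
      have "quad_form d M ?v = (\<Sum>l<d. ?v l * (\<Sum>j<d. M l j * ?v j))"
        by (simp add: quad_form_def sum_distrib_left mult_ac)
      also have "\<dots> = (\<Sum>l<d. ?v l * ((\<Sum>j<d. M l j * w j) + e * M l i))" by (simp only: row)
      also have "\<dots> = (\<Sum>l<d. w l * (\<Sum>j<d. M l j * w j) + e * (M i l * w l)
          + (if l = i then e * ((\<Sum>j<d. M l j * w j) + e * M l i) else 0))"
      proof (rule sum.cong[OF refl])
        fix l assume "l \<in> {..<d}"
        then have "M l i = M i l" using sym i by simp
        then show "?v l * ((\<Sum>j<d. M l j * w j) + e * M l i) = w l * (\<Sum>j<d. M l j * w j) + e * (M i l * w l)
            + (if l = i then e * ((\<Sum>j<d. M l j * w j) + e * M l i) else 0)"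
          by (cases "l = i") (simp_all add: Rd_axis_def algebra_simps)
      qed
      also have "\<dots> = quad_form d M w + e * L + e * (L + e * M i i)"
        using i by (simp add: sum.distrib L_def quad_form_def sum_distrib_left mult_ac)
      finally have "quad_form d M ?v = \<mu> + 2 * e * L + e\<^sup>2 * M i i"
        by (simp add: \<mu>_def power2_eq_square algebra_simps)
      moreover have "Rd_dot d ?v ?v = 1 + 2 * e * w i + e\<^sup>2"
      proof -
        have "Rd_dot d (Rd_axis i) ?v = w i + e" using i by (simp only: Rd_dot_axis) (simp add: Rd_axis_def)
        moreover have "Rd_dot d w ?v = 1 + e * w i"
          using i by (subst Rd_dot_commute) (simp add: Rd_dot_add_scale ww Rd_dot_axis)
        ultimately show ?thesis
          unfolding Rd_dot_add_scale[of d w e "Rd_axis i" ?v] by (simp add: power2_eq_square algebra_simps)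
      qed
      ultimately show ?thesis using le[of ?v] by (simp add: algebra_simps)
    qed
    then have "L - \<mu> * w i = 0" by (rule linear_term_zero)
    then show ?thesis by (simp add: L_def)
  qed
  \<comment> \<open>\<open>Max\<close> is informative only on finite sets; the eigenvalues are roots
    of the monic characteristic polynomial.\<close>
  have evals: "{k. eigenvalue A k} \<subseteq> {k. poly (char_poly A) k = 0}"
    using eigenvalue_root_char_poly[OF A] by auto
  have fin: "finite {k. eigenvalue A k}"
  proof (rule finite_subset[OF evals])
    have "monic (char_poly A)" using degree_monic_char_poly[OF A] by simp
    then have "char_poly A \<noteq> 0" by auto
    then show "finite {k. poly (char_poly A) k = 0}" by (rule poly_roots_finite)
  qed
  have "eigenvalue A \<mu>"
    unfolding eigenvalue_def eigenvector_def
  proof (intro exI conjI)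
    show "vec d w \<in> carrier_vec (dim_row A)" using A by simp
    show "vec d w \<noteq> 0\<^sub>v (dim_row A)"
    proof
      assume "vec d w = 0\<^sub>v (dim_row A)"
      then have "w i = 0" if "i < d" for i using A that by (metis carrier_matD(1) index_vec index_zero_vec(1))
      then have "Rd_dot d w w = 0" by (simp add: Rd_dot_def)
      with ww show False by simp
    qed
    show "A *\<^sub>v vec d w = \<mu> \<cdot>\<^sub>v vec d w"
      by (rule eq_vecI) (auto simp: A_def scalar_prod_def atLeast0LessThan eig)
  qed
  moreover have "k \<le> \<mu>" if ev: "eigenvalue A k" for k
  proof -
    obtain v where v: "v \<in> carrier_vec d" "v \<noteq> 0\<^sub>v d" "A *\<^sub>v v = k \<cdot>\<^sub>v v"
      using ev A unfolding eigenvalue_def eigenvector_def by auto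
    let ?v = "\<lambda>i. v $ i"
    have row: "(\<Sum>j<d. M i j * ?v j) = k * ?v i" if i: "i < d" for i
    proof -
      have "(A *\<^sub>v v) $ i = (\<Sum>j<d. M i j * ?v j)"
        using i v(1) by (simp add: A_def scalar_prod_def atLeast0LessThan)
      then show ?thesis using i v by simp
    qed
    have "quad_form d M ?v = (\<Sum>i<d. ?v i * (\<Sum>j<d. M i j * ?v j))"
      by (simp add: quad_form_def sum_distrib_left mult_ac)
    also have "\<dots> = k * Rd_dot d ?v ?v" by (simp add: row Rd_dot_def sum_distrib_left mult_ac)
    finally have "k * Rd_dot d ?v ?v \<le> \<mu> * Rd_dot d ?v ?v" using le[of ?v] by simp
    moreover have "0 < Rd_dot d ?v ?v"
    proof -
      obtain i where i: "i < d" "?v i \<noteq> 0" using v(1,2) by (metis carrier_vecD eq_vecI index_zero_vec)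
      have "0 < ?v i * ?v i" using i(2) by (auto simp: zero_less_mult_iff linorder_neq_iff)
      also have "\<dots> \<le> Rd_dot d ?v ?v" unfolding Rd_dot_def using i(1) by (intro member_le_sum) auto
      finally show ?thesis .
    qed
    ultimately show ?thesis by simp
  qed
  ultimately have "Max {k. eigenvalue A k} = \<mu>" using fin by (intro Max_eqI) auto
  then have "lambda_max A = \<mu>" by (simp add: lambda_max_def symA)
  then show thesis using that[OF w _ max] by (simp add: A_def \<mu>_def)
qed

section \<open>Integrating over time\<close>

text \<open>Fatou's lemma for the difference quotients.\<close>

lemma nn_integral_deriv_mono_le:
  fixes F F' :: "real \<Rightarrow> real"
  assumes mono: "mono_on {0..1} F" and T: "T \<in> sets borel" "T \<subseteq> {0<..<1}"
    and der: "\<And>t. t \<in> T \<Longrightarrow> (F has_real_derivative F' t) (at t within {0..1})"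
  shows "(\<integral>\<^sup>+t. ennreal (F' t) * indicator T t \<partial>lborel) \<le> ennreal (F 1 - F 0)"
proof -
  note component_measurable [measurable del]
  \<comment> \<open>Constant continuation beyond [0, 1], so that shifted values exist; subtracting
    \<open>F 0\<close> makes it nonnegative.\<close>
  define H where "H t = F (max 0 (min 1 t)) - F 0" for t
  have monoH: "mono H"
    using mono by (auto simp: mono_def mono_on_def H_def)
  have Hm [measurable]: "H \<in> borel_measurable borel" by (rule borel_measurable_mono[OF monoH])
  have H0: "0 \<le> H t" and H1: "H t \<le> F 1 - F 0" for t
    using mono by (auto simp: mono_on_def H_def)
  have Hin: "H t = F t - F 0" if "t \<in> {0..1}" for t using that by (auto simp: H_def)
  \<comment> \<open>The increments integrate to the integral of \<open>H\<close> over
    [\<delta>, 1 + \<delta>] minus that over [0, 1]; only the last stretch of length \<delta> can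
    contribute. The common part is cancelled at the end, being finite.\<close>
  have incr: "(\<integral>\<^sup>+t. ennreal (H (t + \<delta>) - H t) * indicator {0..1} t \<partial>lborel) \<le> ennreal (\<delta> * (F 1 - F 0))"
    if \<delta>: "0 < \<delta>" for \<delta>
  proof -
    let ?I = "\<lambda>A. \<integral>\<^sup>+t. ennreal (H t) * indicator A t \<partial>lborel"
    have "(\<integral>\<^sup>+t. ennreal (H (t + \<delta>) - H t) * indicator {0..1} t \<partial>lborel) + ?I {0..1}
        = (\<integral>\<^sup>+t. ennreal (H (t + \<delta>)) * indicator {0..1} t \<partial>lborel)"
    proof (subst nn_integral_add[symmetric])
      have [measurable]: "(\<lambda>t. H (t + \<delta>)) \<in> borel_measurable borel"
        by (rule measurable_compose[OF _ Hm]) measurable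
      show "(\<lambda>t. ennreal (H (t + \<delta>) - H t) * indicator {0..1} t) \<in> borel_measurable lborel" by measurable
      show "(\<lambda>t. ennreal (H t) * indicator {0..1} t) \<in> borel_measurable lborel" by measurable
      show "(\<integral>\<^sup>+t. ennreal (H (t + \<delta>) - H t) * indicator {0..1} t + ennreal (H t) * indicator {0..1} t \<partial>lborel)
          = (\<integral>\<^sup>+t. ennreal (H (t + \<delta>)) * indicator {0..1} t \<partial>lborel)"
      proof (rule nn_integral_cong)
        fix t
        have "H t \<le> H (t + \<delta>)" using monoH \<delta> by (simp add: mono_def)
        then show "ennreal (H (t + \<delta>) - H t) * indicator {0..1} t + ennreal (H t) * indicator {0..1} t
            = ennreal (H (t + \<delta>)) * indicator {0..1} t"
          using H0[of t] by (simp add: indicator_def flip: ennreal_plus)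
      qed
    qed
    also have "\<dots> = ?I {\<delta>..1 + \<delta>}"
      by (subst nn_integral_real_affine[of _ 1 \<delta>])
         (auto intro!: nn_integral_cong simp: indicator_def add.commute)
    also have "\<dots> \<le> (\<integral>\<^sup>+t. ennreal (H t) * indicator {0..1} t + ennreal (F 1 - F 0) * indicator {1..1 + \<delta>} t \<partial>lborel)"
    proof (rule nn_integral_mono)
      fix t
      have "ennreal (H t) \<le> ennreal (F 1 - F 0)" by (intro ennreal_leI H1)
      then show "ennreal (H t) * indicator {\<delta>..1 + \<delta>} t \<le> ennreal (H t) * indicator {0..1} t + ennreal (F 1 - F 0) * indicator {1..1 + \<delta>} t"
        using \<delta> by (auto simp: indicator_def intro: add_increasing)
    qed
    also have "\<dots> = ?I {0..1} + ennreal (F 1 - F 0) * emeasure lborel {1..1 + \<delta>}"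
      by (subst nn_integral_add) (auto simp: nn_integral_cmult)
    also have "ennreal (F 1 - F 0) * emeasure lborel {1..1 + \<delta>} = ennreal (\<delta> * (F 1 - F 0))"
      using \<delta> order_trans[OF H0 H1] by (simp add: mult.commute flip: ennreal_mult)
    finally have le: "?I {0..1} + (\<integral>\<^sup>+t. ennreal (H (t + \<delta>) - H t) * indicator {0..1} t \<partial>lborel)
        \<le> ?I {0..1} + ennreal (\<delta> * (F 1 - F 0))" by (simp add: add.commute)
    have "?I {0..1} \<le> (\<integral>\<^sup>+t. ennreal (F 1 - F 0) * indicator {0..1::real} t \<partial>lborel)"
      by (intro nn_integral_mono mult_right_mono ennreal_leI H1) simp
    also have "\<dots> < \<infinity>" by (simp add: nn_integral_cmult)
    finally have "?I {0..1} \<noteq> \<infinity>" by simp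
    then show ?thesis using le by (simp add: ennreal_add_left_cancel_le)
  qed
  define u where "u n t = ennreal ((H (t + 1 / real (Suc n)) - H t) / (1 / real (Suc n))) * indicator {0..1} t" for n :: nat and t
  have um [measurable]: "u n \<in> borel_measurable lborel" for n unfolding u_def[abs_def] by measurable
  have uint: "(\<integral>\<^sup>+t. u n t \<partial>lborel) \<le> ennreal (F 1 - F 0)" for n
  proof -
    let ?N = "real (Suc n)"
    have "(\<integral>\<^sup>+t. u n t \<partial>lborel) = (\<integral>\<^sup>+t. ennreal ?N * (ennreal (H (t + 1 / ?N) - H t) * indicator {0..1} t) \<partial>lborel)"
    proof (rule nn_integral_cong)
      fix t
      have "H t \<le> H (t + 1 / ?N)" using monoH by (simp add: mono_def)
      moreover have "(H (t + 1 / ?N) - H t) / (1 / ?N) = ?N * (H (t + 1 / ?N) - H t)" by (simp add: mult.commute)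
      ultimately show "u n t = ennreal ?N * (ennreal (H (t + 1 / ?N) - H t) * indicator {0..1} t)"
        unfolding u_def by (simp only: ennreal_mult'[of ?N] of_nat_0_le_iff mult.assoc)
    qed
    also have "\<dots> = ennreal ?N * (\<integral>\<^sup>+t. ennreal (H (t + 1 / ?N) - H t) * indicator {0..1} t \<partial>lborel)"
      by (rule nn_integral_cmult) measurable
    also have "\<dots> \<le> ennreal ?N * ennreal (1 / ?N * (F 1 - F 0))"
      by (intro mult_left_mono incr) auto
    also have "\<dots> = ennreal (?N * (1 / ?N * (F 1 - F 0)))"
      using order_trans[OF H0 H1] by (intro ennreal_mult[symmetric]) auto
    also have "?N * (1 / ?N * (F 1 - F 0)) = F 1 - F 0" by simp
    finally show ?thesis .
  qed
  have lim: "(\<lambda>n. u n t) \<longlonglongrightarrow> ennreal (F' t)" if t: "t \<in> T" for t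
  proof -
    have t01: "0 < t" "t < 1" using t T(2) by auto
    have "at t within {0..1} = at t" using t01 by (intro at_within_interior) auto
    then have "(F has_real_derivative F' t) (at t)" using der[OF t] by simp
    then have D: "((\<lambda>h. (F (t + h) - F t) / h) \<longlongrightarrow> F' t) (at 0)" by (simp add: DERIV_def)
    have s: "filterlim (\<lambda>n. 1 / real (Suc n)) (at 0) sequentially"
      unfolding filterlim_at using LIMSEQ_Suc[OF lim_1_over_n] by (auto simp del: of_nat_Suc)
    have "(\<lambda>n. (F (t + 1 / real (Suc n)) - F t) / (1 / real (Suc n))) \<longlonglongrightarrow> F' t"
      by (rule filterlim_compose[OF D s])
    moreover have "\<forall>\<^sub>F n in sequentially. (F (t + 1 / real (Suc n)) - F t) / (1 / real (Suc n))
        = (H (t + 1 / real (Suc n)) - H t) / (1 / real (Suc n))"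
    proof -
      have "(\<lambda>n. 1 / real (Suc n)) \<longlonglongrightarrow> 0" by (intro LIMSEQ_Suc[OF lim_1_over_n])
      then have "\<forall>\<^sub>F n in sequentially. 1 / real (Suc n) < 1 - t" using t01 by (intro order_tendstoD) auto
      then show ?thesis
      proof eventually_elim
        fix n assume n: "1 / real (Suc n) < 1 - t"
        have "0 \<le> 1 / real (Suc n)" by simp
        then have "t + 1 / real (Suc n) \<in> {0..1}" using n t01 by auto
        then show "(F (t + 1 / real (Suc n)) - F t) / (1 / real (Suc n)) = (H (t + 1 / real (Suc n)) - H t) / (1 / real (Suc n))"
          using t01 by (simp only: Hin) (simp add: Hin)
      qed
    qed
    ultimately have "(\<lambda>n. (H (t + 1 / real (Suc n)) - H t) / (1 / real (Suc n))) \<longlonglongrightarrow> F' t"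
      by (rule Lim_transform_eventually)
    moreover have "indicator {0..1} t = (1 :: ennreal)" using t01 by simp
    ultimately show ?thesis unfolding u_def by (simp only: mult_1_right tendsto_ennrealI)
  qed
  have "(\<integral>\<^sup>+t. ennreal (F' t) * indicator T t \<partial>lborel) \<le> (\<integral>\<^sup>+t. liminf (\<lambda>n. u n t) \<partial>lborel)"
  proof (rule nn_integral_mono)
    fix t show "ennreal (F' t) * indicator T t \<le> liminf (\<lambda>n. u n t)"
      using lim_imp_Liminf[OF _ lim[of t]] by (cases "t \<in> T") auto
  qed
  also have "\<dots> \<le> liminf (\<lambda>n. \<integral>\<^sup>+t. u n t \<partial>lborel)" by (rule nn_integral_liminf) measurable
  also have "\<dots> \<le> ennreal (F 1 - F 0)"
    by (rule Liminf_le) (auto intro!: always_eventually uint)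
  finally show ?thesis .
qed

section \<open>The supremum over space of the largest eigenvalue\<close>

lemma tilt_cong: "(\<And>i. i < d \<Longrightarrow> b i = b' i) \<Longrightarrow> tilt d p k b = tilt d p k b'"
  by (simp add: tilt_def[abs_def] Rd_dot_def)

context Rd_density
begin

text \<open>A function of \<open>k\<close> alone, which reduces measurability in time to one real
  variable. The supremum is taken in the reals and is informative only under boundedness, hence the
  hypothesis \<open>ub\<close> below.\<close>

definition max_var :: "real \<Rightarrow> real" where
  "max_var k = (SUP (b, w)\<in>UNIV \<times> {w. Rd_norm d w = 1}. tilt_var k b w)"

lemma quad_form_velocity_jacobian:
  fixes f s f' s' :: real and x :: "nat \<Rightarrow> real"
  assumes s: "0 < s" and f: "0 < f" and x: "x \<in> Rd d"
  defines "M \<equiv> \<lambda>i j. partial_deriv j (\<lambda>x. velocity d p f s f' s' x i) x"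
  shows "quad_form d M w = s' / s * (Rd_norm d w)\<^sup>2
      + (f' - f * s' / s) * (f / s\<^sup>2) * tilt_var (f\<^sup>2 / s\<^sup>2) (\<lambda>i. f / s\<^sup>2 * x i) w"
    and "i < d \<Longrightarrow> j < d \<Longrightarrow> M i j = M j i"
proof -
  let ?k = "f\<^sup>2 / s\<^sup>2" and ?b = "\<lambda>i. f / s\<^sup>2 * x i" and ?c = "(f' - f * s' / s) * (f / s\<^sup>2)"
  let ?C = "\<lambda>i j. tilt_cov ?k ?b (Rd_axis i) (Rd_axis j)"
  have k: "0 < ?k" using s f by simp
  have M: "M i j = s' / s * (if i = j then 1 else 0) + ?c * ?C i j" if "i < d" "j < d" for i j
    unfolding M_def by (rule partial_deriv_velocity[OF s f x that])
  show "M i j = M j i" if "i < d" "j < d"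
    unfolding M[OF that] M[OF that(2,1)] tilt_cov_sym[of ?k ?b "Rd_axis i" "Rd_axis j"] by (simp only: eq_commute)
  have "quad_form d M w = (\<Sum>i<d. \<Sum>j<d. (if j = i then s' / s * (w i * w i) else 0) + ?c * (?C i j * w i * w j))"
    unfolding quad_form_def by (intro sum.cong refl) (auto simp: M algebra_simps)
  also have "\<dots> = s' / s * (\<Sum>i<d. w i * w i) + ?c * (\<Sum>i<d. \<Sum>j<d. ?C i j * w i * w j)"
    by (simp add: sum.distrib sum_distrib_left)
  finally show "quad_form d M w = s' / s * (Rd_norm d w)\<^sup>2 + ?c * tilt_var ?k ?b w"
    unfolding tilt_var_eq_cov[OF k] Rd_norm_eq_dot Rd_dot_def .
qed

text \<open>The map from \<open>x\<close> to f x / s^2 reaches every \<open>b\<close> on the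
  relevant coordinates, so the supremum over \<open>x\<close> becomes one over \<open>b\<close>. The
  signs of f' and s' make the coefficient of the variance nonnegative, so it can be pulled out of
  the supremum.\<close>

lemma SUP_lambda_max_velocity:
  assumes d: "1 \<le> d" and s: "0 < s" and f: "0 < f" and f': "0 \<le> f'" and s': "s' \<le> 0"
    and ub: "\<And>b w. Rd_norm d w = 1 \<Longrightarrow> tilt_var (f\<^sup>2 / s\<^sup>2) b w \<le> U"
  shows "(SUP x\<in>Rd d. ereal (lambda_max (jacobian_mat d (velocity d p f s f' s') x)))
      = ereal (s' / s + (f' - f * s' / s) * (f / s\<^sup>2) * max_var (f\<^sup>2 / s\<^sup>2))"
    and "max_var (f\<^sup>2 / s\<^sup>2) \<le> U"
proof -
  let ?k = "f\<^sup>2 / s\<^sup>2" and ?b = "\<lambda>x i. f / s\<^sup>2 * x i" and ?c = "(f' - f * s' / s) * (f / s\<^sup>2)"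
  let ?J = "jacobian_mat d (velocity d p f s f' s')"
  let ?S = "UNIV \<times> {w. Rd_norm d w = 1}"
  have c: "0 \<le> ?c"
  proof -
    have "f * s' / s \<le> 0" using f s s' by (simp add: divide_nonpos_pos mult_nonneg_nonpos)
    then show ?thesis using f' f s by (intro mult_nonneg_nonneg) auto
  qed
  have bdd: "bdd_above ((\<lambda>(b, w). tilt_var ?k b w) ` ?S)" by (rule bdd_aboveI[of _ U]) (auto intro: ub)
  have upper: "tilt_var ?k b w \<le> max_var ?k" if "Rd_norm d w = 1" for b w
    unfolding max_var_def using cSUP_upper[OF _ bdd, of "(b, w)"] that by simp
  have lam: "\<exists>w. Rd_norm d w = 1 \<and> lambda_max (?J x) = s' / s + ?c * tilt_var ?k (?b x) w"
    and lam_ge: "Rd_norm d v = 1 \<Longrightarrow> s' / s + ?c * tilt_var ?k (?b x) v \<le> lambda_max (?J x)"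
    if x: "x \<in> Rd d" for x v
  proof -
    note q = quad_form_velocity_jacobian[OF s f x, where f' = f' and s' = s']
    obtain w where w: "w \<in> Rd d" "Rd_norm d w = 1"
      "lambda_max (?J x) = quad_form d (\<lambda>i j. partial_deriv j (\<lambda>x. velocity d p f s f' s' x i) x) w"
      "\<And>v. Rd_norm d v = 1 \<Longrightarrow> quad_form d (\<lambda>i j. partial_deriv j (\<lambda>x. velocity d p f s f' s' x i) x) v
        \<le> quad_form d (\<lambda>i j. partial_deriv j (\<lambda>x. velocity d p f s f' s' x i) x) w"
      unfolding jacobian_mat_def by (rule lambda_max_quad_form[where M = "\<lambda>i j. partial_deriv j (\<lambda>x. velocity d p f s f' s' x i) x", OF d q(2)]) auto
    then show "\<exists>w. Rd_norm d w = 1 \<and> lambda_max (?J x) = s' / s + ?c * tilt_var ?k (?b x) w"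
      by (intro exI[of _ w]) (simp add: q(1))
    show "s' / s + ?c * tilt_var ?k (?b x) v \<le> lambda_max (?J x)" if "Rd_norm d v = 1"
      using w(3) w(4)[OF that] that by (simp add: q(1))
  qed
  obtain x0 where x0: "x0 \<in> Rd d" by (metis Rd_mid_in)
  obtain w0 where w0: "Rd_norm d w0 = 1" using lam[OF x0] by auto
  have ne: "?S \<noteq> {}" using w0 by auto
  show "max_var ?k \<le> U" unfolding max_var_def by (rule cSUP_least[OF ne]) (auto intro: ub)
  let ?T = "SUP x\<in>Rd d. ereal (lambda_max (?J x))"
  have le: "?T \<le> ereal (s' / s + ?c * max_var ?k)"
  proof (rule SUP_least)
    fix x assume "x \<in> Rd d"
    then obtain w where w: "Rd_norm d w = 1" and eq: "lambda_max (?J x) = s' / s + ?c * tilt_var ?k (?b x) w"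
      using lam by blast
    show "ereal (lambda_max (?J x)) \<le> ereal (s' / s + ?c * max_var ?k)"
      unfolding eq ereal_less_eq(3) by (intro add_left_mono mult_left_mono upper[OF w] c)
  qed
  have ge: "ereal (lambda_max (?J x)) \<le> ?T" if "x \<in> Rd d" for x by (rule SUP_upper[OF that])
  obtain T where T: "?T = ereal T"
    using le ge[OF x0] by (cases ?T) auto
  have all: "s' / s + ?c * tilt_var ?k b w \<le> T" if w: "Rd_norm d w = 1" for b w
  proof -
    \<comment> \<open>The point whose linear tilt agrees with \<open>b\<close> on the first
      \<open>d\<close> coordinates.\<close>
    define x where "x = (\<lambda>i\<in>{..<d}. s\<^sup>2 / f * b i)"
    have x: "x \<in> Rd d" by (simp add: x_def)
    have "tilt d p ?k (?b x) = tilt d p ?k b"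
      using s f by (intro tilt_cong) (simp add: x_def)
    then have "tilt_var ?k (?b x) w = tilt_var ?k b w" by (simp add: tilt_var_def tilt_mean_def)
    with lam_ge[OF x w] ge[OF x] show ?thesis unfolding T by simp
  qed
  have "s' / s + ?c * max_var ?k \<le> T"
  \<comment> \<open>Moving the coefficient across the supremum means dividing by it.\<close>
  proof (cases "?c = 0")
    case True
    show ?thesis using all[OF w0, of w0] by (simp only: True mult_zero_left)
  next
    case False
    with c have c: "0 < ?c" by (rule le_neq_trans[OF _ not_sym])
    have "max_var ?k \<le> (T - s' / s) / ?c"
      unfolding max_var_def
    proof (rule cSUP_least[OF ne], clarify)
      fix b w assume "Rd_norm d w = 1"
      then have "?c * tilt_var ?k b w \<le> T - s' / s" using all[of w b] by linarith
      then show "tilt_var ?k b w \<le> (T - s' / s) / ?c" using c by (simp only: pos_le_divide_eq mult.commute)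
    qed
    then have "max_var ?k * ?c \<le> T - s' / s" using c by (simp only: pos_le_divide_eq)
    then have "?c * max_var ?k \<le> T - s' / s" by (simp only: mult.commute)
    then show ?thesis by linarith
  qed
  then show "?T = ereal (s' / s + ?c * max_var ?k)" using le unfolding T by (intro antisym) auto
qed

text \<open>As a supremum of functions continuous in \<open>k\<close>, \<open>max_var\<close> is lower semicontinuous, so the
  uncountable supremum does no harm.\<close>

lemma max_var_measurable:
  assumes ub: "\<And>k b w. 0 < k \<Longrightarrow> Rd_norm d w = 1 \<Longrightarrow> tilt_var k b w \<le> U k"
    and w0: "Rd_norm d w0 = 1"
  shows "(\<lambda>k. if 0 < k then max_var k else 0) \<in> borel_measurable borel"
proof (rule borel_measurableI_greater)
  fix y :: real
  let ?S = "UNIV \<times> {w. Rd_norm d w = 1}"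
  have "y < max_var k \<longleftrightarrow> (\<exists>b w. Rd_norm d w = 1 \<and> y < tilt_var k b w)" if k: "0 < k" for k
  proof -
    have "bdd_above ((\<lambda>(b, w). tilt_var k b w) ` ?S)" by (rule bdd_aboveI[of _ "U k"]) (auto intro: ub[OF k])
    then show ?thesis unfolding max_var_def using w0 by (subst less_cSUP_iff) auto
  qed
  then have eq: "{k \<in> space borel. y < (if 0 < k then max_var k else 0)}
      = (\<Union>b. \<Union>w\<in>{w. Rd_norm d w = 1}. {0<..} \<inter> (\<lambda>k. tilt_var k b w) -` {y<..}) \<union> (if y < 0 then {..0} else {})"
    by (auto split: if_splits)
  have "open ({0<..} \<inter> (\<lambda>k. tilt_var k b w) -` {y<..})" for b w
    by (rule continuous_open_preimage[OF tilt_var_continuous]) auto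
  then have "open (\<Union>b. \<Union>w\<in>{w. Rd_norm d w = 1}. {0<..} \<inter> (\<lambda>k. tilt_var k b w) -` {y<..})" by blast
  then show "{k \<in> space borel. y < (if 0 < k then max_var k else 0)} \<in> sets borel"
    unfolding eq by (intro sets.Un) auto
qed

end

section \<open>The pointwise bound in time\<close>

lemma mono_on_deriv_nonneg:
  fixes F :: "real \<Rightarrow> real"
  assumes mono: "mono_on {0..1} F" and t: "t \<in> {0<..<1}"
    and der: "(F has_real_derivative D) (at t within {0..1})"
  shows "0 \<le> D"
proof (rule ccontr)
  assume "\<not> 0 \<le> D"
  then have D: "D < 0" by simp
  have "at t within {0..1} = at t" using t by (intro at_within_interior) auto
  then have "(F has_real_derivative D) (at t)" using der by simp
  from DERIV_neg_dec_right[OF this D]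
  obtain e where e: "0 < e" "\<And>h. 0 < h \<Longrightarrow> h < e \<Longrightarrow> F (t + h) < F t" by auto
  define h where "h = min (e / 2) ((1 - t) / 2)"
  have h: "0 < h" "h < e" "t + h \<le> 1" using e t by (auto simp: h_def min_def field_simps)
  have "F t \<le> F (t + h)" using mono t h by (auto simp: mono_on_def)
  with e(2)[OF h(1,2)] show False by simp
qed

text \<open>The main terms combine to \<open>(\<alpha> s s' + f f') / (\<alpha> s\<^sup>2 + f\<^sup>2)\<close>, so the non-integrable
  contributions \<open>s' / s\<close> cancel; what remains is integrable because \<open>\<eta> > 0\<close>.\<close>

lemma velocity_growth_bound:
  fixes \<alpha> f s f' s' :: real
  assumes \<alpha>: "0 < \<alpha>" and f: "0 < f" "f \<le> 1" and s: "0 < s" "s \<le> 1" and f': "0 \<le> f'" and s': "s' \<le> 0"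
    and C: "0 \<le> C" and \<eta>: "0 < \<eta>" and c0: "0 < c0" "c0 \<le> \<alpha> * s\<^sup>2 + f\<^sup>2"
    and V: "V \<le> 1 / (\<alpha> + f\<^sup>2 / s\<^sup>2) * (1 + C * (1 / (\<alpha> + f\<^sup>2 / s\<^sup>2)) powr \<eta>)"
  shows "s' / s + (f' - f * s' / s) * (f / s\<^sup>2) * V
    \<le> (1 / c0 + C * (1 / c0) * (1 / c0) powr \<eta>) * (f' + - s' * s powr (2 * \<eta> - 1))"
proof -
  define D where "D = \<alpha> * s\<^sup>2 + f\<^sup>2"
  define m where "m = - s'"
  have m: "0 \<le> m" using s' by (simp add: m_def)
  have D: "0 < D" "c0 \<le> D" using c0 by (auto simp: D_def)
  have tau: "1 / (\<alpha> + f\<^sup>2 / s\<^sup>2) = s\<^sup>2 / D"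
    using s by (simp add: D_def field_simps)
  define R where "R = C * (s\<^sup>2 / D) powr \<eta>"
  \<comment> \<open>The variance contribution with the ideal bound 1 / \<kappa> = s^2 / D; the
    correction is \<open>N * R\<close>.\<close>
  define N where "N = (f' * s + f * m) * f / (s * D)"
  have N0: "0 \<le> N" using f s f' m D by (auto simp: N_def)
  have coef: "0 \<le> (f' - f * s' / s) * (f / s\<^sup>2)"
  proof -
    have "f * s' / s \<le> 0" using f s s' by (simp add: divide_nonpos_pos mult_nonneg_nonpos)
    then show ?thesis using f' f s by (intro mult_nonneg_nonneg) auto
  qed
  have "(f' - f * s' / s) * (f / s\<^sup>2) * V \<le> (f' - f * s' / s) * (f / s\<^sup>2) * (s\<^sup>2 / D * (1 + R))"
    using V unfolding tau R_def by (intro mult_left_mono coef)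
  also have "(f' - f * s' / s) * (f / s\<^sup>2) * (s\<^sup>2 / D * (1 + R)) = N + N * R"
    using s D by (simp add: N_def m_def field_simps power2_eq_square)
  finally have 1: "s' / s + (f' - f * s' / s) * (f / s\<^sup>2) * V \<le> s' / s + N + N * R" by simp
  \<comment> \<open>In the numerator - m D + f^2 m = - m \<alpha> s^2, so the denominator's factor s
    cancels.\<close>
  have "s' / s + N = (f' * f - m * \<alpha> * s) / D"
  proof -
    have "s' / s = - (m * D) / (s * D)" using D by (simp add: m_def)
    then have "s' / s + N = (- (m * D) + (f' * s + f * m) * f) / (s * D)"
      by (simp only: N_def add_divide_distrib)
    also have "- (m * D) + (f' * s + f * m) * f = s * (f' * f - m * \<alpha> * s)"
      by (simp add: D_def algebra_simps power2_eq_square)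
    finally show ?thesis using s by simp
  qed
  also have "\<dots> \<le> f' / D"
    using f f' m \<alpha> s D mult_left_le[OF f(2) f'] by (intro divide_right_mono) (auto intro: order_trans[of _ "f' * f"])
  also have "\<dots> \<le> f' / c0" using D c0 f' by (intro divide_left_mono) auto
  finally have 2: "s' / s + N \<le> f' / c0" .
  have powr0: "0 \<le> s powr (2 * \<eta> - 1)" "0 \<le> (1 / c0) powr \<eta>" by auto
  have sR: "s powr (2 * \<eta>) \<le> 1" using s \<eta> by (intro powr_le1) auto
  have s2: "(s\<^sup>2) powr \<eta> = s powr (2 * \<eta>)" using s by (simp add: powr_powr flip: powr_numeral)
  have R: "R \<le> C * (s powr (2 * \<eta>) * (1 / c0) powr \<eta>)"
  proof -
    have "(s\<^sup>2 / D) powr \<eta> = s powr (2 * \<eta>) * (1 / D) powr \<eta>"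
      using s D by (simp add: s2 powr_divide)
    also have "\<dots> \<le> s powr (2 * \<eta>) * (1 / c0) powr \<eta>"
      using D c0 \<eta> by (intro mult_left_mono powr_mono2) (auto intro!: divide_left_mono)
    finally show ?thesis unfolding R_def by (intro mult_left_mono C)
  qed
  \<comment> \<open>For the correction a bound with m / s is good enough, because \<open>R\<close>
    supplies the factor \<open>s powr (2 * \<eta>)\<close>.\<close>
  have N: "N \<le> (f' + m / s) / c0"
  proof -
    have "N = (f' + f * m / s) * f / D" using s D by (simp add: N_def field_simps)
    also have "\<dots> \<le> (f' + m / s) * 1 / D"
      using f f' m s D by (intro divide_right_mono mult_mono add_left_mono) (auto intro!: divide_right_mono mult_left_le_one_le)
    also have "\<dots> \<le> (f' + m / s) / c0" using f' m s D c0 by (simp add: divide_left_mono)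
    finally show ?thesis .
  qed
  have "N * R \<le> (f' + m / s) / c0 * (C * (s powr (2 * \<eta>) * (1 / c0) powr \<eta>))"
    using N R N0 f' m s c0 C by (intro mult_mono) (auto simp: R_def)
  also have "\<dots> = C * (1 / c0) * (1 / c0) powr \<eta> * (f' * s powr (2 * \<eta>) + m * (s powr (2 * \<eta>) / s))"
    by (simp add: field_simps)
  also have "s powr (2 * \<eta>) / s = s powr (2 * \<eta> - 1)" using s by (simp add: powr_diff)
  also have "C * (1 / c0) * (1 / c0) powr \<eta> * (f' * s powr (2 * \<eta>) + m * s powr (2 * \<eta> - 1))
      \<le> C * (1 / c0) * (1 / c0) powr \<eta> * (f' + m * s powr (2 * \<eta> - 1))"
    using C c0 mult_left_le[OF sR f'] by (intro mult_left_mono add_right_mono) auto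
  finally have 3: "N * R \<le> C * (1 / c0) * (1 / c0) powr \<eta> * (f' + m * s powr (2 * \<eta> - 1))" .
  have "f' / c0 \<le> 1 / c0 * (f' + m * s powr (2 * \<eta> - 1))" using c0 m by (simp add: field_simps)
  with 1 2 3 show ?thesis by (simp add: m_def distrib_right)
qed

text \<open>Derivatives within a nondegenerate closed interval are unique, so off \<open>N\<close>
  the derivative chosen by \<open>time_deriv\<close> is the continuous one.\<close>

lemma C1_ae_time_deriv:
  assumes "C1_ae f"
  obtains N where "closed N" "N \<in> null_sets lborel"
    "\<And>t. t \<in> {0..1} - N \<Longrightarrow> (f has_real_derivative time_deriv f t) (at t within {0..1})"
    "continuous_on ({0..1} - N) (time_deriv f)"
proof -
  obtain N f' where N: "closed N" "N \<in> null_sets lborel"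
    and der: "\<And>t. t \<in> {0..1} - N \<Longrightarrow> (f has_real_derivative f' t) (at t within {0..1})"
    and cont: "continuous_on ({0..1} - N) f'"
    using assms unfolding C1_ae_def by blast
  have eq: "time_deriv f t = f' t" if t: "t \<in> {0..1} - N" for t
    using der[OF t] t by (intro vector_derivative_within_closed_interval)
      (auto simp: has_real_derivative_iff_has_vector_derivative)
  have "continuous_on ({0..1} - N) (time_deriv f)"
    using cont by (rule continuous_on_eq) (simp add: eq)
  with that[OF N] show thesis using der eq by simp
qed

text \<open>The negative part, even if infinite, only lowers the value once the positive part is
  bounded.\<close>

lemma ereal_integral_le_nn_integral:
  assumes "(\<integral>\<^sup>+x. e2ennreal (g x) \<partial>M) \<le> ennreal C" and "0 \<le> C"
  shows "ereal_integral M g \<le> ereal C"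
proof -
  have "ereal_integral M g \<le> enn2ereal (\<integral>\<^sup>+x. e2ennreal (g x) \<partial>M)"
    unfolding ereal_integral_def by (rule ereal_diff_le_self) simp
  also have "\<dots> \<le> enn2ereal (ennreal C)" using assms(1) by (simp add: less_eq_ennreal.rep_eq)
  also have "\<dots> = ereal C" using assms(2) by (simp add: enn2ereal_ennreal)
  finally show ?thesis .
qed

text \<open>Outside \<open>T\<close> nothing is known about \<open>g\<close>; completeness of
  Lebesgue measure makes any behaviour on the null set harmless.\<close>

lemma borel_measurable_lebesgue_on_ae_borel:
  fixes g :: "real \<Rightarrow> ereal" and h :: "real \<Rightarrow> real"
  assumes T: "T \<in> sets borel" and h: "h \<in> borel_measurable (restrict_space borel T)"
    and gh: "\<And>t. t \<in> T \<Longrightarrow> g t = ereal (h t)" and S: "S \<in> sets borel" and null: "negligible (S - T)"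
  shows "g \<in> borel_measurable (lebesgue_on S)"
proof (rule measurableI)
  fix A :: "ereal set" assume A: "A \<in> sets borel"
  have "(\<lambda>t. ereal (h t)) \<in> borel_measurable (restrict_space borel T)" using h by simp
  from measurable_sets[OF this A]
  have "{t \<in> T. ereal (h t) \<in> A} \<in> sets borel"
    using T by (simp add: sets_restrict_space_iff space_restrict_space vimage_def Int_def conj_commute)
  then have "{t \<in> T. ereal (h t) \<in> A} \<inter> S \<in> sets lebesgue" using S by auto
  moreover have "g -` A \<inter> (S - T) \<in> sets lebesgue"
    using negligible_subset[OF null, of "g -` A \<inter> (S - T)"] by (auto simp: negligible_iff_null_sets)
  moreover have "g -` A \<inter> S = ({t \<in> T. ereal (h t) \<in> A} \<inter> S) \<union> (g -` A \<inter> (S - T))"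
    using gh by auto
  ultimately have "g -` A \<inter> S \<in> sets lebesgue" by simp
  then show "g -` A \<inter> space (lebesgue_on S) \<in> sets (lebesgue_on S)"
    using S by (simp add: sets_restrict_space_iff)
qed simp

section \<open>Assembling the bound on the time integral\<close>

context Rd_density
begin

text \<open>At almost every time the integrand is at most \<open>A\<close> times the derivative of f
  - (2/\<beta>) \<sigma> powr (\<beta>/2), which increases by 1 + 2/\<beta> over [0, 1]. This
  derivative is nonnegative, so the integral from \<open>z\<close> may be enlarged to all good
  times.\<close>

lemma time_integral_lambda_max:
  fixes \<alpha> \<beta> \<gamma> C :: real and f \<sigma> :: "real \<Rightarrow> real"
  assumes \<alpha>: "0 < \<alpha>" and \<beta>: "0 < \<beta>" and \<gamma>: "0 < \<gamma>" and C: "0 \<le> C" and d: "1 \<le> d"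
    and var: "\<And>k b w. 0 < k \<Longrightarrow> Rd_norm d w = 1 \<Longrightarrow>
      tilt_var k b w \<le> 1 / (\<alpha> + k) * (1 + C * (1 / (\<alpha> + k)) powr (\<beta> / 4))"
    and f: "C1_ae f" "strict_mono_on {0..1} f" "f 0 = 0" "f 1 = 1"
    and \<sigma>: "C1_ae \<sigma>" "strict_antimono_on {0..1} \<sigma>" "\<sigma> 0 = 1" "\<sigma> 1 = 0"
    and half: "\<gamma> \<le> \<sigma> (1/2)" "\<gamma> \<le> f (1/2)" and z: "z \<in> {0..1}"
  defines "c0 \<equiv> min \<alpha> 1 * \<gamma>\<^sup>2"
  defines "A \<equiv> 1 / c0 + C * (1 / c0) * (1 / c0) powr (\<beta> / 4)"
    and "g \<equiv> \<lambda>t. SUP x\<in>Rd d. ereal (lambda_max (jacobian_mat d (flow_matching_field d p f \<sigma> t) x))"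
  shows "g \<in> borel_measurable (lebesgue_on {z..1})"
    and "ereal_integral (lebesgue_on {z..1}) g \<le> ereal (A * (1 + 2 / \<beta>))"
proof -
  have c0: "0 < c0" using \<alpha> \<gamma> by (simp add: c0_def)
  have A: "0 \<le> A" using C c0 by (simp add: A_def)
  let ?f' = "time_deriv f" and ?s' = "time_deriv \<sigma>"
  obtain N1 where N1: "closed N1" "N1 \<in> null_sets lborel"
    and df: "\<And>t. t \<in> {0..1} - N1 \<Longrightarrow> (f has_real_derivative ?f' t) (at t within {0..1})"
    and cf: "continuous_on ({0..1} - N1) ?f'" by (rule C1_ae_time_deriv[OF f(1)]) blast
  obtain N2 where N2: "closed N2" "N2 \<in> null_sets lborel"
    and ds: "\<And>t. t \<in> {0..1} - N2 \<Longrightarrow> (\<sigma> has_real_derivative ?s' t) (at t within {0..1})"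
    and cs: "continuous_on ({0..1} - N2) ?s'" by (rule C1_ae_time_deriv[OF \<sigma>(1)]) blast
  \<comment> \<open>Good times: both derivatives exist and are continuous there, and without the
    endpoints \<open>f\<close> and \<sigma> are positive.\<close>
  define T where "T = {0<..<1} - (N1 \<union> N2)"
  have T: "T \<in> sets borel" "T \<subseteq> {0<..<1}"
    using N1(1) N2(1) by (auto simp: T_def intro!: sets.Diff borel_closed closed_Un)
  have nullT: "negligible ({z..1} - T)"
  proof (rule negligible_subset)
    show "negligible (N1 \<union> N2 \<union> {0, 1})"
      using null_sets_completionI[OF N1(2)] null_sets_completionI[OF N2(2)]
      by (auto simp: negligible_iff_null_sets)
    show "{z..1} - T \<subseteq> N1 \<union> N2 \<union> {0, 1}" using z by (auto simp: T_def)
  qed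
  have dfT: "(f has_real_derivative ?f' t) (at t within {0..1})"
    and dsT: "(\<sigma> has_real_derivative ?s' t) (at t within {0..1})" if "t \<in> T" for t
    using df[of t] ds[of t] that by (auto simp: T_def)
  have f_less: "f x < f y" and s_less: "\<sigma> y < \<sigma> x" if "x \<in> {0..1}" "y \<in> {0..1}" "x < y" for x y
    using f(2) \<sigma>(2) that by (auto simp: monotone_on_def)
  have f_le: "f x \<le> f y" and s_le: "\<sigma> y \<le> \<sigma> x" if "x \<in> {0..1}" "y \<in> {0..1}" "x \<le> y" for x y
    using f_less[of x y] s_less[of x y] that by (cases "x = y"; force)+
  have fT: "0 < f t" "f t \<le> 1" and sT: "0 < \<sigma> t" "\<sigma> t \<le> 1" if t: "t \<in> T" for t
    using f_less[of 0 t] f_le[of t 1] s_less[of t 1] s_le[of 0 t] t T(2) f \<sigma> by auto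
  have mono_f: "mono_on {0..1} f" using f_le by (auto simp: mono_on_def)
  have mono_neg: "mono_on {0..1} (\<lambda>t. - \<sigma> t)" using s_le by (auto simp: mono_on_def)
  have f'T: "0 \<le> ?f' t" and s'T: "?s' t \<le> 0" if t: "t \<in> T" for t
  proof -
    show "0 \<le> ?f' t" using mono_on_deriv_nonneg[OF mono_f _ dfT[OF t]] t T(2) by auto
    show "?s' t \<le> 0" using mono_on_deriv_nonneg[OF mono_neg _ DERIV_minus[OF dsT[OF t]]] t T(2) by auto
  qed
  \<comment> \<open>Up to time 1/2 monotonicity gives \<sigma> \<ge> \<gamma>, afterwards f \<ge>
    \<gamma>; one of the two summands always suffices.\<close>
  have c0T: "c0 \<le> \<alpha> * (\<sigma> t)\<^sup>2 + (f t)\<^sup>2" if t: "t \<in> T" for t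
  proof (cases "t \<le> 1/2")
    case True
    then have "\<gamma> \<le> \<sigma> t" using s_le[of t "1/2"] half t T(2) by auto
    then have "\<gamma>\<^sup>2 \<le> (\<sigma> t)\<^sup>2" using \<gamma> by (intro power_mono) auto
    then have "min \<alpha> 1 * \<gamma>\<^sup>2 \<le> \<alpha> * (\<sigma> t)\<^sup>2" using \<alpha> by (intro mult_mono) auto
    then show ?thesis unfolding c0_def by (rule add_increasing2[rotated]) simp
  next
    case False
    then have "\<gamma> \<le> f t" using f_le[of "1/2" t] half t T(2) by auto
    then have "\<gamma>\<^sup>2 \<le> (f t)\<^sup>2" using \<gamma> by (intro power_mono) auto
    then have "min \<alpha> 1 * \<gamma>\<^sup>2 \<le> 1 * (f t)\<^sup>2" using \<alpha> by (intro mult_mono) auto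
    then show ?thesis using \<alpha> unfolding c0_def by (simp add: add_increasing)
  qed
  \<comment> \<open>The value 0 for k \<le> 0 makes this a Borel function on the whole line; on
    \<open>T\<close> the argument is positive.\<close>
  define G where "G k = (if 0 < k then max_var k else 0)" for k
  define h where "h t = ?s' t / \<sigma> t + (?f' t - f t * ?s' t / \<sigma> t) * (f t / (\<sigma> t)\<^sup>2) * G ((f t)\<^sup>2 / (\<sigma> t)\<^sup>2)" for t
  have gh: "g t = ereal (h t)"
    and hle: "h t \<le> A * (?f' t + - ?s' t * \<sigma> t powr (\<beta> / 2 - 1))" if t: "t \<in> T" for t
  proof -
    let ?k = "(f t)\<^sup>2 / (\<sigma> t)\<^sup>2"
    have k: "0 < ?k" using fT[OF t] sT[OF t] by simp
    then have Gk: "G ?k = max_var ?k" by (simp add: G_def)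
    note sup = SUP_lambda_max_velocity[OF d sT(1)[OF t] fT(1)[OF t] f'T[OF t] s'T[OF t] var[OF k]]
    show "g t = ereal (h t)"
      unfolding g_def flow_matching_field_def h_def Gk by (rule sup(1))
    show "h t \<le> A * (?f' t + - ?s' t * \<sigma> t powr (\<beta> / 2 - 1))"
      using velocity_growth_bound[OF \<alpha> fT[OF t] sT[OF t] f'T[OF t] s'T[OF t] C _ c0 c0T[OF t] sup(2)] \<beta>
      unfolding h_def Gk A_def by simp
  qed
  let ?R = "restrict_space borel T"
  have Tsub: "T \<subseteq> {0..1}" "T \<subseteq> {0..1} - N1" "T \<subseteq> {0..1} - N2" using T(2) by (auto simp: T_def)
  have mR: "f \<in> borel_measurable ?R" "\<sigma> \<in> borel_measurable ?R"
    "?f' \<in> borel_measurable ?R" "?s' \<in> borel_measurable ?R"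
  proof -
    show "f \<in> borel_measurable ?R"
      by (intro borel_measurable_continuous_on_restrict DERIV_continuous_on)
         (rule DERIV_subset[OF dfT Tsub(1)])
    show "\<sigma> \<in> borel_measurable ?R"
      by (intro borel_measurable_continuous_on_restrict DERIV_continuous_on)
         (rule DERIV_subset[OF dsT Tsub(1)])
    show "?f' \<in> borel_measurable ?R"
      by (intro borel_measurable_continuous_on_restrict continuous_on_subset[OF cf Tsub(2)])
    show "?s' \<in> borel_measurable ?R"
      by (intro borel_measurable_continuous_on_restrict continuous_on_subset[OF cs Tsub(3)])
  qed
  obtain w0 where w0: "Rd_norm d w0 = 1"
    using quad_form_attains_max[OF d, of "\<lambda>_ _. 0"] by auto
  have Gm: "G \<in> borel_measurable borel"
    unfolding G_def[abs_def] by (rule max_var_measurable[OF var w0])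
  have kR: "(\<lambda>t. (f t)\<^sup>2 / (\<sigma> t)\<^sup>2) \<in> borel_measurable ?R"
    by (intro borel_measurable_divide borel_measurable_power mR)
  have hm: "h \<in> borel_measurable ?R"
    unfolding h_def[abs_def]
    by (intro borel_measurable_add borel_measurable_times borel_measurable_diff borel_measurable_divide
        borel_measurable_power mR measurable_compose[OF kR Gm])
  show "g \<in> borel_measurable (lebesgue_on {z..1})"
    by (rule borel_measurable_lebesgue_on_ae_borel[OF T(1) hm gh _ nullT]) auto
  \<comment> \<open>A primitive of - \<sigma>' \<sigma> powr (\<beta>/2 - 1), increasing from -
    2/\<beta> to 0 as \<sigma> falls from 1 to 0.\<close>
  let ?F = "\<lambda>t. - (2 / \<beta>) * \<sigma> t powr (\<beta> / 2)" and ?F' = "\<lambda>t. - ?s' t * \<sigma> t powr (\<beta> / 2 - 1)"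
  have s0: "0 \<le> \<sigma> t" if "t \<in> {0..1}" for t using s_le[of t 1] that \<sigma>(4) by auto
  have "(\<integral>\<^sup>+t. ennreal (?F' t) * indicator T t \<partial>lborel) \<le> ennreal (?F 1 - ?F 0)"
  proof (rule nn_integral_deriv_mono_le[OF _ T])
    show "mono_on {0..1} ?F"
      using \<beta> s_le s0 by (auto simp: mono_on_def intro!: divide_right_mono powr_mono2)
    fix t assume t: "t \<in> T"
    have "at t within {0..1} = at t" using t T(2) by (intro at_within_interior) auto
    then have "(\<sigma> has_real_derivative ?s' t) (at t)" using dsT[OF t] by simp
    from DERIV_cmult[OF DERIV_fun_powr[OF this sT(1)[OF t], of "\<beta> / 2"], of "- (2 / \<beta>)"]
    have "(?F has_real_derivative - (2 / \<beta>) * (\<beta> / 2 * \<sigma> t powr (\<beta> / 2 - of_nat 1) * ?s' t)) (at t)" .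
    moreover have "- (2 / \<beta>) * (\<beta> / 2 * \<sigma> t powr (\<beta> / 2 - of_nat 1) * ?s' t) = ?F' t"
      using \<beta> by simp
    ultimately show "(?F has_real_derivative ?F' t) (at t within {0..1})"
      by (simp only: has_field_derivative_at_within)
  qed
  also have "?F 1 - ?F 0 = 2 / \<beta>" using \<sigma> by simp
  finally have Is: "(\<integral>\<^sup>+t. ennreal (?F' t) * indicator T t \<partial>lborel) \<le> ennreal (2 / \<beta>)" .
  have If: "(\<integral>\<^sup>+t. ennreal (?f' t) * indicator T t \<partial>lborel) \<le> ennreal 1"
    using nn_integral_deriv_mono_le[OF mono_f T dfT] f by simp
  have meas: "(\<lambda>t. ennreal (u t) * indicator T t) \<in> borel_measurable lborel"
    if "u \<in> borel_measurable ?R" for u :: "real \<Rightarrow> real"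
    using borel_measurable_restrict_space_iff_ennreal[of T borel "\<lambda>t. ennreal (u t)"] that T(1) by simp
  have F'R: "?F' \<in> borel_measurable ?R"
    by (intro borel_measurable_times borel_measurable_uminus powr_real_measurable borel_measurable_const mR)
  have "(\<integral>\<^sup>+t. e2ennreal (g t) \<partial>lebesgue_on {z..1}) = (\<integral>\<^sup>+t. e2ennreal (g t) * indicator {z..1} t \<partial>lebesgue)"
    by (rule nn_integral_restrict_space) simp
  also have "\<dots> \<le> (\<integral>\<^sup>+t. ennreal A * (ennreal (?f' t) * indicator T t + ennreal (?F' t) * indicator T t) \<partial>lebesgue)"
  proof (rule nn_integral_mono_AE)
    have "AE t in lebesgue. t \<notin> {z..1} - T"
      using nullT by (intro AE_not_in) (simp add: negligible_iff_null_sets)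
    then show "AE t in lebesgue. e2ennreal (g t) * indicator {z..1} t
        \<le> ennreal A * (ennreal (?f' t) * indicator T t + ennreal (?F' t) * indicator T t)"
    proof eventually_elim
      fix t assume t: "t \<notin> {z..1} - T"
      show "e2ennreal (g t) * indicator {z..1} t
          \<le> ennreal A * (ennreal (?f' t) * indicator T t + ennreal (?F' t) * indicator T t)"
      proof (cases "t \<in> T")
        case True
        have nn: "0 \<le> ?f' t" "0 \<le> ?F' t" using f'T[OF True] s'T[OF True] by (auto intro: mult_nonpos_nonneg)
        have "e2ennreal (g t) * indicator {z..1} t \<le> e2ennreal (g t)" by (simp add: indicator_def)
        also have "\<dots> = ennreal (h t)" by (simp add: gh[OF True])
        also have "\<dots> \<le> ennreal (A * (?f' t + ?F' t))" by (rule ennreal_leI[OF hle[OF True]])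
        also have "\<dots> = ennreal A * (ennreal (?f' t) + ennreal (?F' t))"
          using nn A by (simp only: ennreal_mult ennreal_plus add_nonneg_nonneg)
        finally show ?thesis using True by simp
      qed (use t in auto)
    qed
  qed
  also have "\<dots> = (\<integral>\<^sup>+t. ennreal A * (ennreal (?f' t) * indicator T t + ennreal (?F' t) * indicator T t) \<partial>lborel)"
    by (rule nn_integral_completion)
  also have "\<dots> = ennreal A * (\<integral>\<^sup>+t. ennreal (?f' t) * indicator T t + ennreal (?F' t) * indicator T t \<partial>lborel)"
    by (intro nn_integral_cmult borel_measurable_add meas F'R mR)
  also have "(\<integral>\<^sup>+t. ennreal (?f' t) * indicator T t + ennreal (?F' t) * indicator T t \<partial>lborel)
      = (\<integral>\<^sup>+t. ennreal (?f' t) * indicator T t \<partial>lborel) + (\<integral>\<^sup>+t. ennreal (?F' t) * indicator T t \<partial>lborel)"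
    by (intro nn_integral_add meas F'R mR)
  also have "ennreal A * \<dots> \<le> ennreal A * (ennreal 1 + ennreal (2 / \<beta>))"
    by (intro mult_left_mono add_mono If Is) simp
  also have "\<dots> = ennreal (A * (1 + 2 / \<beta>))"
    using A \<beta> by (simp add: ennreal_mult flip: ennreal_1 ennreal_plus del: ennreal_1)
  finally show "ereal_integral (lebesgue_on {z..1}) g \<le> ereal (A * (1 + 2 / \<beta>))"
    by (rule ereal_integral_le_nn_integral) (use A \<beta> in simp)
qed

end

theorem corollary1:
  fixes \<alpha> K \<beta> \<gamma> s :: real
  assumes "0 < \<alpha>" and "0 < K" and "0 < \<beta>" and "\<beta> \<le> 1" and "0 < \<gamma>" and "\<gamma> < 1"
  shows "\<exists>C>0. \<forall>(d::nat) (p :: (nat \<Rightarrow> real) \<Rightarrow> real) (f :: real \<Rightarrow> real) (\<sigma> :: real \<Rightarrow> real).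
     1 \<le> d \<and>
     prob_density_on d p \<and> weakly_log_concave d \<alpha> \<beta> K p \<and>
     C1_ae f \<and> strict_mono_on {0..1} f \<and> f 0 = 0 \<and> f 1 = 1 \<and>
     C1_ae \<sigma> \<and> strict_antimono_on {0..1} \<sigma> \<and> \<sigma> 0 = 1 \<and> \<sigma> 1 = 0 \<and>
     \<gamma> \<le> min (\<sigma> (1/2)) (f (1/2)) \<and> (f (1 - \<gamma>))\<^sup>2 \<ge> \<sigma> (1 - \<gamma>) \<and> \<sigma> (1 - \<gamma>) = s
     \<longrightarrow> (let g = (\<lambda>t. SUP x\<in>Rd d. ereal (lambda_max (jacobian_mat d (flow_matching_field d p f \<sigma> t) x)))
          in \<forall>z\<in>{0..1}. g \<in> borel_measurable (lebesgue_on {z..1}) \<and>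
               ereal_integral (lebesgue_on {z..1}) g \<le> ereal C)"
proof -
  obtain C0 where C0: "0 \<le> C0"
    "\<And>d p k b w. prob_density_on d p \<Longrightarrow> weakly_log_concave d \<alpha> \<beta> K p \<Longrightarrow> 0 < k \<Longrightarrow> Rd_norm d w = 1 \<Longrightarrow>
      Rd_density.tilt_var d p k b w \<le> 1 / (\<alpha> + k) * (1 + C0 * (1 / (\<alpha> + k)) powr (\<beta> / 4))"
    by (rule tilt_var_bound[OF assms(1) less_imp_le[OF assms(2)] assms(3,4)]) blast
  define c0 where "c0 = min \<alpha> 1 * \<gamma>\<^sup>2"
  \<comment> \<open>Fixed before \<open>d\<close>, \<open>p\<close>, \<open>f\<close> and \<sigma>;
    \<open>K\<close> enters through \<open>C0\<close>, and \<gamma> through the lower bound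
    \<open>c0\<close> on \<alpha> \<sigma>^2 + f^2.\<close>
  define C where "C = (1 / c0 + C0 * (1 / c0) * (1 / c0) powr (\<beta> / 4)) * (1 + 2 / \<beta>)"
  have c0: "0 < c0" using assms by (simp add: c0_def)
  have C: "0 < C" unfolding C_def using c0 C0(1) assms(3)
    by (intro mult_pos_pos add_pos_nonneg) auto
  show ?thesis
  proof (rule exI[of _ C], intro conjI C allI impI, elim conjE)
    fix d :: nat and p :: "(nat \<Rightarrow> real) \<Rightarrow> real" and f \<sigma> :: "real \<Rightarrow> real"
    assume d: "1 \<le> d" and p: "prob_density_on d p" and wlc: "weakly_log_concave d \<alpha> \<beta> K p"
      and f: "C1_ae f" "strict_mono_on {0..1} f" "f 0 = 0" "f 1 = 1"
      and \<sigma>: "C1_ae \<sigma>" "strict_antimono_on {0..1} \<sigma>" "\<sigma> 0 = 1" "\<sigma> 1 = 0"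
      and half: "\<gamma> \<le> min (\<sigma> (1/2)) (f (1/2))"
    interpret Rd_density d p by standard (rule p)
    have half': "\<gamma> \<le> \<sigma> (1/2)" "\<gamma> \<le> f (1/2)" using half by auto
    note main = time_integral_lambda_max[OF assms(1,3,5) C0(1) d C0(2)[OF p wlc] f \<sigma> half']
    show "let g = (\<lambda>t. SUP x\<in>Rd d. ereal (lambda_max (jacobian_mat d (flow_matching_field d p f \<sigma> t) x)))
          in \<forall>z\<in>{0..1}. g \<in> borel_measurable (lebesgue_on {z..1}) \<and>
               ereal_integral (lebesgue_on {z..1}) g \<le> ereal C"
      unfolding Let_def C_def c0_def by (intro ballI conjI main)
  qed
qed

end
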